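(* Let $N\ge2$. The free $\mathbb Z[\delta,s_1,s_2]$-module on the set of all reduced diagrams with $N$ marked points on the upper and lower edges, with multiplication given by composition of diagrams, is an algebra isomorphic to the two-boundary Temperley-Lieb algebra over $\mathbb Z[\delta,s_1,s_2]$.
   Context: The two-boundary Temperley-Lieb (2BTL) algebra over $\mathbb Z[\delta,s_1,s_2]$ ($\delta,s_1,s_2$ indeterminates) is the unital associative algebra with generators $e_0,e_1,\dots,e_N$ and relations $e_i^2=\delta e_i$, $e_ie_{i\pm1}e_i=e_i$ for $1\le i\le N-1$ (with $i\pm1\in\{0,\dots,N\}$), $e_0^2=s_1e_0$, $e_N^2=s_2e_N$, $e_ie_j=e_je_i$ for $|i-j|>1$. Diagrams: take a rectangle with $N$ marked points on each of its upper and lower edges and an even number (possibly zero, and variable) of marked points on each of the left and right sides. Draw non-intersecting arcs inside the rectangle connecting the marked points in pairs, each marked point being used exactly once; lines connecting the left and right sides are permitted. Diagrams are considered up to smooth invertible maps preserving the edges. A diagram is reduced if no arc has both endpoints on the left side and no arc has both endpoints on the right side. In a non-reduced diagram, an arc with both endpoints on the left (right) side is called odd or even according to the parity of the number of marked points on that side lying below the lowest endpoint of the arc. Composition: for reduced diagrams $A,B$, the product $AB$ is obtained by placing $A$ directly below $B$, identifying the marked points on the common edge, and then: removing closed loops, each with a factor $\delta$; removing even arcs from a side to itself, each with factor $1$; removing odd arcs from the left side to itself, each with factor $s_1$; removing odd arcs from the right side to itself, each with factor $s_2$. *)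

theory Defs
  imports
    "HOL-Algebra.Algebraic_Closure_Type"
    "HOL-Algebra.QuotRing"
    "HOL-Library.Poly_Mapping"
    "HOL-Library.Disjoint_Sets"
begin

section \<open>The ground ring\<close>

text \<open>Integer polynomials in three indeterminates, as the monoid ring over \<open>\<int>\<close> of the
  monoid of monomials (exponent vectors) in \<open>\<delta>\<close>, \<open>s\<^sub>1\<close>, \<open>s\<^sub>2\<close>.\<close>

datatype indet = Delta | S1 | S2

type_synonym coeff = "(indet \<Rightarrow>\<^sub>0 nat) \<Rightarrow>\<^sub>0 int"

definition indet :: "indet \<Rightarrow> coeff" where
  "indet v = Poly_Mapping.single (Poly_Mapping.single v 1) 1"

definition ground_ring :: "coeff ring" where
  "ground_ring = ring_of_type_algebra"


section \<open>Unital associative algebras\<close>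

text \<open>The locale \<^locale>\<open>algebra\<close> of the library demands a commutative multiplication, so it
  cannot be used here.\<close>

definition assoc_algebra :: "('a, 'm) ring_scheme \<Rightarrow> ('a, 'b, 'n) module_scheme \<Rightarrow> bool" where
  "assoc_algebra R A \<longleftrightarrow> module R A \<and> ring A \<and>
     (\<forall>c\<in>carrier R. \<forall>x\<in>carrier A. \<forall>y\<in>carrier A.
        (c \<odot>\<^bsub>A\<^esub> x) \<otimes>\<^bsub>A\<^esub> y = c \<odot>\<^bsub>A\<^esub> (x \<otimes>\<^bsub>A\<^esub> y) \<and>
        x \<otimes>\<^bsub>A\<^esub> (c \<odot>\<^bsub>A\<^esub> y) = c \<odot>\<^bsub>A\<^esub> (x \<otimes>\<^bsub>A\<^esub> y))"

definition algebra_iso ::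
  "('a, 'm) ring_scheme \<Rightarrow> ('a, 'b, 'n) module_scheme \<Rightarrow> ('a, 'c, 'k) module_scheme \<Rightarrow> ('b \<Rightarrow> 'c) set"
  where "algebra_iso R A B =
    {h \<in> ring_iso A B. \<forall>c\<in>carrier R. \<forall>x\<in>carrier A. h (c \<odot>\<^bsub>A\<^esub> x) = c \<odot>\<^bsub>B\<^esub> h x}"

definition algebra_isomorphic ::
  "('a, 'm) ring_scheme \<Rightarrow> ('a, 'b, 'n) module_scheme \<Rightarrow> ('a, 'c, 'k) module_scheme \<Rightarrow> bool"
  where "algebra_isomorphic R A B \<longleftrightarrow> algebra_iso R A B \<noteq> {}"

text \<open>The free module on the set \<open>S\<close>, with the bilinear multiplication for which the product of
  the basis elements \<open>u\<close> and \<open>v\<close> is \<open>c \<cdot> w\<close> where \<open>m u v = (c, w)\<close>; the basis element \<open>e\<close> is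
  the intended unit.\<close>

definition based_algebra ::
  "'s set \<Rightarrow> 's \<Rightarrow> ('s \<Rightarrow> 's \<Rightarrow> coeff \<times> 's) \<Rightarrow> (coeff, 's \<Rightarrow>\<^sub>0 coeff) module" where
  "based_algebra S e m =
    \<lparr>carrier = {p. Poly_Mapping.keys p \<subseteq> S},
     monoid.mult = (\<lambda>p q. \<Sum>u\<in>Poly_Mapping.keys p. \<Sum>v\<in>Poly_Mapping.keys q.
        Poly_Mapping.single (snd (m u v))
          (Poly_Mapping.lookup p u * Poly_Mapping.lookup q v * fst (m u v))),
     one = Poly_Mapping.single e 1,
     zero = 0,
     add = (+),
     module.smult = (\<lambda>c. Poly_Mapping.map (\<lambda>a. c * a))\<rparr>"


section \<open>The two-boundary Temperley-Lieb algebra\<close>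

text \<open>The free unital associative algebra on letters \<open>0, \<dots>, N\<close> has the words in these letters
  as basis.\<close>

definition free_algebra :: "nat \<Rightarrow> (coeff, nat list \<Rightarrow>\<^sub>0 coeff) module" where
  "free_algebra N = based_algebra (lists {0..N}) [] (\<lambda>u v. (1, u @ v))"

definition gen :: "nat \<Rightarrow> nat list \<Rightarrow>\<^sub>0 coeff" where
  "gen i = Poly_Mapping.single [i] 1"

text \<open>Pairs \<open>(l, r)\<close> stand for the relations \<open>l = r\<close>.\<close>

definition tl2_relations ::
  "nat \<Rightarrow> ((nat list \<Rightarrow>\<^sub>0 coeff) \<times> (nat list \<Rightarrow>\<^sub>0 coeff)) set" where
  "tl2_relations N =
    (let F = free_algebra N in
      {(gen i \<otimes>\<^bsub>F\<^esub> gen i, indet Delta \<odot>\<^bsub>F\<^esub> gen i) | i. 1 \<le> i \<and> i \<le> N - 1} \<union>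
      {(gen i \<otimes>\<^bsub>F\<^esub> gen j \<otimes>\<^bsub>F\<^esub> gen i, gen i) | i j.
          1 \<le> i \<and> i \<le> N - 1 \<and> j \<le> N \<and> (j = i + 1 \<or> i = j + 1)} \<union>
      {(gen 0 \<otimes>\<^bsub>F\<^esub> gen 0, indet S1 \<odot>\<^bsub>F\<^esub> gen 0)} \<union>
      {(gen N \<otimes>\<^bsub>F\<^esub> gen N, indet S2 \<odot>\<^bsub>F\<^esub> gen N)} \<union>
      {(gen i \<otimes>\<^bsub>F\<^esub> gen j, gen j \<otimes>\<^bsub>F\<^esub> gen i) | i j.
          i \<le> N \<and> j \<le> N \<and> \<bar>int i - int j\<bar> > 1})"

definition tl2_ideal :: "nat \<Rightarrow> (nat list \<Rightarrow>\<^sub>0 coeff) set" where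
  "tl2_ideal N = Idl\<^bsub>free_algebra N\<^esub> {l \<ominus>\<^bsub>free_algebra N\<^esub> r | l r. (l, r) \<in> tl2_relations N}"

text \<open>The quotient ring, with scalars acting on cosets in the way in which
  \<^const>\<open>rcoset_mult\<close> multiplies cosets.\<close>

definition tl2_algebra :: "nat \<Rightarrow> (coeff, (nat list \<Rightarrow>\<^sub>0 coeff) set) module" where
  "tl2_algebra N =
    (let F = free_algebra N; I = tl2_ideal N in
      ring.extend (F Quot I) (module.fields (\<lambda>c K. \<Union>x\<in>K. I +>\<^bsub>F\<^esub> (c \<odot>\<^bsub>F\<^esub> x))))"


section \<open>Diagrams\<close>

text \<open>Marked points on the four edges of the rectangle are numbered from 0, from left to right on
  the lower and upper edges and from bottom to top on the left and right edges. Up to maps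
  preserving the edges, a system of non-intersecting arcs is determined by the numbers of marked
  points on the left and right edges and the pairing of the marked points (an arc is the set of
  its two endpoints).\<close>

datatype point = Bot nat | Top nat | Lft nat | Rgt nat

datatype diagram = Diagram (lefts: nat) (rights: nat) (arcs: "point set set")

definition points :: "nat \<Rightarrow> diagram \<Rightarrow> point set" where
  "points N D = Bot ` {..<N} \<union> Top ` {..<N} \<union> Lft ` {..<lefts D} \<union> Rgt ` {..<rights D}"

text \<open>Position of a marked point when walking clockwise around the boundary of the rectangle,
  starting at the lower left corner.\<close>

fun boundary_pos :: "nat \<Rightarrow> diagram \<Rightarrow> point \<Rightarrow> nat" where
  "boundary_pos N D (Lft i) = i"
| "boundary_pos N D (Top i) = lefts D + i"
| "boundary_pos N D (Rgt i) = lefts D + N + (rights D - 1 - i)"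
| "boundary_pos N D (Bot i) = lefts D + N + rights D + (N - 1 - i)"

definition noncrossing :: "nat \<Rightarrow> diagram \<Rightarrow> bool" where
  "noncrossing N D \<longleftrightarrow>
    \<not> (\<exists>a b c d. {a, b} \<in> arcs D \<and> {c, d} \<in> arcs D \<and>
         boundary_pos N D a < boundary_pos N D c \<and>
         boundary_pos N D c < boundary_pos N D b \<and>
         boundary_pos N D b < boundary_pos N D d)"

definition is_diagram :: "nat \<Rightarrow> diagram \<Rightarrow> bool" where
  "is_diagram N D \<longleftrightarrow>
    even (lefts D) \<and> even (rights D) \<and>
    partition_on (points N D) (arcs D) \<and> (\<forall>a\<in>arcs D. card a = 2) \<and>
    noncrossing N D"

definition left_returns :: "diagram \<Rightarrow> point set set" where
  "left_returns D = {a \<in> arcs D. a \<subseteq> range Lft}"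

definition right_returns :: "diagram \<Rightarrow> point set set" where
  "right_returns D = {a \<in> arcs D. a \<subseteq> range Rgt}"

definition reduced_diagrams :: "nat \<Rightarrow> diagram set" where
  "reduced_diagrams N = {D. is_diagram N D \<and> left_returns D = {} \<and> right_returns D = {}}"

definition id_diagram :: "nat \<Rightarrow> diagram" where
  "id_diagram N = Diagram 0 0 ((\<lambda>i. {Bot i, Top i}) ` {..<N})"


section \<open>Composition of diagrams\<close>

text \<open>In the picture with \<open>A\<close> placed directly below \<open>B\<close>, the upper points of \<open>A\<close> and the lower
  points of \<open>B\<close> become the inner points \<open>Inner i\<close>; on the left and right sides the points
  of \<open>B\<close> come above those of \<open>A\<close>.\<close>

datatype stacked_point = Outer point | Inner nat

fun embed_lower :: "point \<Rightarrow> stacked_point" where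
  "embed_lower (Top i) = Inner i"
| "embed_lower p = Outer p"

fun embed_upper :: "diagram \<Rightarrow> point \<Rightarrow> stacked_point" where
  "embed_upper A (Bot i) = Inner i"
| "embed_upper A (Top i) = Outer (Top i)"
| "embed_upper A (Lft i) = Outer (Lft (lefts A + i))"
| "embed_upper A (Rgt i) = Outer (Rgt (rights A + i))"

definition stacked_arcs :: "diagram \<Rightarrow> diagram \<Rightarrow> stacked_point set set" where
  "stacked_arcs A B = (`) embed_lower ` arcs A \<union> (`) (embed_upper A) ` arcs B"

definition joined :: "diagram \<Rightarrow> diagram \<Rightarrow> (stacked_point \<times> stacked_point) set" where
  "joined A B = {(x, y). {x, y} \<in> stacked_arcs A B}\<^sup>*"

text \<open>A closed loop is identified with the set of inner points through which it passes.\<close>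

definition closed_loops :: "nat \<Rightarrow> diagram \<Rightarrow> diagram \<Rightarrow> stacked_point set set" where
  "closed_loops N A B =
    {C. \<exists>i<N. C = joined A B `` {Inner i} \<and> C \<subseteq> range Inner}"

text \<open>The stacked diagram without its closed loops, not yet reduced.\<close>

definition stack :: "diagram \<Rightarrow> diagram \<Rightarrow> diagram" where
  "stack A B = Diagram (lefts A + lefts B) (rights A + rights B)
     {{p, q} | p q. p \<noteq> q \<and> (Outer p, Outer q) \<in> joined A B}"

text \<open>As sides are numbered from the bottom, starting at 0, the number of marked points below a
  point on a side is the index of that point. Parities refer to the stacked diagram before any arc
  is removed.\<close>

definition odd_left :: "diagram \<Rightarrow> point set set" where
  "odd_left D = {a \<in> left_returns D. odd (LEAST i. Lft i \<in> a)}"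

definition odd_right :: "diagram \<Rightarrow> point set set" where
  "odd_right D = {a \<in> right_returns D. odd (LEAST i. Rgt i \<in> a)}"

text \<open>After removal of the arcs from a side to itself the remaining points on that side are
  renumbered consecutively.\<close>

fun renumber :: "diagram \<Rightarrow> point \<Rightarrow> point" where
  "renumber D (Lft i) = Lft (card {j. j < i \<and> Lft j \<notin> \<Union>(left_returns D)})"
| "renumber D (Rgt i) = Rgt (card {j. j < i \<and> Rgt j \<notin> \<Union>(right_returns D)})"
| "renumber D p = p"

definition reduce :: "diagram \<Rightarrow> diagram" where
  "reduce D = Diagram
     (card {j. j < lefts D \<and> Lft j \<notin> \<Union>(left_returns D)})
     (card {j. j < rights D \<and> Rgt j \<notin> \<Union>(right_returns D)})
     ((`) (renumber D) ` (arcs D - left_returns D - right_returns D))"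

definition compose :: "nat \<Rightarrow> diagram \<Rightarrow> diagram \<Rightarrow> coeff \<times> diagram" where
  "compose N A B =
    (indet Delta ^ card (closed_loops N A B) *
     indet S1 ^ card (odd_left (stack A B)) *
     indet S2 ^ card (odd_right (stack A B)),
     reduce (stack A B))"

definition diagram_algebra :: "nat \<Rightarrow> (coeff, diagram \<Rightarrow>\<^sub>0 coeff) module" where
  "diagram_algebra N = based_algebra (reduced_diagrams N) (id_diagram N) (compose N)"

end

theory Submission
  imports Defs "HOL-Library.Product_Lexorder"
begin

text \<open>A word in the letters \<open>0, \<dots>, N\<close> acts from the right on reduced diagrams, letter \<open>k\<close> as the
  diagram of \<open>e\<^sub>k\<close>; this action respects the defining relations. By the relations every word is a
  monomial times an \<^emph>\<open>alternating\<close> word, in which the occurrences of any two neighbouring letters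
  alternate, and an alternating word is determined up to commutations by its projections to pairs
  of neighbouring letters. These projections can be read off from the diagram of the word: the
  number of points on the left side gives the number of letters \<open>0\<close>, and the first and last letter
  of the projection to \<open>{i, Suc i}\<close> tell to which side the lines from \<open>Bot i\<close> and \<open>Top i\<close> lead.
  Hence inequivalent alternating words have different diagrams. Conversely, a reduced diagram other
  than the identity has a cup at some gap of its upper edge; cutting the cup and the line closest to
  it writes the diagram as a product of a simpler one with a generator, so every reduced diagram
  comes from a word, and products of diagrams can be computed letter by letter.\<close>

section \<open>Reduction of words\<close>

text \<open>The delicate point is the parity rule: returns (arcs from a side to itself) are odd or
  even in the stacked diagram before any arc is removed, whereas a word is evaluated by reducing
  after each letter. The two agree because, by planarity, the returns removed below a remaining
  point occupy an even number of places, so renumbering keeps all parities. A second obstacle is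
  that stacking is defined by reachability in a graph, which is awkward to iterate. Diagrams are
  therefore encoded as involutions on which each generator acts by one local reconnection at a gap
  of the upper edge; for \<open>e_0\<close> and \<open>e_N\<close> a return is first added at the
  corner, so that boundary and inner generators are treated alike. Associativity of composition is
  never examined on triple stacks: it is inherited from concatenation of words, once the product is
  known to depend on the right factor only through its diagram and not through the word chosen for
  it.\<close>

inductive_set tl2_rewrites :: "nat \<Rightarrow> (nat list \<times> coeff \<times> nat list) set" for N where
  square: "1 \<le> i \<Longrightarrow> i \<le> N - 1 \<Longrightarrow> ([i, i], indet Delta, [i]) \<in> tl2_rewrites N"
| square_0: "([0, 0], indet S1, [0]) \<in> tl2_rewrites N"
| square_N: "([N, N], indet S2, [N]) \<in> tl2_rewrites N"
| braid: "1 \<le> i \<Longrightarrow> i \<le> N - 1 \<Longrightarrow> j = Suc i \<or> i = Suc j \<Longrightarrow> ([i, j, i], 1, [i]) \<in> tl2_rewrites N"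
| commute: "i \<le> N \<Longrightarrow> j \<le> N \<Longrightarrow> Suc i < j \<or> Suc j < i \<Longrightarrow> ([i, j], 1, [j, i]) \<in> tl2_rewrites N"

text \<open>Read \<open>reduces N u c v\<close> as u = c v in the algebra. Every relation equates a
  word with a scalar multiple of a word, so a chain of rewrites stays among multiples of words and
  the scalars simply multiply.\<close>

inductive reduces :: "nat \<Rightarrow> nat list \<Rightarrow> coeff \<Rightarrow> nat list \<Rightarrow> bool" for N where
  rw_refl: "reduces N u 1 u"
| rw_step: "(l, c, r) \<in> tl2_rewrites N \<Longrightarrow> x \<in> lists {0..N} \<Longrightarrow> y \<in> lists {0..N} \<Longrightarrow>
    reduces N (x @ l @ y) c (x @ r @ y)"
| rw_trans: "reduces N u c v \<Longrightarrow> reduces N v d w \<Longrightarrow> reduces N u (c * d) w"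

lemma reduces_trans_1: "reduces N u 1 v \<Longrightarrow> reduces N v d w \<Longrightarrow> reduces N u d w"
  using reduces.rw_trans[of N u 1 v d w] by simp

lemma reduces_context:
  assumes "reduces N u c v" "x \<in> lists {0..N}" "y \<in> lists {0..N}"
  shows "reduces N (x @ u @ y) c (x @ v @ y)"
  using assms(1)
proof induction
  case (rw_refl u)
  then show ?case by (rule reduces.rw_refl)
next
  case (rw_step l c r x' y')
  then show ?case
    using reduces.rw_step[of l c r N "x @ x'" "y' @ y"] assms(2,3) by simp
next
  case (rw_trans u c v d w)
  then show ?case by (blast intro: reduces.rw_trans)
qed

lemma reduces_in_lists:
  "reduces N u c v \<Longrightarrow> 2 \<le> N \<Longrightarrow> u \<in> lists {0..N} \<longleftrightarrow> v \<in> lists {0..N}"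
  by (induction rule: reduces.induct) (auto elim!: tl2_rewrites.cases)

definition far :: "nat \<Rightarrow> nat \<Rightarrow> bool" where
  "far i j \<longleftrightarrow> Suc i < j \<or> Suc j < i"

lemma reduces_move_left:
  assumes "a \<le> N" "y \<in> lists {0..N}" "\<forall>b\<in>set y. far a b"
  shows "reduces N (y @ [a]) 1 (a # y)"
  using assms(2,3)
proof (induction y)
  case Nil
  then show ?case by (simp add: reduces.rw_refl)
next
  case (Cons b y)
  have "reduces N ([b] @ (y @ [a]) @ []) 1 ([b] @ (a # y) @ [])"
    using Cons by (intro reduces_context) auto
  moreover have "reduces N ([] @ [b, a] @ y) 1 ([] @ [a, b] @ y)"
    using Cons assms(1) by (intro reduces.rw_step tl2_rewrites.commute) (auto simp: far_def)
  ultimately show ?case by (auto intro: reduces_trans_1)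
qed

lemma reduces_move_right:
  assumes "a \<le> N" "y \<in> lists {0..N}" "\<forall>b\<in>set y. far a b"
  shows "reduces N (a # y) 1 (y @ [a])"
  using assms(2,3)
proof (induction y)
  case Nil
  then show ?case by (simp add: reduces.rw_refl)
next
  case (Cons b y)
  have "reduces N ([b] @ (a # y) @ []) 1 ([b] @ (y @ [a]) @ [])"
    using Cons by (intro reduces_context) auto
  moreover have "reduces N ([] @ [a, b] @ y) 1 ([] @ [b, a] @ y)"
    using Cons assms(1) by (intro reduces.rw_step tl2_rewrites.commute) (auto simp: far_def)
  ultimately show ?case by (auto intro: reduces_trans_1)
qed

section \<open>Alternating words and their projections to pairs of neighbouring letters\<close>

abbreviation proj :: "nat \<Rightarrow> nat list \<Rightarrow> nat list" where
  "proj i \<equiv> filter (\<lambda>x. x = i \<or> x = Suc i)"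

definition alternating :: "nat \<Rightarrow> nat list \<Rightarrow> bool" where
  "alternating N u \<longleftrightarrow> u \<in> lists {0..N} \<and> (\<forall>i<N. distinct_adj (proj i u))"

text \<open>The shape of a failure to alternate: between two consecutive letters \<open>a\<close>,
  with \<open>y\<close> in between, one of the neighbouring letters of \<open>a\<close> does not
  occur. The bounds say that this neighbour is a letter at all.\<close>

definition gap :: "nat \<Rightarrow> nat \<Rightarrow> nat list \<Rightarrow> bool" where
  "gap N a y \<longleftrightarrow> a \<notin> set y \<and>
     (a < N \<and> Suc a \<notin> set y \<or> 0 < a \<and> a - 1 \<notin> set y)"

lemma not_distinct_adjE:
  assumes "\<not> distinct_adj xs"
  obtains x y a where "xs = x @ [a, a] @ y"
  using assms
proof (induction xs arbitrary: thesis rule: induct_list012)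
  case (3 x y zs)
  show ?case
  proof (cases "x = y")
    case True
    then show ?thesis using 3(3)[of "[]" x zs] by simp
  next
    case False
    then have "\<not> distinct_adj (y # zs)" using 3(4) by simp
    then obtain x' a y' where "y # zs = x' @ [a, a] @ y'" using 3(2) by blast
    then show ?thesis using 3(3)[of "x # x'" a y'] by simp
  qed
qed auto

lemma filter_eq_appendD:
  assumes "filter P xs = us @ vs"
  shows "\<exists>ys zs. xs = ys @ zs \<and> filter P ys = us \<and> filter P zs = vs"
  using assms
proof (induction us arbitrary: xs)
  case Nil
  then show ?case by (intro exI[of _ "[]"] exI[of _ xs]) simp
next
  case (Cons u us)
  from Cons.prems have "filter P xs = u # (us @ vs)" by simp
  from filter_eq_ConsD[OF this] obtain ps qs where
    *: "xs = ps @ u # qs" "\<forall>x\<in>set ps. \<not> P x" "P u" "us @ vs = filter P qs" by auto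
  from Cons.IH[OF *(4)[symmetric]] obtain ys zs where
    "qs = ys @ zs" "filter P ys = us" "filter P zs = vs" by blast
  with * show ?case by (intro exI[of _ "ps @ u # ys"] exI[of _ zs]) (auto simp: filter_empty_conv)
qed

lemma not_alternating_gap:
  assumes "u \<in> lists {0..N}" "\<not> alternating N u"
  obtains x a y z where "u = x @ [a] @ y @ [a] @ z" "gap N a y"
proof -
  from assms obtain i where i: "i < N" "\<not> distinct_adj (proj i u)"
    by (auto simp: alternating_def)
  obtain x y a where "proj i u = x @ [a, a] @ y" using i(2) by (rule not_distinct_adjE)
  then have *: "proj i u = x @ a # a # y" by simp
  obtain p q where 1: "u = p @ q" "proj i q = a # a # y"
    using filter_eq_appendD[OF *] by blast
  from filter_eq_ConsD[OF 1(2)] obtain q1 q2 where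
    2: "q = q1 @ a # q2" "a = i \<or> a = Suc i" "proj i q2 = a # y" by force
  from filter_eq_ConsD[OF 2(3)] obtain q3 q4 where
    3: "q2 = q3 @ a # q4" "\<forall>x\<in>set q3. \<not> (x = i \<or> x = Suc i)" by force
  show thesis
    by (rule that[of "p @ q1" a q3 q4]) (use 1 2 3 i in \<open>auto simp: gap_def\<close>)
qed

lemma split_by_letter:
  assumes "b \<in> set y"
  obtains (once) y1 y2 where "y = y1 @ [b] @ y2" "b \<notin> set y1" "b \<notin> set y2"
    | (twice) y1 y2 y3 where "y = y1 @ [b] @ y2 @ [b] @ y3" "b \<notin> set y2"
proof -
  from assms obtain y1 y2 where 1: "y = y1 @ b # y2" "b \<notin> set y1"
    by (meson split_list_first)
  show thesis
  proof (cases "b \<in> set y2")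
    case True
    then obtain y3 y4 where "y2 = y3 @ b # y4" "b \<notin> set y3" by (meson split_list_first)
    then show ?thesis using twice[of y1 y3 y4] 1 by simp
  next
    case False
    then show ?thesis using once[of y1 y2] 1 by simp
  qed
qed

text \<open>In a gap of minimal length the other neighbouring letter occurs at most once.\<close>

lemma gap_shorten:
  assumes "2 \<le> N" "u \<in> lists {0..N}" "u = x @ [a] @ y @ [a] @ z" "gap N a y"
  shows "\<exists>c v. reduces N u c v \<and> length v < length u"
  using assms(3,4)
proof (induction "length y" arbitrary: x a y z rule: less_induct)
  case less
  have letters: "a \<le> N" "x \<in> lists {0..N}" "y \<in> lists {0..N}" "z \<in> lists {0..N}"
    using assms(2) less.prems(1) by auto
  have far: "\<forall>b\<in>set y. b \<noteq> Suc a \<longrightarrow> Suc b \<noteq> a \<longrightarrow> far a b"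
    using less.prems(2) unfolding gap_def far_def by (metis Suc_lessI linorder_neqE_nat)
  show ?case
  proof (cases "\<forall>b\<in>set y. far a b")
    case True
    \<comment> \<open>Every letter between the two \<open>a\<close> commutes with \<open>a\<close>,
      so the two meet and a square rule removes one of them.\<close>
    have "reduces N ((x @ [a]) @ (y @ [a]) @ z) 1 ((x @ [a]) @ (a # y) @ z)"
      using letters True by (intro reduces_context reduces_move_left) auto
    moreover have "\<exists>c. ([a, a], c, [a]) \<in> tl2_rewrites N"
    proof (cases "a = 0 \<or> a = N")
      case True
      then show ?thesis using square_0 square_N by blast
    next
      case False
      then have "([a, a], indet Delta, [a]) \<in> tl2_rewrites N"
        using letters by (intro square) auto
      then show ?thesis by blast
    qed
    then obtain c where "([a, a], c, [a]) \<in> tl2_rewrites N" by blast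
    then have "reduces N (x @ [a, a] @ (y @ z)) c (x @ [a] @ (y @ z))"
      using letters by (intro reduces.rw_step) auto
    ultimately have "reduces N u c (x @ [a] @ y @ z)"
      using less.prems by (auto intro: reduces_trans_1)
    then show ?thesis using less.prems by (intro exI[of _ c] exI[of _ "x @ [a] @ y @ z"]) simp
  next
    case False
    then obtain b where b: "b \<in> set y" "b = Suc a \<or> a = Suc b" "\<forall>b'\<in>set y. b' \<noteq> b \<longrightarrow> far a b'"
      using far less.prems(2) unfolding gap_def
      by (metis diff_Suc_1)
    have "b \<le> N" using b letters by auto
    \<comment> \<open>The neighbour missing from the gap and the neighbour \<open>b\<close> present
      in it are different, so \<open>a\<close> has neighbours on both sides; only then is the braid
      relation available.\<close>
    have interior: "1 \<le> a" "a \<le> N - 1"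
      using less.prems(2) b \<open>b \<le> N\<close> unfolding gap_def by auto
    from b(1) show ?thesis
    proof (cases rule: split_by_letter)
      case (once y1 y2)
      have far: "far a b'" if "b' \<in> set y1 \<union> set y2" for b'
        using b(3) once that by (cases "b' = b") auto
      \<comment> \<open>The two \<open>a\<close> move up to \<open>b\<close> from both sides and
        form the left side of a braid rule.\<close>
      have "reduces N (x @ (a # y1) @ ([b] @ y2 @ [a] @ z)) 1 (x @ (y1 @ [a]) @ ([b] @ y2 @ [a] @ z))"
        using letters far once by (intro reduces_context reduces_move_right) auto
      moreover have "reduces N ((x @ y1 @ [a, b]) @ (y2 @ [a]) @ z) 1 ((x @ y1 @ [a, b]) @ (a # y2) @ z)"
        using letters far once by (intro reduces_context reduces_move_left) auto
      moreover have "reduces N ((x @ y1) @ [a, b, a] @ (y2 @ z)) 1 ((x @ y1) @ [a] @ (y2 @ z))"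
        using letters b once interior by (intro reduces.rw_step tl2_rewrites.braid) auto
      ultimately have "reduces N u 1 (x @ y1 @ [a] @ y2 @ z)"
        using less.prems once by (auto intro: reduces_trans_1)
      then show ?thesis using less.prems once
        by (intro exI[of _ 1] exI[of _ "x @ y1 @ [a] @ y2 @ z"]) simp
    next
      case (twice y1 y2 y3)
      \<comment> \<open>\<open>a\<close> is a neighbour of \<open>b\<close> and does not occur in
        \<open>y2\<close>, so two consecutive letters \<open>b\<close> enclose a shorter
        gap.\<close>
      show ?thesis
        by (rule less.hyps[of y2 "x @ [a] @ y1" b "y3 @ [a] @ z"])
          (use twice less.prems b letters interior in \<open>auto simp: gap_def\<close>)
    qed
  qed
qed

lemma reduces_alternating:
  assumes "2 \<le> N" "u \<in> lists {0..N}"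
  shows "\<exists>c v. reduces N u c v \<and> alternating N v"
  using assms(2)
proof (induction "length u" arbitrary: u rule: less_induct)
  case less
  show ?case
  proof (cases "alternating N u")
    case True
    then show ?thesis using reduces.rw_refl by blast
  next
    case False
    then obtain x a y z where "u = x @ [a] @ y @ [a] @ z" "gap N a y"
      using not_alternating_gap less.prems by metis
    then obtain c v where v: "reduces N u c v" "length v < length u"
      using gap_shorten assms(1) less.prems by metis
    then have "v \<in> lists {0..N}" using reduces_in_lists assms(1) less.prems by blast
    then show ?thesis using less.hyps v reduces.rw_trans by metis
  qed
qed

text \<open>The projection criterion for partially commutative words (traces). The first letter
  \<open>a\<close> of \<open>u\<close> is preceded in \<open>v\<close>, at its first occurrence,
  only by letters that commute with it: a neighbour of \<open>a\<close> before it would come first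
  in a projection that begins with \<open>a\<close> in \<open>u\<close>. So this \<open>a\<close>
  can be moved to the front and cancelled.\<close>

lemma reduces_of_proj_eq:
  assumes "1 \<le> N" "u \<in> lists {0..N}" "v \<in> lists {0..N}" "\<And>i. i < N \<Longrightarrow> proj i u = proj i v"
  shows "reduces N u 1 v"
  using assms(2-)
proof (induction u arbitrary: v rule: list.induct)
  case Nil
  have "v = []"
  proof (cases v)
    case (Cons a v')
    \<comment> \<open>Every letter lies in a pair of neighbours; \<open>N\<close> only in the pair
      of \<open>N - 1\<close> and \<open>N\<close>.\<close>
    define i where "i = (if a < N then a else a - 1)"
    have "i < N" "a = i \<or> a = Suc i"
      using Nil.prems(2) assms(1) Cons by (auto simp: i_def)
    then show ?thesis using Nil.prems(3)[of i] Cons by auto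
  qed
  then show ?case by (simp add: reduces.rw_refl)
next
  case (Cons a u)
  have a: "a \<le> N" using Cons.prems(1) by simp
  define i where "i = (if a < N then a else a - 1)"
  have i: "i < N" "a = i \<or> a = Suc i" using a assms(1) by (auto simp: i_def)
  have "a \<in> set (proj i (a # u))" using i by simp
  then have "a \<in> set v" using Cons.prems(3)[OF i(1)] by (metis filter_is_subset subsetD)
  then obtain v1 v2 where v: "v = v1 @ a # v2" "a \<notin> set v1" by (meson split_list_first)
  have far: "far a b" if b: "b \<in> set v1" for b
  proof (rule ccontr)
    assume "\<not> far a b"
    moreover have "b \<noteq> a" using b v by auto
    ultimately have "b = Suc a \<or> a = Suc b" by (auto simp: far_def)
    moreover have "b \<le> N" using b v Cons.prems by auto
    ultimately obtain j where j: "j < N" "a = j \<or> a = Suc j" "b = j \<or> b = Suc j"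
      using a by (metis Suc_le_lessD)
    have "proj j v1 = a # tl (proj j v1)"
      using Cons.prems(3)[OF j(1)] b j unfolding v(1)
      by (cases "proj j v1") (auto simp: filter_empty_conv)
    then have "a \<in> set (proj j v1)" by (metis list.set_intros(1))
    then show False using v by auto
  qed
  have *: "proj j u = proj j (v1 @ v2)" if "j < N" for j
  proof (cases "a = j \<or> a = Suc j")
    case True
    then have "proj j v1 = []" using far by (fastforce simp: filter_empty_conv far_def)
    then show ?thesis using Cons.prems(3)[OF that] True v by auto
  next
    case False
    then show ?thesis using Cons.prems(3)[OF that] v by auto
  qed
  have "reduces N u 1 (v1 @ v2)"
    by (rule Cons.IH) (use * v Cons.prems in auto)
  then have "reduces N ([a] @ u @ []) 1 ([a] @ (v1 @ v2) @ [])"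
    using a by (intro reduces_context) auto
  moreover have "reduces N ([] @ (a # v1) @ v2) 1 ([] @ (v1 @ [a]) @ v2)"
    using far a v Cons.prems(2) by (intro reduces_context reduces_move_right) auto
  ultimately show ?case using v by (auto intro: reduces_trans_1)
qed


section \<open>Configurations and planarity\<close>

text \<open>An encoding of diagrams by the numbers of points on the left and right side and an involution
  on all points whose fixed points are exactly those that are not marked.\<close>

datatype config = Config (nl: nat) (nr: nat) (mt: "point \<Rightarrow> point")

definition pts :: "nat \<Rightarrow> nat \<Rightarrow> nat \<Rightarrow> point set" where
  "pts N l r = Bot ` {..<N} \<union> Top ` {..<N} \<union> Lft ` {..<l} \<union> Rgt ` {..<r}"

lemma pts_simps [simp]:
  "Bot i \<in> pts N l r \<longleftrightarrow> i < N" "Top i \<in> pts N l r \<longleftrightarrow> i < N"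
  "Lft i \<in> pts N l r \<longleftrightarrow> i < l" "Rgt i \<in> pts N l r \<longleftrightarrow> i < r"
  by (auto simp: pts_def)

lemma finite_pts [simp]: "finite (pts N l r)"
  by (simp add: pts_def)

definition pairing :: "nat \<Rightarrow> config \<Rightarrow> bool" where
  "pairing N c \<longleftrightarrow> (\<forall>x. mt c (mt c x) = x) \<and> (\<forall>x. mt c x \<noteq> x \<longleftrightarrow> x \<in> pts N (nl c) (nr c))"

lemma pairing_mt [simp]: "pairing N c \<Longrightarrow> mt c (mt c x) = x"
  by (simp add: pairing_def)

lemma pairing_fix: "pairing N c \<Longrightarrow> mt c x = x \<longleftrightarrow> x \<notin> pts N (nl c) (nr c)"
  by (auto simp: pairing_def)

lemma pairing_mt_pts: "pairing N c \<Longrightarrow> mt c x \<in> pts N (nl c) (nr c) \<longleftrightarrow> x \<in> pts N (nl c) (nr c)"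
  unfolding pairing_def by metis

lemma pairing_mt_eq: "pairing N c \<Longrightarrow> mt c x = mt c y \<longleftrightarrow> x = y"
  unfolding pairing_def by metis

text \<open>The clockwise order of \<^const>\<open>boundary_pos\<close>, made independent of the numbers of points.\<close>

fun key :: "point \<Rightarrow> nat \<times> int" where
  "key (Lft i) = (0, int i)"
| "key (Top i) = (1, int i)"
| "key (Rgt i) = (2, - int i)"
| "key (Bot i) = (3, - int i)"

lemma key_inject [simp]: "key x = key y \<longleftrightarrow> x = y"
  by (cases x; cases y) auto

text \<open>Symmetric in \<open>a\<close> and \<open>b\<close>, so that arcs need not be oriented.
  Cutting the boundary circle at the lower left corner does no harm: whether a chord separates two
  points does not depend on where the circle is cut.\<close>

definition btw :: "point \<Rightarrow> point \<Rightarrow> point \<Rightarrow> bool" where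
  "btw a b c \<longleftrightarrow> key a < key c \<and> key c < key b \<or> key b < key c \<and> key c < key a"

lemma btw_commute: "btw a b c \<longleftrightarrow> btw b a c"
  by (auto simp: btw_def)

lemma btw_irrefl [simp]: "\<not> btw a a c" "\<not> btw a b a" "\<not> btw a b b"
  by (auto simp: btw_def)

text \<open>Intervals add modulo 2: away from end points, the interval from \<open>a\<close> to
  \<open>b\<close> is the symmetric difference of those from \<open>a\<close> to \<open>w\<close>
  and from \<open>w\<close> to \<open>b\<close>. The planarity proofs for reconnected arcs rest on
  this rule.\<close>

lemma btw_xor: "c \<noteq> w \<Longrightarrow> c \<noteq> a \<Longrightarrow> c \<noteq> b \<Longrightarrow> btw a b c \<longleftrightarrow> (btw a w c \<noteq> btw w b c)"
  using key_inject[of c w] key_inject[of c a] key_inject[of c b] unfolding btw_def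
  by (metis less_asym' linorder_less_linear order_less_trans)

text \<open>No arc separates a point from its partner. The quantifiers can range over all points
  because an unmarked one is fixed by \<open>mt\<close>: it bounds an empty interval and is not
  separated from itself.\<close>

definition planar :: "config \<Rightarrow> bool" where
  "planar c \<longleftrightarrow> (\<forall>x y. btw x (mt c x) y \<longrightarrow> btw x (mt c x) (mt c y))"

lemma planar_btw_iff:
  "planar c \<Longrightarrow> pairing N c \<Longrightarrow> btw x (mt c x) (mt c y) \<longleftrightarrow> btw x (mt c x) y"
  unfolding planar_def pairing_def by metis

definition diagram_of :: "config \<Rightarrow> diagram" where
  "diagram_of c = Diagram (nl c) (nr c) {{x, mt c x} | x. mt c x \<noteq> x}"

definition planar_config :: "nat \<Rightarrow> config \<Rightarrow> bool" where
  "planar_config N c \<longleftrightarrow> pairing N c \<and> even (nl c) \<and> even (nr c) \<and> planar c"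

lemma mem_arcs_diagram_of:
  "pairing N c \<Longrightarrow> {x, y} \<in> arcs (diagram_of c) \<longleftrightarrow> x \<in> pts N (nl c) (nr c) \<and> y = mt c x"
  unfolding diagram_of_def pairing_def by (auto simp: doubleton_eq_iff)

lemma diagram_of_inject:
  assumes "pairing N c" "pairing N d" "diagram_of c = diagram_of d"
  shows "c = d"
proof -
  have l: "nl c = nl d" "nr c = nr d"
    using assms(3) by (auto simp: diagram_of_def)
  have "mt c x = mt d x" for x
    using mem_arcs_diagram_of[OF assms(1), of x "mt c x"]
      mem_arcs_diagram_of[OF assms(2), of x "mt c x"]
      pairing_fix[OF assms(1), of x] pairing_fix[OF assms(2), of x] l assms(3) by metis
  then show ?thesis using l by (intro config.expand) auto
qed

lemma boundary_pos_less_iff: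
  assumes "x \<in> points N D" "y \<in> points N D"
  shows "boundary_pos N D x < boundary_pos N D y \<longleftrightarrow> key x < key y"
  using assms by (cases x; cases y) (auto simp: points_def)

lemma points_diagram_of: "points N (diagram_of c) = pts N (nl c) (nr c)"
  by (simp add: points_def pts_def diagram_of_def)

lemma noncrossing_diagram_of:
  assumes "pairing N c"
  shows "noncrossing N (diagram_of c) \<longleftrightarrow> planar c"
proof -
  let ?P = "pts N (nl c) (nr c)"
  have less: "boundary_pos N (diagram_of c) x < boundary_pos N (diagram_of c) y \<longleftrightarrow> key x < key y"
    if "x \<in> ?P" "y \<in> ?P" for x y
    using that by (intro boundary_pos_less_iff) (auto simp: points_diagram_of)
  have 1: "noncrossing N (diagram_of c) \<longleftrightarrow> \<not> (\<exists>a\<in>?P. \<exists>b\<in>?P. key a < key b \<and>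
      key b < key (mt c a) \<and> key (mt c a) < key (mt c b))"
    unfolding noncrossing_def mem_arcs_diagram_of[OF assms]
    using less pairing_mt_pts[OF assms] by (smt (verit, best))
  show ?thesis
  proof
    assume "planar c"
    show "noncrossing N (diagram_of c)"
      unfolding 1
    proof (intro notI, elim bexE conjE)
      fix a b
      assume "key a < key b" "key b < key (mt c a)" "key (mt c a) < key (mt c b)"
      moreover from this have "btw a (mt c a) b" by (auto simp: btw_def)
      then have "btw a (mt c a) (mt c b)" using \<open>planar c\<close> by (auto simp: planar_def)
      ultimately show False by (auto simp: btw_def)
    qed
  next
    assume nc: "noncrossing N (diagram_of c)"
    have *: "key a < key (mt c b) \<and> key (mt c b) < key (mt c a)"
      if ab: "key a < key b" "key b < key (mt c a)" for a b
    proof -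
      have a: "a \<in> ?P" using ab pairing_fix[OF assms, of a] by auto
      show ?thesis
      proof (cases "b \<in> ?P")
        case False
        then show ?thesis using ab pairing_fix[OF assms, of b] by auto
      next
        case True
        then have "\<not> key (mt c a) < key (mt c b)" using nc a ab unfolding 1 by blast
        \<comment> \<open>A partner of \<open>b\<close> before \<open>a\<close> is the same
          forbidden pattern, formed by \<open>mt c b\<close>, \<open>a\<close>, \<open>b\<close>,
          \<open>mt c a\<close> in this order.\<close>
        moreover have "\<not> key (mt c b) < key a"
          using nc a ab True assms pairing_mt_pts[OF assms, of b] unfolding 1
          by (metis pairing_mt)
        moreover have "key (mt c b) \<noteq> key (mt c a)"
          using ab(1) pairing_mt_eq[OF assms] by auto
        moreover have "key (mt c b) \<noteq> key a"
          using ab(2) assms by auto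
        ultimately show ?thesis
          using key_inject[of "mt c b" "mt c a"] key_inject[of "mt c b" a]
          by (metis linorder_less_linear)
      qed
    qed
    show "planar c"
      unfolding planar_def
    proof (intro allI impI)
      fix x y assume "btw x (mt c x) y"
      then show "btw x (mt c x) (mt c y)"
        using *[of x y] *[of "mt c x" y] assms unfolding btw_def by auto
    qed
  qed
qed

lemma is_diagram_diagram_of:
  assumes "planar_config N c"
  shows "is_diagram N (diagram_of c)"
proof -
  have p: "pairing N c" using assms by (simp add: planar_config_def)
  let ?P = "pts N (nl c) (nr c)"
  have arcs: "arcs (diagram_of c) = (\<lambda>x. {x, mt c x}) ` ?P"
    using p by (auto simp: diagram_of_def pairing_def)
  have "partition_on ?P (arcs (diagram_of c))"
    unfolding arcs
  proof (rule partition_onI)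
    show "\<Union> ((\<lambda>x. {x, mt c x}) ` ?P) = ?P"
      using pairing_mt_pts[OF p] by auto
    fix q q' assume "q \<in> (\<lambda>x. {x, mt c x}) ` ?P" "q' \<in> (\<lambda>x. {x, mt c x}) ` ?P" "q \<noteq> q'"
    then show "disjnt q q'" using p by (auto simp: disjnt_def pairing_mt_eq)
  qed auto
  moreover have "\<forall>a\<in>arcs (diagram_of c). card a = 2"
  proof
    fix a assume "a \<in> arcs (diagram_of c)"
    then obtain x where "a = {x, mt c x}" "mt c x \<noteq> x" by (auto simp: diagram_of_def)
    then show "card a = 2" by simp
  qed
  ultimately show ?thesis
    using assms noncrossing_diagram_of[OF p]
    unfolding is_diagram_def planar_config_def points_diagram_of by (auto simp: diagram_of_def)
qed

lemma is_diagramE: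
  assumes "is_diagram N D"
  obtains c where "planar_config N c" "D = diagram_of c"
proof -
  have part: "partition_on (points N D) (arcs D)" and card: "\<forall>a\<in>arcs D. card a = 2"
    using assms by (auto simp: is_diagram_def)
  have ex1: "\<exists>!y. {x, y} \<in> arcs D" if x: "x \<in> points N D" for x
  proof -
    obtain a where a: "a \<in> arcs D" "x \<in> a"
      using x part by (auto simp: partition_on_def)
    moreover have "card a = 2" using a card by blast
    ultimately obtain y where y: "a = {x, y}" "x \<noteq> y" by (auto simp: card_2_iff)
    have "z = y" if "{x, z} \<in> arcs D" for z
    proof -
      have "{x, z} = {x, y}"
        using that a y part unfolding partition_on_def disjoint_def by (metis disjoint_iff insertI1)
      then show ?thesis by (auto simp: doubleton_eq_iff)
    qed
    then show ?thesis using a y by blast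
  qed
  define s where "s x = (if x \<in> points N D then THE y. {x, y} \<in> arcs D else x)" for x
  have s: "{x, y} \<in> arcs D \<longleftrightarrow> y = s x" if "x \<in> points N D" for x y
    using ex1[OF that] that by (metis (mono_tags, lifting) s_def theI_unique)
  have sub: "a \<subseteq> points N D" if "a \<in> arcs D" for a
    using that part by (auto simp: partition_on_def)
  have s_pts: "s x \<in> points N D" if "x \<in> points N D" for x
    using s[OF that, of "s x"] sub by auto
  have s_s: "s (s x) = x" for x
  proof (cases "x \<in> points N D")
    case True
    then have "{s x, x} \<in> arcs D" using s[of x "s x"] by (simp add: insert_commute)
    then show ?thesis using s s_pts True by metis
  qed (simp add: s_def)
  have s_ne: "s x \<noteq> x" if "x \<in> points N D" for x
    using s[OF that, of "s x"] card by auto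
  define c where "c = Config (lefts D) (rights D) s"
  have P: "points N D = pts N (nl c) (nr c)" by (simp add: points_def pts_def c_def)
  have c: "pairing N c"
    using s_s s_ne P unfolding pairing_def by (auto simp: c_def s_def)
  have "a \<in> {{x, s x} |x. s x \<noteq> x}" if a: "a \<in> arcs D" for a
  proof -
    obtain x y where "a = {x, y}" "x \<noteq> y" using a card by (metis card_2_iff)
    then show ?thesis using s[of x y] sub[OF a] a by auto
  qed
  moreover have "{x, s x} \<in> arcs D" if "s x \<noteq> x" for x
    using s[of x "s x"] that by (auto simp: s_def split: if_splits)
  ultimately have "arcs D = {{x, s x} |x. s x \<noteq> x}" by blast
  then have D: "D = diagram_of c" by (simp add: diagram_of_def c_def diagram.expand)
  moreover have "planar_config N c"
  proof -
    have "nl c = lefts D" "nr c = rights D" by (simp_all add: c_def)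
    moreover have "noncrossing N D \<longleftrightarrow> planar c" using noncrossing_diagram_of[OF c] D by metis
    ultimately show ?thesis using assms c by (metis planar_config_def is_diagram_def)
  qed
  ultimately show thesis using that by blast
qed

text \<open>The case \<open>i = j\<close> has to be allowed, since \<open>mt\<close> fixes the
  points that are not marked.\<close>

definition reduced :: "config \<Rightarrow> bool" where
  "reduced c \<longleftrightarrow> (\<forall>i j. mt c (Lft i) = Lft j \<longrightarrow> i = j) \<and> (\<forall>i j. mt c (Rgt i) = Rgt j \<longrightarrow> i = j)"

definition reduced_configs :: "nat \<Rightarrow> config set" where
  "reduced_configs N = {c. planar_config N c \<and> reduced c}"

lemma returns_diagram_of:
  "left_returns (diagram_of c) = {{Lft i, Lft j} | i j. mt c (Lft i) = Lft j \<and> i \<noteq> j}"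
  "right_returns (diagram_of c) = {{Rgt i, Rgt j} | i j. mt c (Rgt i) = Rgt j \<and> i \<noteq> j}"
proof -
  have "{x, mt c x} \<subseteq> range Lft \<longleftrightarrow> (\<exists>i j. x = Lft i \<and> mt c (Lft i) = Lft j)"
    "{x, mt c x} \<subseteq> range Rgt \<longleftrightarrow> (\<exists>i j. x = Rgt i \<and> mt c (Rgt i) = Rgt j)" for x
    by (cases x; auto)+
  then show "left_returns (diagram_of c) = {{Lft i, Lft j} | i j. mt c (Lft i) = Lft j \<and> i \<noteq> j}"
    "right_returns (diagram_of c) = {{Rgt i, Rgt j} | i j. mt c (Rgt i) = Rgt j \<and> i \<noteq> j}"
    unfolding left_returns_def right_returns_def diagram_of_def diagram.sel by fastforce+
qed

lemma reduced_diagrams_eq: "reduced_diagrams N = diagram_of ` reduced_configs N"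
proof -
  have "left_returns (diagram_of c) = {} \<and> right_returns (diagram_of c) = {} \<longleftrightarrow> reduced c" for c
    unfolding returns_diagram_of reduced_def by blast
  then show ?thesis
    using is_diagram_diagram_of
    by (auto simp: reduced_diagrams_def reduced_configs_def elim!: is_diagramE)
qed

lemma inj_on_diagram_of: "inj_on diagram_of (reduced_configs N)"
  using diagram_of_inject by (auto simp: inj_on_def reduced_configs_def planar_config_def)

section \<open>Added returns and reconnection of arcs at a gap of the upper edge\<close>

definition surgery :: "'a \<Rightarrow> 'a \<Rightarrow> ('a \<Rightarrow> 'a) \<Rightarrow> 'a \<Rightarrow> 'a" where
  "surgery a b s x = (if x = a then b else if x = b then a else
     if x = s a then s b else if x = s b then s a else s x)"

definition cap_left :: "config \<Rightarrow> config" where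
  "cap_left c = Config (nl c + 2) (nr c)
     ((mt c)(Lft (nl c) := Lft (nl c + 1), Lft (nl c + 1) := Lft (nl c)))"

definition cap_right :: "config \<Rightarrow> config" where
  "cap_right c = Config (nl c) (nr c + 2)
     ((mt c)(Rgt (nr c) := Rgt (nr c + 1), Rgt (nr c + 1) := Rgt (nr c)))"

definition cap :: "nat \<Rightarrow> nat \<Rightarrow> config \<Rightarrow> config" where
  "cap N k c = (if k = 0 then cap_left c else if k = N then cap_right c else c)"

definition gap_left :: "nat \<Rightarrow> config \<Rightarrow> point" where
  "gap_left k c = (if k = 0 then Lft (nl c - 1) else Top (k - 1))"

definition gap_right :: "nat \<Rightarrow> nat \<Rightarrow> config \<Rightarrow> point" where
  "gap_right N k c = (if k = N then Rgt (nr c - 1) else Top k)"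

definition join :: "nat \<Rightarrow> nat \<Rightarrow> config \<Rightarrow> config" where
  "join N k c = Config (nl c) (nr c) (surgery (gap_left k c) (gap_right N k c) (mt c))"

text \<open>The product with the diagram of \<open>e\<^sub>k\<close> on top, before returns are removed. A factor \<open>e\<^sub>0\<close> or
  \<open>e\<^sub>N\<close> adds a return at the upper corner, which is then reconnected like the cap of an inner
  generator; if the two points at the gap are already joined, the result is the same diagram and
  the closed loop is dropped.\<close>

definition ext :: "nat \<Rightarrow> nat \<Rightarrow> config \<Rightarrow> config" where
  "ext N k c = join N k (cap N k c)"

lemma pairing_cap_left: "pairing N c \<Longrightarrow> pairing N (cap_left c)"
proof -
  assume p: "pairing N c"
  have "mt c x \<noteq> Lft (nl c)" "mt c x \<noteq> Lft (Suc (nl c))" if "x \<noteq> Lft (nl c)" "x \<noteq> Lft (Suc (nl c))" for x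
    using pairing_fix[OF p, of "Lft (nl c)"] pairing_fix[OF p, of "Lft (Suc (nl c))"] that
      pairing_mt[OF p, of x] by fastforce+
  moreover have "x \<in> pts N (nl c + 2) (nr c) \<longleftrightarrow>
      x \<in> pts N (nl c) (nr c) \<or> x = Lft (nl c) \<or> x = Lft (Suc (nl c))" for x
    by (cases x) auto
  ultimately show "pairing N (cap_left c)"
    using p by (auto simp: pairing_def cap_left_def)
qed

lemma pairing_cap_right: "pairing N c \<Longrightarrow> pairing N (cap_right c)"
proof -
  assume p: "pairing N c"
  have "mt c x \<noteq> Rgt (nr c)" "mt c x \<noteq> Rgt (Suc (nr c))" if "x \<noteq> Rgt (nr c)" "x \<noteq> Rgt (Suc (nr c))" for x
    using pairing_fix[OF p, of "Rgt (nr c)"] pairing_fix[OF p, of "Rgt (Suc (nr c))"] that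
      pairing_mt[OF p, of x] by fastforce+
  moreover have "x \<in> pts N (nl c) (nr c + 2) \<longleftrightarrow>
      x \<in> pts N (nl c) (nr c) \<or> x = Rgt (nr c) \<or> x = Rgt (Suc (nr c))" for x
    by (cases x) auto
  ultimately show "pairing N (cap_right c)"
    using p by (auto simp: pairing_def cap_right_def)
qed

lemma pairing_cap: "pairing N c \<Longrightarrow> pairing N (cap N k c)"
  by (simp add: cap_def pairing_cap_left pairing_cap_right)

lemma gap_in_pts:
  assumes "k \<le> N" "1 \<le> N"
  shows "gap_left k (cap N k c) \<in> pts N (nl (cap N k c)) (nr (cap N k c))"
    "gap_right N k (cap N k c) \<in> pts N (nl (cap N k c)) (nr (cap N k c))"
    "gap_left k d \<noteq> gap_right N k d"
  using assms by (auto simp: gap_left_def gap_right_def cap_def cap_left_def cap_right_def)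

text \<open>Capping off an existing arc leaves the involution as it is. The loop that arises leaves
  no trace in it and has to be counted separately.\<close>

lemma surgery_trivial: "(\<And>x. s (s x) = x) \<Longrightarrow> s a = b \<Longrightarrow> surgery a b s = s"
  by (auto simp: surgery_def fun_eq_iff)

lemma surgery_values:
  assumes "\<And>x. s (s x) = x" "a \<noteq> b" "s a \<noteq> a" "s b \<noteq> b" "s a \<noteq> b"
  shows "surgery a b s a = b" "surgery a b s b = a" "surgery a b s (s a) = s b"
    "surgery a b s (s b) = s a" "x \<notin> {a, b, s a, s b} \<Longrightarrow> surgery a b s x = s x"
    "s a \<noteq> s b" "s b \<noteq> a" "x \<notin> {a, b, s a, s b} \<Longrightarrow> s x \<notin> {a, b, s a, s b}"
proof -
  show 1: "s a \<noteq> s b" using assms(1,2) by metis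
  show 2: "s b \<noteq> a" using assms(1,5) by metis
  show "x \<notin> {a, b, s a, s b} \<Longrightarrow> s x \<notin> {a, b, s a, s b}"
    using assms(1) by (metis insert_iff empty_iff)
qed (use assms in \<open>auto simp: surgery_def\<close>)

lemma pairing_surgery:
  assumes "pairing N c" "a \<in> pts N (nl c) (nr c)" "b \<in> pts N (nl c) (nr c)" "a \<noteq> b"
  shows "pairing N (Config (nl c) (nr c) (surgery a b (mt c)))"
proof (cases "mt c a = b")
  case True
  then show ?thesis using surgery_trivial[of "mt c" a b] assms(1) by (simp add: pairing_def)
next
  case False
  define s where "s = mt c"
  have s: "\<And>x. s (s x) = x" and s_fix: "\<And>x. s x = x \<longleftrightarrow> x \<notin> pts N (nl c) (nr c)"
    and s_pts: "\<And>x. s x \<in> pts N (nl c) (nr c) \<longleftrightarrow> x \<in> pts N (nl c) (nr c)"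
    using assms(1) by (auto simp: s_def pairing_fix pairing_mt_pts)
  have ne: "s a \<noteq> a" "s b \<noteq> b" "s a \<noteq> b" using assms False s_fix by (auto simp: s_def)
  note t = surgery_values[OF s assms(4) ne]
  have "surgery a b s (surgery a b s x) = x \<and> (surgery a b s x \<noteq> x \<longleftrightarrow> x \<in> pts N (nl c) (nr c))" for x
  proof (cases "x \<in> {a, b, s a, s b}")
    case True
    then show ?thesis using t(1-4,6,7) assms s_pts by auto
  next
    case False
    then show ?thesis using t(5,8) s s_fix by metis
  qed
  then show ?thesis by (simp add: pairing_def s_def)
qed

lemma pairing_ext: "pairing N c \<Longrightarrow> k \<le> N \<Longrightarrow> 1 \<le> N \<Longrightarrow> pairing N (ext N k c)"
  unfolding ext_def join_def using gap_in_pts[of k N c] gap_in_pts(3)[of k N "cap N k c"] pairing_cap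
  by (intro pairing_surgery) auto

text \<open>\<open>a\<close> and \<open>b\<close> are adjacent, so the new arc between them encloses
  no marked point. Modulo 2, the other new arc encloses what the two old arcs at \<open>a\<close>
  and \<open>b\<close> enclose together, and neither of those separates a point from its
  partner.\<close>

lemma planar_surgery:
  assumes pl: "planar c" and p: "pairing N c" and ab: "a \<noteq> b"
    and adj: "\<And>y. y \<in> pts N (nl c) (nr c) \<Longrightarrow> \<not> btw a b y"
    and a: "a \<in> pts N (nl c) (nr c)" and b: "b \<in> pts N (nl c) (nr c)"
  shows "planar (Config (nl c) (nr c) (surgery a b (mt c)))"
proof (cases "mt c a = b")
  case True
  then have "surgery a b (mt c) = mt c" using p by (intro surgery_trivial) auto
  then show ?thesis using pl by (simp add: planar_def)
next
  case False
  define s where "s = mt c"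
  define P where "P = pts N (nl c) (nr c)"
  define t where "t = surgery a b s"
  have ss: "s (s x) = x" for x using p by (simp add: s_def)
  have sP: "s x \<in> P \<longleftrightarrow> x \<in> P" for x using p by (simp add: s_def P_def pairing_mt_pts)
  have sfix: "s x = x \<longleftrightarrow> x \<notin> P" for x using p by (simp add: s_def P_def pairing_fix)
  have inv: "btw x (s x) (s y) = btw x (s x) y" for x y
    using pl p by (simp add: s_def planar_btw_iff)
  have abP: "a \<in> P" "b \<in> P" using a b by (simp_all add: P_def)
  have adj': "\<not> btw a b y" if "y \<in> P" for y using adj that by (simp add: P_def)
  have adj1: "btw a u y \<longleftrightarrow> btw b u y" if "y \<in> P" "y \<noteq> a" "y \<noteq> b" for u y
    using btw_xor[of y b a u] adj'[OF that(1)] that by (cases "y = u") auto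
  \<comment> \<open>Adjacent points lie on the same side of every chord that ends elsewhere.\<close>
  have adj2: "btw u v a \<longleftrightarrow> btw u v b" if "u \<in> P" "v \<in> P" "u \<notin> {a, b}" "v \<notin> {a, b}" for u v
    using adj'[OF that(1)] adj'[OF that(2)] that ab key_inject[of u a] key_inject[of u b]
      key_inject[of v a] key_inject[of v b] unfolding btw_def by (auto simp del: key_inject)
  have ne: "s a \<noteq> b" "s b \<noteq> a" "s a \<noteq> a" "s b \<noteq> b" "s a \<noteq> s b"
    using False abP sfix ss surgery_values(6,7)[OF ss ab] by (auto simp: s_def)
  note t = surgery_values(1-5)[OF ss ab ne(3,4,1), folded t_def]
    and other = surgery_values(8)[OF ss ab ne(3,4,1)]
  have pq: "btw (s a) (s b) y = (btw a (s a) y \<noteq> btw b (s b) y)"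
    if "y \<in> P" "y \<noteq> a" "y \<noteq> b" "y \<noteq> s a" "y \<noteq> s b" for y
    using btw_xor[of y a "s a" "s b"] adj1[OF that(1-3)] that btw_commute by metis
  have main: "btw x (t x) y \<Longrightarrow> btw x (t x) (t y)" if "y \<in> P" for x y
  proof -
    assume B: "btw x (t x) y"
    have x: "x \<in> P"
    proof (rule ccontr)
      assume "x \<notin> P"
      moreover from this have "x \<notin> {a, b, s a, s b}" using abP sP by auto
      ultimately show False using B t(5)[of x] sfix[of x] by simp
    qed
    show "btw x (t x) (t y)"
    proof (cases "x \<in> {a, b}")
      case True
      then show ?thesis using B adj'[OF that] t(1,2) btw_commute by (metis insertE singletonD)
    next
      case xab: False
      show ?thesis
      proof (cases "x \<in> {s a, s b}")
        case True
        have B': "btw (s a) (s b) y" using B True t(3,4) btw_commute by (metis insertE singletonD)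
        then have "y \<notin> {s a, s b}" by auto
        have "btw (s a) (s b) (t y)"
        proof (cases "y \<in> {a, b}")
          case True
          then show ?thesis using B' adj2[of "s a" "s b"] t(1,2) ne sP abP by (metis insertE singletonD)
        next
          case False
          then have "t y = s y" using t(5)[of y] \<open>y \<notin> {s a, s b}\<close> by simp
          moreover have "s y \<notin> {a, b, s a, s b}"
            using \<open>y \<notin> {s a, s b}\<close> False by (intro other) auto
          ultimately show ?thesis
            using pq[of y] pq[of "s y"] B' that sP[of y] inv[of a y] inv[of b y] False \<open>y \<notin> {s a, s b}\<close>
            by (metis insertCI)
        qed
        then show ?thesis using True t(3,4) btw_commute by (metis insertE singletonD)
      next
        case False
        then have x': "x \<notin> {a, b, s a, s b}" using xab by auto
        then have sx: "s x \<notin> {a, b, s a, s b}" using other by blast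
        have "btw x (s x) y" using B t(5)[OF x'] by simp
        then have "btw x (s x) (t y)"
        proof -
          have "btw x (s x) (s a) = btw x (s x) a" "btw x (s x) (s b) = btw x (s x) b"
            "btw x (s x) (s y) = btw x (s x) y"
            using inv by auto
          moreover have "btw x (s x) a = btw x (s x) b"
            using adj2[of x "s x"] x x' sx sP by auto
          moreover have "y = a \<or> y = b \<or> y = s a \<or> y = s b \<or> t y = s y"
            using t(5)[of y] by auto
          ultimately show ?thesis using \<open>btw x (s x) y\<close> t(1-4) by metis
        qed
        then show ?thesis using t(5)[OF x'] by simp
      qed
    qed
  qed
  have "btw x (t x) y \<longrightarrow> btw x (t x) (t y)" for x y
  proof (cases "y \<in> P")
    case False
    then have "y \<notin> {a, b, s a, s b}" using abP sP by auto
    then have "t y = y" using False t(5)[of y] sfix[of y] by simp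
    then show ?thesis by simp
  qed (use main in blast)
  then show ?thesis by (simp add: planar_def t_def s_def)
qed

lemma planar_insert_arc:
  assumes "planar c" "pairing N c" "u \<noteq> v" "mt c u = u" "mt c v = v" "\<And>y. \<not> btw u v y"
  shows "planar (Config l r ((mt c)(u := v, v := u)))"
proof -
  have ne: "mt c x \<noteq> u" "mt c x \<noteq> v" if "x \<noteq> u" "x \<noteq> v" for x
    using that assms(2,4,5) by (metis pairing_mt)+
  have side: "key x < key u \<longleftrightarrow> key x < key v" "key u < key x \<longleftrightarrow> key v < key x"
    if "x \<noteq> u" "x \<noteq> v" for x
    using assms(6)[of x] key_inject[of x u] key_inject[of x v] that unfolding btw_def
    by (auto simp del: key_inject)
  have adj: "btw x y u \<longleftrightarrow> btw x y v" if "x \<noteq> u" "x \<noteq> v" "y \<noteq> u" "y \<noteq> v" for x y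
    using side[OF that(1,2)] side[OF that(3,4)] unfolding btw_def by blast
  let ?t = "(mt c)(u := v, v := u)"
  have "btw x (?t x) (?t y)" if "btw x (?t x) y" for x y
  proof (cases "x = u \<or> x = v")
    case True
    then show ?thesis using that assms(6)[of y] btw_commute[of u v y] assms(3) by auto
  next
    case False
    then have "btw x (mt c x) y" "mt c x \<noteq> u" "mt c x \<noteq> v" using that ne by auto
    moreover from this have "btw x (mt c x) (?t y)"
      using adj[of x "mt c x"] False assms(1) by (cases "y = u \<or> y = v") (auto simp: planar_def)
    ultimately show ?thesis using False by auto
  qed
  then show ?thesis by (simp add: planar_def)
qed

lemma planar_cap:
  assumes "planar c" "pairing N c"
  shows "planar (cap N k c)"
proof -
  have "\<not> btw (Lft (nl c)) (Lft (nl c + 1)) y" "\<not> btw (Rgt (nr c)) (Rgt (nr c + 1)) y" for y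
    by (cases y; auto simp: btw_def)+
  moreover have "mt c (Lft (nl c)) = Lft (nl c)" "mt c (Lft (nl c + 1)) = Lft (nl c + 1)"
    "mt c (Rgt (nr c)) = Rgt (nr c)" "mt c (Rgt (nr c + 1)) = Rgt (nr c + 1)"
    using pairing_fix[OF assms(2)] by auto
  ultimately show ?thesis
    unfolding cap_def cap_left_def cap_right_def
    using assms(1) by (auto intro!: planar_insert_arc[OF assms] simp del: fun_upd_apply)
qed

lemma planar_config_cap: "planar_config N c \<Longrightarrow> planar_config N (cap N k c)"
  using planar_cap[of c N k] pairing_cap[of N c k]
  by (auto simp: planar_config_def cap_def cap_left_def cap_right_def)

lemma gap_adjacent:
  assumes "y \<in> pts N (nl c) (nr c)" "1 \<le> N"
  shows "\<not> btw (gap_left k c) (gap_right N k c) y"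
  using assms by (cases y) (auto simp: btw_def gap_left_def gap_right_def)

lemma planar_config_ext:
  assumes "planar_config N c" "k \<le> N" "1 \<le> N"
  shows "planar_config N (ext N k c)"
proof -
  have c: "planar_config N (cap N k c)" using planar_config_cap assms(1) by blast
  have "planar (ext N k c)"
    unfolding ext_def join_def
    using c gap_in_pts assms gap_adjacent
    by (intro planar_surgery) (auto simp: planar_config_def)
  then show ?thesis
    using pairing_ext c assms by (auto simp: planar_config_def ext_def join_def)
qed


section \<open>Reconnecting arcs in a graph\<close>

text \<open>In a symmetric graph a path need not pass the new edge more than once, in one direction
  or the other.\<close>

lemma rtrancl_add_edge:
  assumes "sym E"
  shows "(u, v) \<in> (E \<union> {(a, b), (b, a)})\<^sup>* \<longleftrightarrow>
    (u, v) \<in> E\<^sup>* \<or> (u, a) \<in> E\<^sup>* \<and> (b, v) \<in> E\<^sup>* \<or> (u, b) \<in> E\<^sup>* \<and> (a, v) \<in> E\<^sup>*"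
proof -
  have s: "(x, y) \<in> E\<^sup>* \<longleftrightarrow> (y, x) \<in> E\<^sup>*" for x y
    using sym_rtrancl[OF assms] by (auto dest: symD)
  have t: "(x, y) \<in> E\<^sup>* \<Longrightarrow> (y, z) \<in> E\<^sup>* \<Longrightarrow> (x, z) \<in> E\<^sup>*" for x y z
    by (rule rtrancl_trans)
  have "E \<union> {(a, b), (b, a)} = insert (a, b) (insert (b, a) E)" by blast
  then show ?thesis
    by (simp only: rtrancl_insert Un_iff mem_Collect_eq case_prod_conv) (metis s t)
qed

lemma rtrancl_isolated: "x \<notin> Field E \<Longrightarrow> (x, v) \<in> E\<^sup>* \<longleftrightarrow> v = x" "x \<notin> Field E \<Longrightarrow> (v, x) \<in> E\<^sup>* \<longleftrightarrow> v = x"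
  by (auto simp: Field_def elim: converse_rtranclE rtranclE)

text \<open>In the graph \<open>G\<close>, \<open>x\<close> and \<open>y\<close> are end points, hanging from \<open>p\<close> and \<open>q\<close>; in \<open>H\<close> the arcs are
  reconnected as \<open>x y\<close> and \<open>p q\<close>.\<close>

locale reconnect =
  fixes E :: "'v rel" and x y p q :: 'v
  assumes sym_E: "sym E" and x_E: "x \<notin> Field E" and y_E: "y \<notin> Field E"
    and neq: "x \<noteq> y" "p \<noteq> x" "p \<noteq> y" "q \<noteq> x" "q \<noteq> y"
begin

definition "G = E \<union> {(x, p), (p, x)} \<union> {(y, q), (q, y)}"
definition "H = E \<union> {(x, y), (y, x)} \<union> {(p, q), (q, p)}"

lemma conn_sym: "(u, v) \<in> E\<^sup>* \<longleftrightarrow> (v, u) \<in> E\<^sup>*"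
  using sym_rtrancl[OF sym_E] by (auto dest: symD)

lemma conn_trans: "(u, v) \<in> E\<^sup>* \<Longrightarrow> (v, w) \<in> E\<^sup>* \<Longrightarrow> (u, w) \<in> E\<^sup>*"
  by (rule rtrancl_trans)

lemma conn_ends: "(x, v) \<in> E\<^sup>* \<longleftrightarrow> v = x" "(v, x) \<in> E\<^sup>* \<longleftrightarrow> v = x"
    "(y, v) \<in> E\<^sup>* \<longleftrightarrow> v = y" "(v, y) \<in> E\<^sup>* \<longleftrightarrow> v = y"
  using rtrancl_isolated x_E y_E by metis+

lemma G_iff:
  "(x, v) \<in> G\<^sup>* \<longleftrightarrow> v = x \<or> (p, v) \<in> E\<^sup>* \<or> (p, q) \<in> E\<^sup>* \<and> v = y"
  "(y, v) \<in> G\<^sup>* \<longleftrightarrow> v = y \<or> (q, v) \<in> E\<^sup>* \<or> (q, p) \<in> E\<^sup>* \<and> v = x"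
  "u \<noteq> x \<Longrightarrow> u \<noteq> y \<Longrightarrow> (u, v) \<in> G\<^sup>* \<longleftrightarrow>
     (u, v) \<in> E\<^sup>* \<or> (u, p) \<in> E\<^sup>* \<and> v = x \<or> (u, q) \<in> E\<^sup>* \<and> v = y"
proof -
  have 1: "sym (E \<union> {(x, p), (p, x)})" using sym_E by (auto simp: sym_def)
  show "(x, v) \<in> G\<^sup>* \<longleftrightarrow> v = x \<or> (p, v) \<in> E\<^sup>* \<or> (p, q) \<in> E\<^sup>* \<and> v = y"
    "(y, v) \<in> G\<^sup>* \<longleftrightarrow> v = y \<or> (q, v) \<in> E\<^sup>* \<or> (q, p) \<in> E\<^sup>* \<and> v = x"
    "u \<noteq> x \<Longrightarrow> u \<noteq> y \<Longrightarrow> (u, v) \<in> G\<^sup>* \<longleftrightarrow>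
      (u, v) \<in> E\<^sup>* \<or> (u, p) \<in> E\<^sup>* \<and> v = x \<or> (u, q) \<in> E\<^sup>* \<and> v = y"
    unfolding G_def rtrancl_add_edge[OF 1] rtrancl_add_edge[OF sym_E] conn_ends
    using neq conn_sym conn_trans by (auto; metis)+
qed

lemma H_iff:
  "(x, v) \<in> H\<^sup>* \<longleftrightarrow> v = x \<or> v = y"
  "(y, v) \<in> H\<^sup>* \<longleftrightarrow> v = x \<or> v = y"
  "u \<noteq> x \<Longrightarrow> u \<noteq> y \<Longrightarrow> (u, v) \<in> H\<^sup>* \<longleftrightarrow>
     (u, v) \<in> E\<^sup>* \<or> (u, p) \<in> E\<^sup>* \<and> (q, v) \<in> E\<^sup>* \<or> (u, q) \<in> E\<^sup>* \<and> (p, v) \<in> E\<^sup>*"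
proof -
  have 1: "sym (E \<union> {(x, y), (y, x)})" using sym_E by (auto simp: sym_def)
  show "(x, v) \<in> H\<^sup>* \<longleftrightarrow> v = x \<or> v = y"
    "(y, v) \<in> H\<^sup>* \<longleftrightarrow> v = x \<or> v = y"
    "u \<noteq> x \<Longrightarrow> u \<noteq> y \<Longrightarrow> (u, v) \<in> H\<^sup>* \<longleftrightarrow>
      (u, v) \<in> E\<^sup>* \<or> (u, p) \<in> E\<^sup>* \<and> (q, v) \<in> E\<^sup>* \<or> (u, q) \<in> E\<^sup>* \<and> (p, v) \<in> E\<^sup>*"
    unfolding H_def rtrancl_add_edge[OF 1] rtrancl_add_edge[OF sym_E] conn_ends
    using neq by auto
qed

end

text \<open>Abstract form of \<open>closed_loops\<close>: connected components without outer points.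
  The starting points come from a separate set \<open>Z\<close>, which is finite in the application
  while the set \<open>I\<close> of all inner points of the type is not.\<close>

definition loops :: "'v rel \<Rightarrow> 'v set \<Rightarrow> 'v set \<Rightarrow> 'v set set" where
  "loops E Z I = {C. \<exists>z\<in>Z. C = E\<^sup>* `` {z} \<and> C \<subseteq> I}"

lemma finite_loops: "finite Z \<Longrightarrow> finite (loops E Z I)"
  by (rule finite_subset[of _ "(\<lambda>z. E\<^sup>* `` {z}) ` Z"]) (auto simp: loops_def)

text \<open>The points outside \<open>I\<close> are labelled by \<open>out\<close>; in \<open>G\<close> each component contains at most two of
  them, and the involution \<open>s\<close> interchanges these.\<close>

locale reconnect_ends = reconnect E x y p q for E :: "'v rel" and x y p q +
  fixes out :: "'l \<Rightarrow> 'v" and s :: "'l \<Rightarrow> 'l" and a b :: 'l and I Z :: "'v set"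
  assumes inj_out: "inj out" and xy: "x = out a" "y = out b"
    and s_s: "\<And>l. s (s l) = l" and s_a: "s a \<noteq> a" and s_b: "s b \<noteq> b"
    and conn_G: "\<And>l m. l \<noteq> m \<Longrightarrow> (out l, out m) \<in> G\<^sup>* \<longleftrightarrow> s l = m"
    and I: "- I = range out" and Z: "Z \<subseteq> I" "finite Z" "p \<in> I \<Longrightarrow> p \<in> Z"
begin

lemma out_eq: "out l = out m \<longleftrightarrow> l = m"
  using inj_out by (auto simp: inj_def)

lemma ab: "a \<noteq> b"
  using neq xy by auto

lemma out_I: "out l \<notin> I"
  using I by blast

lemma conn_E: "l \<noteq> m \<Longrightarrow> l \<noteq> a \<Longrightarrow> l \<noteq> b \<Longrightarrow> m \<noteq> a \<Longrightarrow> m \<noteq> b \<Longrightarrow> (out l, out m) \<in> E\<^sup>* \<longleftrightarrow> s l = m"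
  using conn_G[of l m] G_iff(3)[of "out l" "out m"] by (simp add: xy out_eq)

lemma conn_p: "l \<noteq> a \<Longrightarrow> l \<noteq> b \<Longrightarrow> (p, out l) \<in> E\<^sup>* \<longleftrightarrow> s a = l"
  using conn_G[of a l] G_iff(1)[of "out l"] by (simp add: xy out_eq)

lemma conn_q: "l \<noteq> a \<Longrightarrow> l \<noteq> b \<Longrightarrow> (q, out l) \<in> E\<^sup>* \<longleftrightarrow> s b = l"
  using conn_G[of b l] G_iff(2)[of "out l"] by (simp add: xy out_eq)

lemma conn_pq: "(p, q) \<in> E\<^sup>* \<longleftrightarrow> s a = b"
  using conn_G[of a b] G_iff(1)[of "out b"] conn_ends neq ab by (auto simp: xy out_eq)

text \<open>In \<open>G\<close> the paths from \<open>x\<close> and \<open>y\<close> run through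
  \<open>p\<close> and \<open>q\<close> to the ends labelled \<open>s a\<close> and
  \<open>s b\<close>. Splitting off the arc \<open>x y\<close> and joining \<open>p\<close> to
  \<open>q\<close> links those ends, which is surgery on the labels.\<close>

lemma conn_H:
  assumes "l \<noteq> m"
  shows "(out l, out m) \<in> H\<^sup>* \<longleftrightarrow> surgery a b s l = m"
proof -
  consider "l = a" | "l = b" | "l \<noteq> a" "l \<noteq> b" by blast
  then show ?thesis
  proof cases
    case 3
    have H: "(out l, out m) \<in> H\<^sup>* \<longleftrightarrow> (out l, out m) \<in> E\<^sup>* \<or>
      (p, out l) \<in> E\<^sup>* \<and> (q, out m) \<in> E\<^sup>* \<or> (q, out l) \<in> E\<^sup>* \<and> (p, out m) \<in> E\<^sup>*"
      using H_iff(3)[of "out l" "out m"] 3 xy out_eq conn_sym by metis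
    show ?thesis
    proof (cases "m = a \<or> m = b")
      case True
      have "(out l, out m) \<notin> H\<^sup>*"
        unfolding H using True 3 conn_ends neq xy out_eq by metis
      moreover have "surgery a b s l \<noteq> m" using True 3 s_s[of a] s_s[of b] s_s[of l] s_a s_b ab unfolding surgery_def by (auto split: if_splits)
      ultimately show ?thesis by simp
    next
      case False
      then have "(out l, out m) \<in> H\<^sup>* \<longleftrightarrow> s l = m \<or> s a = l \<and> s b = m \<or> s b = l \<and> s a = m"
        unfolding H using conn_E conn_p conn_q 3 assms by simp
      also have "\<dots> \<longleftrightarrow> surgery a b s l = m"
        using 3 False assms s_s[of a] s_s[of b] ab unfolding surgery_def
        by (cases "l = s a"; cases "l = s b") auto
      finally show ?thesis .
    qed
  qed (use H_iff[of "out m"] assms ab in \<open>auto simp: xy out_eq surgery_def\<close>)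
qed

text \<open>If the path from \<open>x\<close> ends in \<open>y\<close>, the piece between
  \<open>p\<close> and \<open>q\<close> carries no other outer point and is closed by the new edge:
  one loop more. Otherwise \<open>p\<close> and \<open>q\<close> lead to outer points both before
  and after, and the components without outer points are the same in \<open>G\<close> and
  \<open>H\<close>.\<close>

lemma loops_H:
  "loops H Z I = (if s a = b then insert (E\<^sup>* `` {p}) (loops G Z I) else loops G Z I)"
  "s a = b \<Longrightarrow> E\<^sup>* `` {p} \<notin> loops G Z I"
proof -
  have zI: "z \<noteq> x" "z \<noteq> y" if "z \<in> I" for z using that xy out_I by auto
  have same: "G\<^sup>* `` {z} = E\<^sup>* `` {z}" "H\<^sup>* `` {z} = E\<^sup>* `` {z}"
    if "z \<in> I" "(z, p) \<notin> E\<^sup>*" "(z, q) \<notin> E\<^sup>*" for z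
    using G_iff(3)[of z] H_iff(3)[of z] that zI by auto
  have not_loop: "\<not> G\<^sup>* `` {z} \<subseteq> I" if "z \<in> I" "(z, p) \<in> E\<^sup>* \<or> (z, q) \<in> E\<^sup>*" for z
    using G_iff(3)[of z] that zI xy out_I by blast
  show "s a = b \<Longrightarrow> E\<^sup>* `` {p} \<notin> loops G Z I"
  proof
    assume "E\<^sup>* `` {p} \<in> loops G Z I"
    then obtain z where "z \<in> Z" "E\<^sup>* `` {p} = G\<^sup>* `` {z}" "G\<^sup>* `` {z} \<subseteq> I"
      by (auto simp: loops_def)
    moreover from this have "(z, z) \<in> G\<^sup>*" "z \<in> I" using Z by auto
    ultimately have "(p, z) \<in> E\<^sup>*" by blast
    then show False using not_loop \<open>z \<in> I\<close> \<open>G\<^sup>* `` {z} \<subseteq> I\<close> conn_sym by blast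
  qed
  show "loops H Z I = (if s a = b then insert (E\<^sup>* `` {p}) (loops G Z I) else loops G Z I)"
  proof (cases "s a = b")
    case True
    then have pq: "(p, q) \<in> E\<^sup>*" using conn_pq by simp
    have cp: "E\<^sup>* `` {p} \<subseteq> I"
    proof (rule ccontr)
      assume "\<not> E\<^sup>* `` {p} \<subseteq> I"
      then obtain v where "(p, v) \<in> E\<^sup>*" "v \<in> - I" by auto
      then obtain l where l: "(p, out l) \<in> E\<^sup>*" unfolding I by auto
      then have "l \<noteq> a" "l \<noteq> b" using conn_ends neq xy by auto
      then show False using l conn_p True by auto
    qed
    then have "p \<in> Z" using Z by auto
    have Hz: "H\<^sup>* `` {z} = E\<^sup>* `` {z}" if "z \<in> I" for z
    proof -
      have "(z, v) \<in> H\<^sup>* \<longleftrightarrow> (z, v) \<in> E\<^sup>*" for v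
        using H_iff(3)[OF zI[OF that], of v] pq conn_sym conn_trans by metis
      then show ?thesis by auto
    qed
    have *: "E\<^sup>* `` {z} = E\<^sup>* `` {p}" if "(z, p) \<in> E\<^sup>* \<or> (z, q) \<in> E\<^sup>*" for z
    proof -
      have "(z, p) \<in> E\<^sup>*" using that pq conn_sym conn_trans by metis
      then have "(z, v) \<in> E\<^sup>* \<longleftrightarrow> (p, v) \<in> E\<^sup>*" for v using conn_sym conn_trans by metis
      then show ?thesis by auto
    qed
    have "C \<in> loops H Z I \<longleftrightarrow> C = E\<^sup>* `` {p} \<or> C \<in> loops G Z I" for C
    proof -
      have "C \<in> loops H Z I \<longleftrightarrow> (\<exists>z\<in>Z. C = E\<^sup>* `` {z} \<and> C \<subseteq> I)"
        unfolding loops_def using Hz Z by auto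
      also have "\<dots> \<longleftrightarrow> C = E\<^sup>* `` {p} \<or> C \<in> loops G Z I"
      proof
        assume "\<exists>z\<in>Z. C = E\<^sup>* `` {z} \<and> C \<subseteq> I"
        then obtain z where z: "z \<in> Z" "C = E\<^sup>* `` {z}" "C \<subseteq> I" by blast
        then show "C = E\<^sup>* `` {p} \<or> C \<in> loops G Z I"
        proof (cases "(z, p) \<in> E\<^sup>* \<or> (z, q) \<in> E\<^sup>*")
          case False
          then have "G\<^sup>* `` {z} = C" using same(1)[of z] z Z(1) by auto
          then have "C \<in> loops G Z I" using z(1,3) unfolding loops_def by blast
          then show ?thesis ..
        next
          case True
          then show ?thesis using *[OF True] z(2) by simp
        qed
      next
        assume "C = E\<^sup>* `` {p} \<or> C \<in> loops G Z I"
        then show "\<exists>z\<in>Z. C = E\<^sup>* `` {z} \<and> C \<subseteq> I"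
        proof
          assume "C \<in> loops G Z I"
          then obtain z where z: "z \<in> Z" "C = G\<^sup>* `` {z}" "C \<subseteq> I" by (auto simp: loops_def)
          then have "(z, p) \<notin> E\<^sup>*" "(z, q) \<notin> E\<^sup>*" using not_loop[of z] Z(1) by auto
          then show ?thesis using same(1)[of z] z Z(1) by auto
        qed (use cp \<open>p \<in> Z\<close> in blast)
      qed
      finally show ?thesis .
    qed
    then show ?thesis using True by auto
  next
    case False
    have 1: "s a \<noteq> a" "s a \<noteq> b" "s b \<noteq> a" "s b \<noteq> b" using False s_a s_b s_s by metis+
    have "(p, out (s a)) \<in> E\<^sup>*" "(q, out (s b)) \<in> E\<^sup>*" using 1 conn_p conn_q by auto
    then have "\<not> H\<^sup>* `` {z} \<subseteq> I" if "z \<in> I" "(z, p) \<in> E\<^sup>* \<or> (z, q) \<in> E\<^sup>*" for z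
      using H_iff(3)[OF zI[OF that(1)]] that(2) out_I by (meson Image_singleton_iff subsetD)
    then have not_loop': "\<And>z. z \<in> I \<Longrightarrow> (z, p) \<in> E\<^sup>* \<or> (z, q) \<in> E\<^sup>* \<Longrightarrow> \<not> H\<^sup>* `` {z} \<subseteq> I" .
    have "(H\<^sup>* `` {z} \<subseteq> I \<longleftrightarrow> G\<^sup>* `` {z} \<subseteq> I) \<and> (H\<^sup>* `` {z} \<subseteq> I \<longrightarrow> H\<^sup>* `` {z} = G\<^sup>* `` {z})"
      if "z \<in> Z" for z
    proof (cases "(z, p) \<in> E\<^sup>* \<or> (z, q) \<in> E\<^sup>*")
      case True
      then show ?thesis using not_loop[of z] not_loop'[of z] that Z(1) by blast
    next
      case False
      then have "H\<^sup>* `` {z} = G\<^sup>* `` {z}" using same[of z] that Z(1) by auto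
      then show ?thesis by simp
    qed
    then have "loops H Z I = loops G Z I" unfolding loops_def by (metis (no_types, lifting))
    then show ?thesis using False by simp
  qed
qed

lemma card_loops_H: "card (loops H Z I) = card (loops G Z I) + (if s a = b then 1 else 0)"
  using loops_H finite_loops[OF Z(2)] by simp

end


section \<open>The graph of two stacked diagrams\<close>

abbreviation low :: "point \<Rightarrow> stacked_point" where
  "low \<equiv> embed_lower"

abbreviation up :: "config \<Rightarrow> point \<Rightarrow> stacked_point" where
  "up c \<equiv> embed_upper (diagram_of c)"

lemma low_inject [simp]: "low x = low y \<longleftrightarrow> x = y"
  by (cases x; cases y) auto

lemma lefts_rights_diagram_of [simp]: "lefts (diagram_of c) = nl c" "rights (diagram_of c) = nr c"
  by (simp_all add: diagram_of_def)

lemma up_inject [simp]: "up c x = up c y \<longleftrightarrow> x = y"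
  by (cases x; cases y) auto

text \<open>The side points of the upper diagram are shifted beyond those of the lower one, so the
  two images can meet only in inner points; the bound on \<open>x\<close> excludes an overlap on the
  sides.\<close>

lemma low_neq_up:
  "x \<in> pts N (nl c) (nr c) \<Longrightarrow> up c y = low x \<Longrightarrow> \<exists>i. x = Top i \<and> y = Bot i"
  by (cases x; cases y) auto

definition edges :: "nat \<Rightarrow> config \<Rightarrow> config \<Rightarrow> stacked_point rel" where
  "edges N a b = {(low x, low (mt a x)) | x. x \<in> pts N (nl a) (nr a)} \<union>
     {(up a x, up a (mt b x)) | x. x \<in> pts N (nl b) (nr b)}"

lemma edges_eq:
  assumes "pairing N a" "pairing N b"
  shows "{(x, y). {x, y} \<in> stacked_arcs (diagram_of a) (diagram_of b)} = edges N a b"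
proof -
  have arcs: "arcs (diagram_of c) = (\<lambda>x. {x, mt c x}) ` pts N (nl c) (nr c)"
    if "pairing N c" for c
    using that by (auto simp: diagram_of_def pairing_def)
  have "{x, y} \<in> (`) f ` arcs (diagram_of c) \<longleftrightarrow>
      (\<exists>z\<in>pts N (nl c) (nr c). x = f z \<and> y = f (mt c z))" if c: "pairing N c" for f :: "point \<Rightarrow> stacked_point" and c x y
  proof -
    have "{x, y} \<in> (`) f ` arcs (diagram_of c) \<longleftrightarrow>
      (\<exists>z\<in>pts N (nl c) (nr c). {x, y} = {f z, f (mt c z)})"
      unfolding arcs[OF c] by (simp add: image_iff)
    also have "\<dots> \<longleftrightarrow> (\<exists>z\<in>pts N (nl c) (nr c). x = f z \<and> y = f (mt c z))"
      using pairing_mt_pts[OF c] pairing_mt[OF c] by (metis doubleton_eq_iff)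
    finally show ?thesis .
  qed
  from this[OF assms(1)] this[OF assms(2)] show ?thesis
    unfolding stacked_arcs_def edges_def by auto
qed

lemma sym_edges: "pairing N a \<Longrightarrow> pairing N b \<Longrightarrow> sym (edges N a b)"
  unfolding edges_eq[symmetric] by (auto simp: sym_def insert_commute)

lemma joined_eq: "pairing N a \<Longrightarrow> pairing N b \<Longrightarrow>
    joined (diagram_of a) (diagram_of b) = (edges N a b)\<^sup>*"
  by (simp add: joined_def edges_eq)

abbreviation inner :: "nat \<Rightarrow> stacked_point set" where
  "inner N \<equiv> Inner ` {..<N}"

lemma closed_loops_eq: "pairing N a \<Longrightarrow> pairing N b \<Longrightarrow>
    closed_loops N (diagram_of a) (diagram_of b) = loops (edges N a b) (inner N) (range Inner)"
  by (auto simp: closed_loops_def loops_def joined_eq)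

text \<open>A relation and not a function: the involution of a stack is given only through
  reachability, and it is built up from the identity diagram one generator at a time. The condition
  \<open>x \<noteq> y\<close> is there because every point reaches itself.\<close>

definition stacks_to :: "nat \<Rightarrow> config \<Rightarrow> config \<Rightarrow> config \<Rightarrow> bool" where
  "stacks_to N a b c \<longleftrightarrow> pairing N a \<and> pairing N b \<and> pairing N c \<and>
     nl c = nl a + nl b \<and> nr c = nr a + nr b \<and>
     (\<forall>x y. x \<noteq> y \<longrightarrow> (Outer x, Outer y) \<in> (edges N a b)\<^sup>* \<longleftrightarrow> mt c x = y)"


section \<open>Stacking\<close>

lemma stack_eqI:
  assumes "stacks_to N a b c"
  shows "stack (diagram_of a) (diagram_of b) = diagram_of c"
proof -
  have *: "p \<noteq> q \<and> (Outer p, Outer q) \<in> joined (diagram_of a) (diagram_of b) \<longleftrightarrow> p \<noteq> q \<and> mt c p = q"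
    for p q
    using assms by (auto simp: stacks_to_def joined_eq)
  have "{{p, q} | p q. p \<noteq> q \<and> (Outer p, Outer q) \<in> joined (diagram_of a) (diagram_of b)} =
    {{p, mt c p} | p. mt c p \<noteq> p}"
    by (rule Collect_cong) (metis *)
  then show ?thesis
    using assms unfolding stack_def by (simp add: diagram_of_def stacks_to_def)
qed

lemma Field_edges:
  assumes "pairing N a" "pairing N b"
  shows "Field (edges N a b) \<subseteq> Outer ` pts N (nl a + nl b) (nr a + nr b) \<union> inner N"
proof -
  have "low x \<in> Outer ` pts N (nl a + nl b) (nr a + nr b) \<union> inner N" if "x \<in> pts N (nl a) (nr a)" for x
    using that by (cases x) auto
  moreover have "up a x \<in> Outer ` pts N (nl a + nl b) (nr a + nr b) \<union> inner N" if "x \<in> pts N (nl b) (nr b)" for x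
    using that by (cases x) auto
  ultimately show ?thesis
    using pairing_mt_pts[OF assms(1)] pairing_mt_pts[OF assms(2)]
    unfolding edges_def Field_def by blast
qed

lemma rtrancl_isolated_edge:
  assumes "sym E" "u \<notin> Field E" "v \<notin> Field E" "u \<noteq> v"
  shows "(x, y) \<in> (E \<union> {(u, v), (v, u)})\<^sup>* \<longleftrightarrow>
    (if x = u \<or> x = v then y = u \<or> y = v else (x, y) \<in> E\<^sup>*)"
  unfolding rtrancl_add_edge[OF assms(1)] rtrancl_isolated[OF assms(2)] rtrancl_isolated[OF assms(3)]
  using assms(4) rtrancl_isolated[OF assms(2)] rtrancl_isolated[OF assms(3)] by auto

lemma loops_isolated_edge:
  assumes "sym E" "u \<notin> Field E" "v \<notin> Field E" "u \<noteq> v" "Z \<subseteq> I" "u \<notin> I" "v \<notin> I"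
  shows "loops (E \<union> {(u, v), (v, u)}) Z I = loops E Z I"
proof -
  have "(E \<union> {(u, v), (v, u)})\<^sup>* `` {z} = E\<^sup>* `` {z}" if "z \<in> Z" for z
  proof -
    have "z \<noteq> u" "z \<noteq> v" using that assms(5-7) by auto
    then show ?thesis using rtrancl_isolated_edge[OF assms(1-4), of z] by auto
  qed
  then show ?thesis unfolding loops_def by (metis (no_types, lifting))
qed

lemma stacks_to_insert_arc:
  assumes "stacks_to N a b c" "edges N a b' = edges N a b \<union> {(Outer u, Outer v), (Outer v, Outer u)}"
    "pairing N b'" "pairing N c'" "nl c' = nl a + nl b'" "nr c' = nr a + nr b'"
    "u \<noteq> v" "u \<notin> pts N (nl c) (nr c)" "v \<notin> pts N (nl c) (nr c)" "mt c' = (mt c)(u := v, v := u)"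
  shows "stacks_to N a b' c'"
    "loops (edges N a b') (inner N) (range Inner) = loops (edges N a b) (inner N) (range Inner)"
proof -
  have p: "pairing N a" "pairing N b" "pairing N c" using assms(1) by (auto simp: stacks_to_def)
  have F: "Outer u \<notin> Field (edges N a b)" "Outer v \<notin> Field (edges N a b)" "Outer u \<noteq> Outer v"
    using assms(1,7-9) Field_edges[OF p(1,2)] by (auto simp: stacks_to_def)
  have "mt c x \<noteq> u" "mt c x \<noteq> v" if "x \<noteq> u" "x \<noteq> v" for x
    using pairing_fix[OF p(3)] assms(8,9) that pairing_mt[OF p(3)] by metis+
  then show "stacks_to N a b' c'"
    using assms(1,3-7,10) p
    unfolding stacks_to_def assms(2) rtrancl_isolated_edge[OF sym_edges[OF p(1,2)] F] by auto
  show "loops (edges N a b') (inner N) (range Inner) = loops (edges N a b) (inner N) (range Inner)"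
    unfolding assms(2) by (intro loops_isolated_edge F sym_edges p) auto
qed

lemma edges_insert_arc:
  assumes "pts N (nl b') (nr b') = pts N (nl b) (nr b) \<union> {u, v}" "u \<notin> pts N (nl b) (nr b)"
    "v \<notin> pts N (nl b) (nr b)" "u \<noteq> v" "mt b' = (mt b)(u := v, v := u)"
  shows "edges N a b' = edges N a b \<union> {(up a u, up a v), (up a v, up a u)}"
proof -
  have eq: "mt b' x = mt b x" if "x \<in> pts N (nl b) (nr b)" for x
    using that assms(2,3,5) by auto
  have uv: "mt b' u = v" "mt b' v = u" using assms(4,5) by auto
  have img: "{F x | x. x \<in> S} = F ` S" for F :: "point \<Rightarrow> stacked_point \<times> stacked_point" and S :: "point set"
    by blast
  have "(\<lambda>x. (up a x, up a (mt b' x))) ` (pts N (nl b) (nr b) \<union> {u, v}) =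
    (\<lambda>x. (up a x, up a (mt b x))) ` pts N (nl b) (nr b) \<union> {(up a u, up a v), (up a v, up a u)}"
    unfolding image_Un using eq uv by simp
  then show ?thesis
    unfolding edges_def assms(1) img by (simp only: Un_assoc)
qed

text \<open>The return is added above all side points of \<open>b\<close>, hence also above those of
  the stack, and it is not connected to anything else.\<close>

lemma stacks_to_cap:
  assumes "stacks_to N a b c"
  shows "stacks_to N a (cap N k b) (cap N k c)"
    "loops (edges N a (cap N k b)) (inner N) (range Inner) = loops (edges N a b) (inner N) (range Inner)"
proof -
  have p: "pairing N a" "pairing N b" "pairing N c" and n: "nl c = nl a + nl b" "nr c = nr a + nr b"
    using assms by (auto simp: stacks_to_def)
  have "pts N (nl b + 2) (nr b) = pts N (nl b) (nr b) \<union> {Lft (nl b), Lft (nl b + 1)}"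
    "pts N (nl b) (nr b + 2) = pts N (nl b) (nr b) \<union> {Rgt (nr b), Rgt (nr b + 1)}"
    by (auto simp: pts_def)
  then have "edges N a (cap_left b) = edges N a b \<union>
      {(up a (Lft (nl b)), up a (Lft (nl b + 1))), (up a (Lft (nl b + 1)), up a (Lft (nl b)))}"
    "edges N a (cap_right b) = edges N a b \<union>
      {(up a (Rgt (nr b)), up a (Rgt (nr b + 1))), (up a (Rgt (nr b + 1)), up a (Rgt (nr b)))}"
    by (intro edges_insert_arc; simp add: cap_left_def cap_right_def)+
  then have e: "edges N a (cap_left b) = edges N a b \<union>
      {(Outer (Lft (nl c)), Outer (Lft (nl c + 1))), (Outer (Lft (nl c + 1)), Outer (Lft (nl c)))}"
    "edges N a (cap_right b) = edges N a b \<union>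
      {(Outer (Rgt (nr c)), Outer (Rgt (nr c + 1))), (Outer (Rgt (nr c + 1)), Outer (Rgt (nr c)))}"
    using n by simp_all
  have "stacks_to N a (cap_left b) (cap_left c) \<and>
    loops (edges N a (cap_left b)) (inner N) (range Inner) = loops (edges N a b) (inner N) (range Inner)"
    using n by (intro conjI stacks_to_insert_arc[OF assms e(1) pairing_cap_left[OF p(2)]
        pairing_cap_left[OF p(3)]]) (simp_all add: cap_left_def)
  moreover have "stacks_to N a (cap_right b) (cap_right c) \<and>
    loops (edges N a (cap_right b)) (inner N) (range Inner) = loops (edges N a b) (inner N) (range Inner)"
    using n by (intro conjI stacks_to_insert_arc[OF assms e(2) pairing_cap_right[OF p(2)]
        pairing_cap_right[OF p(3)]]) (simp_all add: cap_right_def)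
  ultimately show "stacks_to N a (cap N k b) (cap N k c)"
    "loops (edges N a (cap N k b)) (inner N) (range Inner) = loops (edges N a b) (inner N) (range Inner)"
    using assms by (auto simp: cap_def)
qed

lemma compl_range_Inner: "- range Inner = range Outer"
proof (intro Set.set_eqI)
  fix x :: stacked_point
  show "x \<in> - range Inner \<longleftrightarrow> x \<in> range Outer" by (cases x) auto
qed

text \<open>The gap points of \<open>b\<close> lie on the outer boundary of the stack, so
  reconnecting there commutes with stacking. Without the two arcs at the gap the stacked graph is
  \<open>E\<close>; adding these arcs or the reconnected ones gives the graphs \<open>G\<close> and
  \<open>H\<close> of the locale. If \<open>b\<close> itself had a loop at the gap,
  \<open>join\<close> would drop it uncounted; \<open>no_loop\<close> excludes this and makes the
  four end points distinct.\<close>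

lemma stacks_to_join:
  assumes st: "stacks_to N a b c" and kN: "k \<le> N" "1 \<le> N"
    and g: "gap_left k b \<in> pts N (nl b) (nr b)" and h: "gap_right N k b \<in> pts N (nl b) (nr b)"
    and no_loop: "mt b (gap_left k b) \<noteq> gap_right N k b"
  shows "stacks_to N a (join N k b) (join N k c)"
    "card (loops (edges N a (join N k b)) (inner N) (range Inner)) =
      card (loops (edges N a b) (inner N) (range Inner)) +
      (if mt c (gap_left k c) = gap_right N k c then 1 else 0)"
proof -
  have p: "pairing N a" "pairing N b" "pairing N c" and n: "nl c = nl a + nl b" "nr c = nr a + nr b"
    using st by (auto simp: stacks_to_def)
  define g' h' where "g' = gap_left k b" and "h' = gap_right N k b"
  define P where "P = pts N (nl b) (nr b)"
  \<comment> \<open>The end points of the two arcs at the gap; exactly these arcs are taken out of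
    \<open>b\<close> to obtain \<open>E\<close>.\<close>
  define Q where "Q = {g', h', mt b g', mt b h'}"
  define E where "E = {(low x, low (mt a x)) | x. x \<in> pts N (nl a) (nr a)} \<union>
     {(up a x, up a (mt b x)) | x. x \<in> P - Q}"
  have out: "up a g' = Outer (gap_left k c)" "up a h' = Outer (gap_right N k c)"
    using g h kN n by (auto simp: g'_def h'_def gap_left_def gap_right_def split: if_splits)
  have gh: "g' \<noteq> h'" "g' \<in> P" "h' \<in> P" "mt b g' \<noteq> h'"
    using gap_in_pts(3)[of k N b] g h kN no_loop by (simp_all add: g'_def h'_def P_def)
  have mt: "mt b (mt b x) = x" "mt b x \<in> P \<longleftrightarrow> x \<in> P" "mt b x = x \<longleftrightarrow> x \<notin> P" for x
    using p(2) by (simp_all add: P_def pairing_mt_pts pairing_fix)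
  have nb: "g' \<noteq> Bot i" "h' \<noteq> Bot i" for i
    by (auto simp: g'_def h'_def gap_left_def gap_right_def)
  have ne: "mt b g' \<noteq> g'" "mt b h' \<noteq> h'" using mt(3) gh by auto
  note t = surgery_values[OF mt(1) gh(1) ne gh(4)]
  have Q: "mt b x \<in> Q \<longleftrightarrow> x \<in> Q" "Q \<subseteq> P" for x
    using mt(1) mt(2) gh by (auto simp: Q_def; metis)+
  have symE: "sym E"
  proof (rule symI)
    fix x y assume "(x, y) \<in> E"
    then consider z where "z \<in> pts N (nl a) (nr a)" "x = low z" "y = low (mt a z)"
      | z where "z \<in> P - Q" "x = up a z" "y = up a (mt b z)"
      by (auto simp: E_def)
    then show "(y, x) \<in> E"
    proof cases
      case 1
      then have "mt a z \<in> pts N (nl a) (nr a)" "x = low (mt a (mt a z))"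
        using p(1) pairing_mt_pts by auto
      then show ?thesis using 1 unfolding E_def by blast
    next
      case 2
      then have "mt b z \<in> P - Q" "x = up a (mt b (mt b z))" using mt Q by auto
      then show ?thesis using 2 unfolding E_def by blast
    qed
  qed
  have notF: "up a z \<notin> Field E" if "z \<in> Q" "\<And>i. z \<noteq> Bot i" for z
  proof
    assume "up a z \<in> Field E"
    then obtain x where "x \<in> pts N (nl a) (nr a) \<and> up a z = low x \<or> x \<in> P - Q \<and> up a z = up a x"
    proof -
      have "v \<in> low ` pts N (nl a) (nr a) \<union> up a ` (P - Q) \<and> w \<in> low ` pts N (nl a) (nr a) \<union> up a ` (P - Q)"
        if "(v, w) \<in> E" for v w
      proof -
        from that consider x where "x \<in> pts N (nl a) (nr a)" "v = low x" "w = low (mt a x)"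
          | x where "x \<in> P - Q" "v = up a x" "w = up a (mt b x)"
          by (auto simp: E_def)
        then show ?thesis
        proof cases
          case 1
          then show ?thesis using pairing_mt_pts[OF p(1)] by blast
        next
          case 2
          then have "mt b x \<in> P - Q" using mt(2) Q by simp
          then show ?thesis using 2 by blast
        qed
      qed
      then have "Field E \<subseteq> low ` pts N (nl a) (nr a) \<union> up a ` (P - Q)"
        unfolding Field_def by blast
      then show thesis using \<open>up a z \<in> Field E\<close> that by blast
    qed
    then show False using that low_neq_up[of x N a z] by auto
  qed
  interpret R: reconnect E "up a g'" "up a h'" "up a (mt b g')" "up a (mt b h')"
    by unfold_locales (use symE notF nb gh ne t in \<open>auto simp: Q_def\<close>)
  have "{(up a x, up a (f x)) | x. x \<in> P} = {(up a x, up a (f x)) | x. x \<in> P - Q} \<union>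
      {(up a g', up a (f g')), (up a h', up a (f h')), (up a (mt b g'), up a (f (mt b g'))),
       (up a (mt b h'), up a (f (mt b h')))}" for f
  proof -
    have "{F x | x. x \<in> P} = {F x | x. x \<in> P - Q} \<union> F ` Q" for F :: "point \<Rightarrow> stacked_point \<times> stacked_point"
      using Q(2) by blast
    from this[of "\<lambda>x. (up a x, up a (f x))"] show ?thesis by (simp add: Q_def)
  qed
  note split = this
  have "R.G = edges N a b"
    unfolding R.G_def unfolding E_def edges_def P_def[symmetric] split[of "mt b"] mt(1) by (simp add: Un_ac insert_commute)
  have jn: "nl (join N k b) = nl b" "nr (join N k b) = nr b"
    "mt (join N k b) = surgery g' h' (mt b)"
    by (simp_all add: join_def g'_def h'_def)
  have "{(up a x, up a (surgery g' h' (mt b) x)) | x. x \<in> P - Q} = {(up a x, up a (mt b x)) | x. x \<in> P - Q}"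
    using t(5) unfolding Q_def by (metis (no_types, lifting) DiffD2)
  then have "R.H = edges N a (join N k b)"
    unfolding R.H_def unfolding E_def edges_def jn P_def[symmetric] split[of "surgery g' h' (mt b)"] t(1-4)
    by (simp add: Un_ac insert_commute)
  have fx: "mt c (gap_left k c) \<noteq> gap_left k c" "mt c (gap_right N k c) \<noteq> gap_right N k c"
    using g h kN n pairing_fix[OF p(3)] by (auto simp: gap_left_def gap_right_def split: if_splits)
  interpret T: reconnect_ends E "up a g'" "up a h'" "up a (mt b g')" "up a (mt b h')" Outer "mt c"
    "gap_left k c" "gap_right N k c" "range Inner" "inner N"
  proof unfold_locales
    show "(Outer l, Outer m) \<in> R.G\<^sup>* \<longleftrightarrow> mt c l = m" if "l \<noteq> m" for l m
      using st that unfolding \<open>R.G = _\<close> stacks_to_def by blast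
    show "up a (mt b g') \<in> inner N" if "up a (mt b g') \<in> range Inner"
    proof -
      have "mt b g' \<in> P" using mt gh by simp
      then show ?thesis using that by (cases "mt b g'") (auto simp: P_def)
    qed
  qed (use out fx compl_range_Inner p in \<open>auto simp: inj_def\<close>)
  show "stacks_to N a (join N k b) (join N k c)"
    unfolding stacks_to_def
  proof (intro conjI allI impI)
    show "pairing N (join N k b)"
      unfolding join_def using g h gh p by (intro pairing_surgery) (auto simp: g'_def h'_def)
    show "pairing N (join N k c)"
      unfolding join_def using p pairing_fix[OF p(3)] fx gap_in_pts(3)[OF kN]
      by (intro pairing_surgery) auto
    show "(Outer x, Outer y) \<in> (edges N a (join N k b))\<^sup>* \<longleftrightarrow> mt (join N k c) x = y" if "x \<noteq> y" for x y
      using T.conn_H[OF that] unfolding \<open>R.H = _\<close> by (simp add: join_def)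
  qed (use n p in \<open>auto simp: join_def\<close>)
  show "card (loops (edges N a (join N k b)) (inner N) (range Inner)) =
      card (loops (edges N a b) (inner N) (range Inner)) +
      (if mt c (gap_left k c) = gap_right N k c then 1 else 0)"
    using T.card_loops_H unfolding \<open>R.H = _\<close> \<open>R.G = _\<close> .
qed


definition loop_at :: "nat \<Rightarrow> nat \<Rightarrow> config \<Rightarrow> bool" where
  "loop_at N k c \<longleftrightarrow> 0 < k \<and> k < N \<and> mt c (Top (k - 1)) = Top k"

text \<open>For \<open>k = 0\<close> and \<open>k = N\<close> the side point at the gap belongs to
  the return that \<open>cap\<close> has just added, so the two points at the gap are not joined and
  no loop can close there.\<close>

lemma loop_at_cap:
  assumes "pairing N c" "k \<le> N" "1 \<le> N"
  shows "mt (cap N k c) (gap_left k (cap N k c)) = gap_right N k (cap N k c) \<longleftrightarrow> loop_at N k c"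
proof -
  have "mt c x \<noteq> Rgt (nr c + 1)" if "x \<noteq> Rgt (nr c + 1)" for x
    using that pairing_fix[OF assms(1), of "Rgt (nr c + 1)"] pairing_mt[OF assms(1), of x] by auto
  then show ?thesis
    using assms(2,3) by (auto simp: cap_def gap_left_def gap_right_def cap_left_def cap_right_def loop_at_def)
qed

lemma stacks_to_ext:
  assumes "stacks_to N a b c" "k \<le> N" "1 \<le> N" "\<not> loop_at N k b"
  shows "stacks_to N a (ext N k b) (ext N k c)"
    "card (closed_loops N (diagram_of a) (diagram_of (ext N k b))) =
      card (closed_loops N (diagram_of a) (diagram_of b)) + (if loop_at N k c then 1 else 0)"
proof -
  have p: "pairing N a" "pairing N b" "pairing N c" using assms by (auto simp: stacks_to_def)
  note cap = stacks_to_cap[OF assms(1), of k]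
  have "mt (cap N k b) (gap_left k (cap N k b)) \<noteq> gap_right N k (cap N k b)"
    using loop_at_cap[OF p(2) assms(2,3)] assms(4) by simp
  note join = stacks_to_join[OF cap(1) assms(2,3) gap_in_pts(1,2)[OF assms(2,3)] this, folded ext_def]
  show "stacks_to N a (ext N k b) (ext N k c)" by (rule join(1))
  show "card (closed_loops N (diagram_of a) (diagram_of (ext N k b))) =
      card (closed_loops N (diagram_of a) (diagram_of b)) + (if loop_at N k c then 1 else 0)"
    using join(2) p pairing_ext[OF p(2) assms(2,3)]
    by (simp add: closed_loops_eq cap(2) loop_at_cap[OF p(3) assms(2,3)])
qed

section \<open>The identity diagram as upper factor\<close>

definition id_config :: "nat \<Rightarrow> config" where
  "id_config N = Config 0 0 (\<lambda>x. case x of Bot i \<Rightarrow> if i < N then Top i else x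
     | Top i \<Rightarrow> if i < N then Bot i else x | _ \<Rightarrow> x)"

lemma pairing_id_config: "pairing N (id_config N)"
  unfolding pairing_def id_config_def
proof (intro conjI allI)
  fix x
  show "mt (Config 0 0 (\<lambda>x. case x of Bot i \<Rightarrow> if i < N then Top i else x
     | Top i \<Rightarrow> if i < N then Bot i else x | _ \<Rightarrow> x)) (mt (Config 0 0 (\<lambda>x. case x of Bot i \<Rightarrow> if i < N then Top i else x
     | Top i \<Rightarrow> if i < N then Bot i else x | _ \<Rightarrow> x)) x) = x" by (cases x) auto
  show "mt (Config 0 0 (\<lambda>x. case x of Bot i \<Rightarrow> if i < N then Top i else x
     | Top i \<Rightarrow> if i < N then Bot i else x | _ \<Rightarrow> x)) x \<noteq> x \<longleftrightarrow>
    x \<in> pts N (nl (Config 0 0 (\<lambda>x. case x of Bot i \<Rightarrow> if i < N then Top i else x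
     | Top i \<Rightarrow> if i < N then Bot i else x | _ \<Rightarrow> x))) (nr (Config 0 0 (\<lambda>x. case x of Bot i \<Rightarrow> if i < N then Top i else x
     | Top i \<Rightarrow> if i < N then Bot i else x | _ \<Rightarrow> x)))"
    by (cases x) auto
qed

lemma id_config_simps [simp]: "nl (id_config N) = 0" "nr (id_config N) = 0"
  "i < N \<Longrightarrow> mt (id_config N) (Bot i) = Top i" "i < N \<Longrightarrow> mt (id_config N) (Top i) = Bot i"
  by (simp_all add: id_config_def)

lemma diagram_of_id_config: "diagram_of (id_config N) = id_diagram N"
proof -
  have "{{x, mt (id_config N) x} | x. mt (id_config N) x \<noteq> x} = (\<lambda>i. {Bot i, Top i}) ` {..<N}"
  proof (intro equalityI subsetI)
    fix s assume "s \<in> {{x, mt (id_config N) x} | x. mt (id_config N) x \<noteq> x}"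
    then obtain x where "s = {x, mt (id_config N) x}" "mt (id_config N) x \<noteq> x" by blast
    then show "s \<in> (\<lambda>i. {Bot i, Top i}) ` {..<N}"
      by (cases x) (auto simp: id_config_def insert_commute split: if_splits)
  next
    fix s assume "s \<in> (\<lambda>i. {Bot i, Top i}) ` {..<N}"
    then obtain i where "i < N" "s = {Bot i, mt (id_config N) (Bot i)}" "mt (id_config N) (Bot i) \<noteq> Bot i"
      by auto
    then show "s \<in> {{x, mt (id_config N) x} | x. mt (id_config N) x \<noteq> x}" by blast
  qed
  then show ?thesis by (simp add: diagram_of_def id_diagram_def)
qed

lemma stacks_to_id:
  assumes a: "pairing N a"
  shows "stacks_to N a (id_config N) a"
    "closed_loops N (diagram_of a) (diagram_of (id_config N)) = {}"
proof -
  define E where "E = edges N a (id_config N)"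
  \<comment> \<open>Contracts the vertical lines of the upper factor: \<open>Inner i\<close> is
    identified with \<open>Top i\<close>, so that every edge of the stack becomes trivial or an arc
    of \<open>a\<close>.\<close>
  define pull where "pull v = (case v of Outer x \<Rightarrow> x | Inner i \<Rightarrow> Top i)" for v
  have pull_low: "pull (low x) = x" for x
    by (cases x) (auto simp: pull_def)
  have upE: "pull (up a x) = pull (up a (mt (id_config N) x))" if "x \<in> pts N 0 0" for x
    using that by (cases x) (auto simp: pull_def)
  have one_step: "pull w = pull v \<or> pull w = mt a (pull v)" if "(v, w) \<in> E" for v w
    using that upE unfolding E_def edges_def by (auto simp: pull_low)
  have conn: "pull w = pull v \<or> pull w = mt a (pull v)" if "(v, w) \<in> E\<^sup>*" for v w
    using that
  proof (induction rule: rtrancl_induct)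
    case (step x y)
    then show ?case using one_step a by (metis pairing_mt)
  qed simp
  have symE: "sym E" using sym_edges a pairing_id_config by (auto simp: E_def)
  have outer_low: "(Outer x, low x) \<in> E\<^sup>*" if "x \<in> pts N (nl a) (nr a)" for x
  proof (cases x)
    case (Top i)
    then have "(up a (Top i), up a (mt (id_config N) (Top i))) \<in> E"
      unfolding E_def edges_def using that by (auto intro!: exI[of _ "Top i"])
    then show ?thesis using Top that by auto
  qed auto
  have conv: "(Outer x, Outer (mt a x)) \<in> E\<^sup>*" if x: "x \<in> pts N (nl a) (nr a)" for x
  proof -
    have "mt a x \<in> pts N (nl a) (nr a)" using x pairing_mt_pts[OF a] by simp
    from outer_low[OF this] have "(low (mt a x), Outer (mt a x)) \<in> E\<^sup>*"
      using sym_rtrancl[OF symE] by (auto dest: symD)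
    moreover have "(low x, low (mt a x)) \<in> E" using x unfolding E_def edges_def by blast
    ultimately show ?thesis using outer_low[OF x] by (meson rtrancl_trans r_into_rtrancl)
  qed
  have "(Outer x, Outer y) \<in> E\<^sup>* \<longleftrightarrow> mt a x = y" if "x \<noteq> y" for x y
    using conn[of "Outer x" "Outer y"] conv[of x] that pairing_fix[OF a, of x] by (auto simp: pull_def)
  then show "stacks_to N a (id_config N) a"
    using a pairing_id_config by (simp add: stacks_to_def E_def)
  have "(Inner i, Outer (Top i)) \<in> E\<^sup>*" if "i < N" for i
    using outer_low[of "Top i"] that sym_rtrancl[OF symE] by (auto dest: symD)
  then have "loops E (inner N) (range Inner) = {}"
    by (auto simp: loops_def)
  then show "closed_loops N (diagram_of a) (diagram_of (id_config N)) = {}"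
    using a pairing_id_config by (simp add: closed_loops_eq E_def)
qed


section \<open>Removal of returns\<close>

definition rank :: "nat set \<Rightarrow> nat \<Rightarrow> nat" where
  "rank S i = card {j \<in> S. j < i}"

lemma rank_less: "finite S \<Longrightarrow> i \<in> S \<Longrightarrow> i < j \<Longrightarrow> rank S i < rank S j"
  unfolding rank_def by (intro psubset_card_mono) auto

lemma rank_less_iff: "finite S \<Longrightarrow> i \<in> S \<Longrightarrow> j \<in> S \<Longrightarrow> rank S i < rank S j \<longleftrightarrow> i < j"
  using rank_less[of S i j] rank_less[of S j i] by (metis less_irrefl linorder_less_linear order_less_trans)

lemma rank_eq_iff: "finite S \<Longrightarrow> i \<in> S \<Longrightarrow> j \<in> S \<Longrightarrow> rank S i = rank S j \<longleftrightarrow> i = j"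
  using rank_less[of S i j] rank_less[of S j i] by (metis less_irrefl linorder_less_linear)

lemma rank_image: "finite S \<Longrightarrow> rank S ` S = {..<card S}"
proof -
  assume S: "finite S"
  have "rank S i < card S" if "i \<in> S" for i
    unfolding rank_def using S that by (intro psubset_card_mono) auto
  then have "rank S ` S \<subseteq> {..<card S}" by auto
  moreover have "card (rank S ` S) = card S"
    using S rank_eq_iff by (intro card_image) (auto simp: inj_on_def)
  ultimately show ?thesis by (intro card_subset_eq) auto
qed

text \<open>Renumbering in two stages agrees with renumbering once; the set on the right consists of
  the points that survive both stages.\<close>

lemma rank_rank:
  assumes "finite S" "S' \<subseteq> {..<card S}" "i \<in> S"
  shows "rank S' (rank S i) = rank {j \<in> S. rank S j \<in> S'} i"
proof -
  have "{j \<in> S'. j < rank S i} = rank S ` {j \<in> {j \<in> S. rank S j \<in> S'}. j < i}"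
  proof (intro equalityI subsetI)
    fix j assume j: "j \<in> {j \<in> S'. j < rank S i}"
    then have "j \<in> rank S ` S" using assms(1,2) rank_image by auto
    then show "j \<in> rank S ` {j \<in> {j \<in> S. rank S j \<in> S'}. j < i}"
      using j assms(1,3) rank_less_iff by auto
  qed (use assms rank_less_iff in auto)
  moreover have "card (rank S ` {j \<in> {j \<in> S. rank S j \<in> S'}. j < i}) = card {j \<in> {j \<in> S. rank S j \<in> S'}. j < i}"
    using assms(1) rank_eq_iff by (intro card_image) (auto simp: inj_on_def)
  ultimately show ?thesis by (simp add: rank_def)
qed

fun ren :: "nat set \<Rightarrow> nat set \<Rightarrow> point \<Rightarrow> point" where
  "ren S T (Lft i) = Lft (rank S i)"
| "ren S T (Rgt i) = Rgt (rank T i)"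
| "ren S T p = p"

definition kept_pts :: "nat \<Rightarrow> nat set \<Rightarrow> nat set \<Rightarrow> point set" where
  "kept_pts N S T = Bot ` {..<N} \<union> Top ` {..<N} \<union> Lft ` S \<union> Rgt ` T"

lemma kept_pts_simps [simp]:
  "Bot i \<in> kept_pts N S T \<longleftrightarrow> i < N" "Top i \<in> kept_pts N S T \<longleftrightarrow> i < N"
  "Lft i \<in> kept_pts N S T \<longleftrightarrow> i \<in> S" "Rgt i \<in> kept_pts N S T \<longleftrightarrow> i \<in> T"
  by (auto simp: kept_pts_def)

lemma ren_eq_iff:
  assumes "finite S" "finite T" "x \<in> kept_pts N S T" "y \<in> kept_pts N S T"
  shows "ren S T x = ren S T y \<longleftrightarrow> x = y"
  using assms rank_eq_iff by (cases x; cases y) auto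

lemma ren_image:
  assumes "finite S" "finite T"
  shows "ren S T ` kept_pts N S T = pts N (card S) (card T)"
proof -
  have "ren S T ` kept_pts N S T = Bot ` {..<N} \<union> Top ` {..<N} \<union> Lft ` (rank S ` S) \<union> Rgt ` (rank T ` T)"
    by (simp add: kept_pts_def image_Un image_image)
  then show ?thesis using assms by (simp add: rank_image pts_def)
qed

text \<open>\<open>d\<close> arises from \<open>c\<close> by removing returns, leaving the points in \<open>S\<close> and \<open>T\<close> on the sides.\<close>

definition removes :: "nat \<Rightarrow> nat set \<Rightarrow> nat set \<Rightarrow> config \<Rightarrow> config \<Rightarrow> bool" where
  "removes N S T c d \<longleftrightarrow> pairing N c \<and> pairing N d \<and> S \<subseteq> {..<nl c} \<and> T \<subseteq> {..<nr c} \<and>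
     nl d = card S \<and> nr d = card T \<and>
     (\<forall>x\<in>kept_pts N S T. mt d (ren S T x) = ren S T (mt c x)) \<and>
     (\<forall>i<nl c. i \<notin> S \<longrightarrow> mt c (Lft i) \<in> Lft ` (- S)) \<and>
     (\<forall>i<nr c. i \<notin> T \<longrightarrow> mt c (Rgt i) \<in> Rgt ` (- T))"

lemma removesD:
  assumes "removes N S T c d"
  shows "pairing N c" "pairing N d" "S \<subseteq> {..<nl c}" "T \<subseteq> {..<nr c}" "finite S" "finite T"
    "nl d = card S" "nr d = card T"
    "x \<in> kept_pts N S T \<Longrightarrow> mt d (ren S T x) = ren S T (mt c x)"
    "x \<in> kept_pts N S T \<Longrightarrow> mt c x \<in> kept_pts N S T"
    "i < nl c \<Longrightarrow> i \<notin> S \<Longrightarrow> mt c (Lft i) \<in> Lft ` (- S)"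
    "i < nr c \<Longrightarrow> i \<notin> T \<Longrightarrow> mt c (Rgt i) \<in> Rgt ` (- T)"
proof -
  show 1: "pairing N c" "pairing N d" "S \<subseteq> {..<nl c}" "T \<subseteq> {..<nr c}"
    "nl d = card S" "nr d = card T"
    "x \<in> kept_pts N S T \<Longrightarrow> mt d (ren S T x) = ren S T (mt c x)"
    "\<And>i. i < nl c \<Longrightarrow> i \<notin> S \<Longrightarrow> mt c (Lft i) \<in> Lft ` (- S)"
    "\<And>i. i < nr c \<Longrightarrow> i \<notin> T \<Longrightarrow> mt c (Rgt i) \<in> Rgt ` (- T)"
    using assms by (simp_all add: removes_def)
  show "finite S" "finite T" using 1(3,4) finite_subset by blast+
  assume x: "x \<in> kept_pts N S T"
  then have "x \<in> pts N (nl c) (nr c)" using 1(3,4) by (cases x) auto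
  then have "mt c x \<in> pts N (nl c) (nr c)" using pairing_mt_pts 1(1) by blast
  moreover have "mt c (mt c x) = x" using 1(1) by simp
  ultimately show "mt c x \<in> kept_pts N S T"
    using 1(8,9) x by (cases "mt c x") (force simp: kept_pts_def)+
qed

lemma removes_unique:
  assumes "removes N S T c d" "removes N S T c e"
  shows "d = e"
proof -
  note d = removesD[OF assms(1)] and e = removesD[OF assms(2)]
  have "mt d y = mt e y" for y
  proof (cases "y \<in> pts N (card S) (card T)")
    case True
    then obtain x where "x \<in> kept_pts N S T" "y = ren S T x" using ren_image d(5,6) by blast
    then show ?thesis using d(9) e(9) by simp
  next
    case False
    then show ?thesis using pairing_fix[OF d(2)] pairing_fix[OF e(2)] d(7,8) e(7,8) by metis
  qed
  then show ?thesis using d(7,8) e(7,8) by (intro config.expand) auto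
qed

text \<open>By the last two conditions both ends of a removed arc go together. What is left is
  transported along the bijection \<open>ren S T\<close> onto consecutive indices.\<close>

lemma removes_exists:
  assumes c: "pairing N c" and S: "S \<subseteq> {..<nl c}" and T: "T \<subseteq> {..<nr c}"
    and left: "\<And>i. i < nl c \<Longrightarrow> i \<notin> S \<Longrightarrow> mt c (Lft i) \<in> Lft ` (- S)"
    and right: "\<And>i. i < nr c \<Longrightarrow> i \<notin> T \<Longrightarrow> mt c (Rgt i) \<in> Rgt ` (- T)"
  shows "\<exists>d. removes N S T c d"
proof -
  have fin: "finite S" "finite T" using S T finite_subset by blast+
  define K where "K = kept_pts N S T"
  have inj: "inj_on (ren S T) K" using ren_eq_iff[OF fin] by (auto simp: inj_on_def K_def)
  have img: "ren S T ` K = pts N (card S) (card T)" using ren_image[OF fin] by (simp add: K_def)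
  have KP: "K \<subseteq> pts N (nl c) (nr c)" using S T by (auto simp: K_def kept_pts_def)
  have K: "mt c x \<in> K" if "x \<in> K" for x
  proof -
    have "mt c x \<in> pts N (nl c) (nr c)" using that KP pairing_mt_pts[OF c] by blast
    moreover have "mt c (mt c x) = x" using c by simp
    ultimately show ?thesis using that left right unfolding K_def
      by (cases "mt c x") (force simp: kept_pts_def)+
  qed
  define s where "s y = (if y \<in> ren S T ` K then ren S T (mt c (inv_into K (ren S T) y)) else y)" for y
  have s: "s (ren S T x) = ren S T (mt c x)" if "x \<in> K" for x
    using that inj by (simp add: s_def)
  define d where "d = Config (card S) (card T) s"
  have "s (s y) = y \<and> (s y \<noteq> y \<longleftrightarrow> y \<in> pts N (card S) (card T))" for y
  proof (cases "y \<in> ren S T ` K")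
    case True
    then obtain x where x: "x \<in> K" "y = ren S T x" by blast
    have "mt c x \<noteq> x" using x(1) KP pairing_fix[OF c] by blast
    then have "ren S T (mt c x) \<noteq> ren S T x" using inj x(1) K by (auto simp: inj_on_def)
    then show ?thesis using x s[OF x(1)] s[OF K[OF x(1)]] c img by auto
  next
    case False
    then show ?thesis using img by (simp add: s_def)
  qed
  then have "pairing N d" by (simp add: pairing_def d_def)
  then have "removes N S T c d"
    unfolding removes_def using c S T left right s by (simp add: d_def K_def)
  then show ?thesis by blast
qed

lemma removes_trans:
  assumes "removes N S T c d" "removes N S' T' d e"
  shows "removes N {i \<in> S. rank S i \<in> S'} {i \<in> T. rank T i \<in> T'} c e"
proof -
  note d = removesD[OF assms(1)] and e = removesD[OF assms(2)]
  let ?S = "{i \<in> S. rank S i \<in> S'}" and ?T = "{i \<in> T. rank T i \<in> T'}"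
  have ren: "ren ?S ?T x = ren S' T' (ren S T x)" if "x \<in> kept_pts N S T" for x
    using that rank_rank[of S S'] rank_rank[of T T'] d e(3,4) by (cases x) auto
  have kept: "x \<in> kept_pts N ?S ?T \<longleftrightarrow> x \<in> kept_pts N S T \<and> ren S T x \<in> kept_pts N S' T'" for x
    by (cases x) auto
  have "rank S ` ?S = S'" "rank T ` ?T = T'"
    using rank_image[OF d(5)] rank_image[OF d(6)] e(3,4) d(7,8) by auto
  moreover have "card (rank S ` ?S) = card ?S" "card (rank T ` ?T) = card ?T"
    using d(5,6) rank_eq_iff by (auto intro!: card_image simp: inj_on_def)
  ultimately have card: "card ?S = card S'" "card ?T = card T'" by simp_all
  show ?thesis
    unfolding removes_def
  proof (intro conjI ballI allI impI)
    show "mt e (ren ?S ?T x) = ren ?S ?T (mt c x)" if "x \<in> kept_pts N ?S ?T" for x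
    proof -
      have k: "x \<in> kept_pts N S T" "ren S T x \<in> kept_pts N S' T'" using that kept by auto
      have "mt e (ren ?S ?T x) = ren S' T' (ren S T (mt c x))"
        unfolding ren[OF k(1)] e(9)[OF k(2)] d(9)[OF k(1)] ..
      also have "\<dots> = ren ?S ?T (mt c x)" using ren[OF d(10)[OF k(1)]] by simp
      finally show ?thesis .
    qed
    show "mt c (Lft i) \<in> Lft ` (- ?S)" if i: "i < nl c" "i \<notin> ?S" for i
    proof (cases "i \<in> S")
      case True
      then have k: "Lft i \<in> kept_pts N S T" by simp
      have "rank S i < nl d" "rank S i \<notin> S'" using True i rank_image[OF d(5)] d(7) by auto
      then have "mt d (ren S T (Lft i)) \<in> Lft ` (- S')" using e(11) by simp
      then have "ren S T (mt c (Lft i)) \<in> Lft ` (- S')" using d(9)[OF k] by simp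
      then show ?thesis by (cases "mt c (Lft i)") auto
    qed (use d(11) i in blast)
    show "mt c (Rgt i) \<in> Rgt ` (- ?T)" if i: "i < nr c" "i \<notin> ?T" for i
    proof (cases "i \<in> T")
      case True
      then have k: "Rgt i \<in> kept_pts N S T" by simp
      have "rank T i < nr d" "rank T i \<notin> T'" using True i rank_image[OF d(6)] d(8) by auto
      then have "mt d (ren S T (Rgt i)) \<in> Rgt ` (- T')" using e(12) by simp
      then have "ren S T (mt c (Rgt i)) \<in> Rgt ` (- T')" using d(9)[OF k] by simp
      then show ?thesis by (cases "mt c (Rgt i)") auto
    qed (use d(12) i in blast)
  qed (use d e card in auto)
qed

definition kept_left :: "config \<Rightarrow> nat set" where
  "kept_left c = {i. i < nl c \<and> mt c (Lft i) \<notin> range Lft}"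

definition kept_right :: "config \<Rightarrow> nat set" where
  "kept_right c = {i. i < nr c \<and> mt c (Rgt i) \<notin> range Rgt}"

definition nf :: "nat \<Rightarrow> config \<Rightarrow> config" where
  "nf N c = (THE d. removes N (kept_left c) (kept_right c) c d)"

lemma removes_nf:
  assumes "pairing N c"
  shows "removes N (kept_left c) (kept_right c) c (nf N c)"
proof -
  have "\<exists>d. removes N (kept_left c) (kept_right c) c d"
  proof (rule removes_exists[OF assms])
    show "mt c (Lft i) \<in> Lft ` (- kept_left c)" if i: "i < nl c" "i \<notin> kept_left c" for i
    proof -
      obtain j where j: "mt c (Lft i) = Lft j" using i by (auto simp: kept_left_def)
      then have "mt c (Lft j) = Lft i" using assms by (metis pairing_mt)
      then show ?thesis using j by (auto simp: kept_left_def)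
    qed
    show "mt c (Rgt i) \<in> Rgt ` (- kept_right c)" if i: "i < nr c" "i \<notin> kept_right c" for i
    proof -
      obtain j where j: "mt c (Rgt i) = Rgt j" using i by (auto simp: kept_right_def)
      then have "mt c (Rgt j) = Rgt i" using assms by (metis pairing_mt)
      then show ?thesis using j by (auto simp: kept_right_def)
    qed
  qed (auto simp: kept_left_def kept_right_def)
  then show ?thesis unfolding nf_def using removes_unique by (metis theI)
qed

lemma nf_eqI: "removes N (kept_left c) (kept_right c) c d \<Longrightarrow> nf N c = d"
  using removes_unique removes_nf removesD(1) by metis

text \<open>Confluence of removal: renumbering keeps every point on its side, so a return that
  survives the first stage is still a return, and no new ones appear. The two stages together remove
  exactly the returns of \<open>c\<close>.\<close>

lemma nf_removes:
  assumes "removes N S T c d"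
  shows "nf N c = nf N d"
proof -
  note d = removesD[OF assms]
  have L: "mt c (Lft i) \<in> range Lft \<longleftrightarrow> mt d (Lft (rank S i)) \<in> range Lft" "rank S i < nl d"
    if "i \<in> S" for i
    using d(9)[of "Lft i"] that rank_image[OF d(5)] d(7) by (cases "mt c (Lft i)"; auto)+
  have R: "mt c (Rgt i) \<in> range Rgt \<longleftrightarrow> mt d (Rgt (rank T i)) \<in> range Rgt" "rank T i < nr d"
    if "i \<in> T" for i
    using d(9)[of "Rgt i"] that rank_image[OF d(6)] d(8) by (cases "mt c (Rgt i)"; auto)+
  have "i \<in> kept_left c \<longleftrightarrow> i \<in> S \<and> rank S i \<in> kept_left d" for i
    unfolding kept_left_def mem_Collect_eq using L[of i] d(3) d(11)[of i] by blast
  moreover have "i \<in> kept_right c \<longleftrightarrow> i \<in> T \<and> rank T i \<in> kept_right d" for i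
    unfolding kept_right_def mem_Collect_eq using R[of i] d(4) d(12)[of i] by blast
  ultimately have "kept_left c = {i \<in> S. rank S i \<in> kept_left d}"
    "kept_right c = {i \<in> T. rank T i \<in> kept_right d}"
    by blast+
  then show ?thesis
    using removes_trans[OF assms removes_nf[OF d(2)]] nf_eqI by metis
qed

lemma reduced_nf:
  assumes "pairing N c"
  shows "reduced (nf N c)"
proof -
  note d = removesD[OF removes_nf[OF assms]]
  have "i = j" if ij: "mt (nf N c) (Lft i) = Lft j" for i j
  proof (rule ccontr)
    assume "i \<noteq> j"
    then have "i < nl (nf N c)" using ij pairing_fix[OF d(2), of "Lft i"] by auto
    then obtain i' where i': "i' \<in> kept_left c" "i = rank (kept_left c) i'"
      using rank_image[OF d(5)] d(7) by auto
    then have "ren (kept_left c) (kept_right c) (mt c (Lft i')) = Lft j"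
      using d(9)[of "Lft i'"] ij by simp
    then show False using i'(1) by (cases "mt c (Lft i')") (auto simp: kept_left_def)
  qed
  moreover have "i = j" if ij: "mt (nf N c) (Rgt i) = Rgt j" for i j
  proof (rule ccontr)
    assume "i \<noteq> j"
    then have "i < nr (nf N c)" using ij pairing_fix[OF d(2), of "Rgt i"] by auto
    then obtain i' where i': "i' \<in> kept_right c" "i = rank (kept_right c) i'"
      using rank_image[OF d(6)] d(8) by auto
    then have "ren (kept_left c) (kept_right c) (mt c (Rgt i')) = Rgt j"
      using d(9)[of "Rgt i'"] ij by simp
    then show False using i'(1) by (cases "mt c (Rgt i')") (auto simp: kept_right_def)
  qed
  ultimately show ?thesis by (simp add: reduced_def)
qed

lemma nf_reduced:
  assumes "pairing N c" "reduced c"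
  shows "nf N c = c"
proof (rule nf_eqI)
  have "mt c (Lft i) \<noteq> Lft j" if "i < nl c" for i j
    using that assms(2) pairing_fix[OF assms(1), of "Lft i"] by (auto simp: reduced_def)
  moreover have "mt c (Rgt i) \<noteq> Rgt j" if "i < nr c" for i j
    using that assms(2) pairing_fix[OF assms(1), of "Rgt i"] by (auto simp: reduced_def)
  ultimately have k: "kept_left c = {..<nl c}" "kept_right c = {..<nr c}"
    by (auto simp: kept_left_def kept_right_def)
  have r: "rank {..<n} i = i" if "i \<le> n" for i n
  proof -
    have "{j \<in> {..<n}. j < i} = {..<i}" using that by auto
    then show ?thesis by (simp add: rank_def)
  qed
  have ren: "ren {..<nl c} {..<nr c} x = x" if "x \<in> pts N (nl c) (nr c)" for x
    using that r by (cases x) auto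
  have "kept_pts N {..<nl c} {..<nr c} = pts N (nl c) (nr c)"
    by (simp add: kept_pts_def pts_def)
  then show "removes N (kept_left c) (kept_right c) c c"
    using assms ren pairing_mt_pts[OF assms(1)] unfolding removes_def k by auto
qed

lemma rank_insert_top:
  assumes "S \<subseteq> {..<n}"
  shows "i < n \<Longrightarrow> rank (S \<union> {n, Suc n}) i = rank S i" "rank (S \<union> {n, Suc n}) n = card S"
    "rank (S \<union> {n, Suc n}) (Suc n) = Suc (card S)" "card (S \<union> {n, Suc n}) = Suc (Suc (card S))"
proof -
  have fin: "finite S" using assms finite_subset by blast
  have sets: "{j \<in> S \<union> {n, Suc n}. j < n} = S" "{j \<in> S \<union> {n, Suc n}. j < Suc n} = insert n S"
    "n \<notin> S" "Suc n \<notin> insert n S" "S \<union> {n, Suc n} = insert (Suc n) (insert n S)"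
    using assms by auto
  show "rank (S \<union> {n, Suc n}) n = card S" "rank (S \<union> {n, Suc n}) (Suc n) = Suc (card S)"
    unfolding rank_def sets(1,2) using fin sets(3) by simp_all
  show "card (S \<union> {n, Suc n}) = Suc (Suc (card S))"
    unfolding sets(5) using fin sets(3,4) by simp
  assume "i < n"
  then have "{j \<in> S \<union> {n, Suc n}. j < i} = {j \<in> S. j < i}" by auto
  then show "rank (S \<union> {n, Suc n}) i = rank S i" by (simp add: rank_def)
qed

lemma removes_cap_left:
  assumes "removes N S T c d"
  shows "removes N (S \<union> {nl c, Suc (nl c)}) T (cap_left c) (cap_left d)"
proof -
  note d = removesD[OF assms]
  note r = rank_insert_top[OF d(3)]
  let ?S = "S \<union> {nl c, Suc (nl c)}"
  have KP: "x \<in> pts N (nl c) (nr c)" if "x \<in> kept_pts N S T" for x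
    using that d(3,4) by (cases x) auto
  have ren: "ren ?S T x = ren S T x" if "x \<in> kept_pts N S T" for x
    using KP[OF that] r(1) by (cases x) auto
  have mt_c: "mt (cap_left c) x = mt c x" if "x \<in> pts N (nl c) (nr c)" for x
    using that by (auto simp: cap_left_def)
  have mt_d: "mt (cap_left d) x = mt d x" if "x \<in> pts N (nl d) (nr d)" for x
    using that by (auto simp: cap_left_def)
  show ?thesis
    unfolding removes_def
  proof (intro conjI ballI allI impI)
    show "mt (cap_left d) (ren ?S T x) = ren ?S T (mt (cap_left c) x)" if x: "x \<in> kept_pts N ?S T" for x
    proof (cases "x \<in> kept_pts N S T")
      case True
      have "ren S T x \<in> pts N (nl d) (nr d)" using ren_image[OF d(5,6)] d(7,8) True by auto
      then show ?thesis
        unfolding ren[OF True] mt_c[OF KP[OF True]] using mt_d d(9)[OF True] ren[OF d(10)[OF True]] by simp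
    next
      case False
      then have "x = Lft (nl c) \<or> x = Lft (Suc (nl c))" using x by (cases x) auto
      then show ?thesis using r d(7) by (auto simp: cap_left_def)
    qed
    show "mt (cap_left c) (Lft i) \<in> Lft ` (- ?S)" if "i < nl (cap_left c)" "i \<notin> ?S" for i
    proof -
      have i: "i < nl c" "i \<notin> S" using that by (auto simp: cap_left_def)
      then obtain j where j: "mt c (Lft i) = Lft j" "j \<notin> S" using d(11) by blast
      then have "j < nl c" using pairing_mt_pts[OF d(1), of "Lft i"] i by simp
      then show ?thesis using mt_c[of "Lft i"] i j by auto
    qed
    show "mt (cap_left c) (Rgt i) \<in> Rgt ` (- T)" if "i < nr (cap_left c)" "i \<notin> T" for i
      using that d(12)[of i] by (simp add: cap_left_def)
    show "pairing N (cap_left c)" "pairing N (cap_left d)" using d(1,2) pairing_cap_left by auto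
  qed (use d(3-8) r in \<open>auto simp: cap_left_def\<close>)
qed

lemma removes_cap_right:
  assumes "removes N S T c d"
  shows "removes N S (T \<union> {nr c, Suc (nr c)}) (cap_right c) (cap_right d)"
proof -
  note d = removesD[OF assms]
  note r = rank_insert_top[OF d(4)]
  let ?T = "T \<union> {nr c, Suc (nr c)}"
  have KP: "x \<in> pts N (nl c) (nr c)" if "x \<in> kept_pts N S T" for x
    using that d(3,4) by (cases x) auto
  have ren: "ren S ?T x = ren S T x" if "x \<in> kept_pts N S T" for x
    using KP[OF that] r(1) by (cases x) auto
  have mt_c: "mt (cap_right c) x = mt c x" if "x \<in> pts N (nl c) (nr c)" for x
    using that by (auto simp: cap_right_def)
  have mt_d: "mt (cap_right d) x = mt d x" if "x \<in> pts N (nl d) (nr d)" for x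
    using that by (auto simp: cap_right_def)
  show ?thesis
    unfolding removes_def
  proof (intro conjI ballI allI impI)
    show "mt (cap_right d) (ren S ?T x) = ren S ?T (mt (cap_right c) x)" if x: "x \<in> kept_pts N S ?T" for x
    proof (cases "x \<in> kept_pts N S T")
      case True
      have "ren S T x \<in> pts N (nl d) (nr d)" using ren_image[OF d(5,6)] d(7,8) True by auto
      then show ?thesis
        unfolding ren[OF True] mt_c[OF KP[OF True]] using mt_d d(9)[OF True] ren[OF d(10)[OF True]] by simp
    next
      case False
      then have "x = Rgt (nr c) \<or> x = Rgt (Suc (nr c))" using x by (cases x) auto
      then show ?thesis using r d(8) by (auto simp: cap_right_def)
    qed
    show "mt (cap_right c) (Rgt i) \<in> Rgt ` (- ?T)" if "i < nr (cap_right c)" "i \<notin> ?T" for i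
    proof -
      have i: "i < nr c" "i \<notin> T" using that by (auto simp: cap_right_def)
      then obtain j where j: "mt c (Rgt i) = Rgt j" "j \<notin> T" using d(12) by blast
      then have "j < nr c" using pairing_mt_pts[OF d(1), of "Rgt i"] i by simp
      then show ?thesis using mt_c[of "Rgt i"] i j by auto
    qed
    show "mt (cap_right c) (Lft i) \<in> Lft ` (- S)" if "i < nl (cap_right c)" "i \<notin> S" for i
      using that d(11)[of i] by (simp add: cap_right_def)
    show "pairing N (cap_right c)" "pairing N (cap_right d)" using d(1,2) pairing_cap_right by auto
  qed (use d(3-8) r in \<open>auto simp: cap_right_def\<close>)
qed

lemma surgery_ren:
  assumes "inj_on f K" "a \<in> K" "b \<in> K" "x \<in> K" "\<And>x. x \<in> K \<Longrightarrow> s x \<in> K"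
    "\<And>x. x \<in> K \<Longrightarrow> t (f x) = f (s x)"
  shows "surgery (f a) (f b) t (f x) = f (surgery a b s x)"
  using assms unfolding surgery_def by (simp add: inj_on_eq_iff[OF assms(1)])

text \<open>Both gap points are kept, hence so are their partners. The reconnection therefore takes
  place among kept points and does not touch the removed arcs.\<close>

lemma removes_join:
  assumes "removes N S T c d" "gap_left k c \<in> kept_pts N S T" "gap_right N k c \<in> kept_pts N S T"
    "gap_left k d = ren S T (gap_left k c)" "gap_right N k d = ren S T (gap_right N k c)"
    "k \<le> N" "1 \<le> N"
  shows "removes N S T (join N k c) (join N k d)"
proof -
  note d = removesD[OF assms(1)]
  let ?K = "kept_pts N S T" and ?a = "gap_left k c" and ?b = "gap_right N k c"
  have KP: "x \<in> pts N (nl c) (nr c)" if "x \<in> ?K" for x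
    using that d(3,4) by (cases x) auto
  have inj: "inj_on (ren S T) ?K" using ren_eq_iff[OF d(5,6)] by (auto simp: inj_on_def)
  have off: "surgery ?a ?b (mt c) x = mt c x" if "x \<notin> ?K" for x
  proof -
    have "x \<noteq> ?a" "x \<noteq> ?b" "x \<noteq> mt c ?a" "x \<noteq> mt c ?b" using that assms(2,3) d(10) by metis+
    then show ?thesis by (simp add: surgery_def)
  qed
  show ?thesis
    unfolding removes_def
  proof (intro conjI ballI allI impI)
    show "pairing N (join N k c)"
      unfolding join_def using d(1) KP assms gap_in_pts(3)[OF assms(6,7)] by (intro pairing_surgery) auto
    have "gap_left k d \<in> pts N (nl d) (nr d)" "gap_right N k d \<in> pts N (nl d) (nr d)"
      unfolding assms(4,5) using assms(2,3) ren_image[OF d(5,6)] d(7,8) by auto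
    then show "pairing N (join N k d)"
      unfolding join_def by (intro pairing_surgery d gap_in_pts(3)[OF assms(6,7)])
    show "mt (join N k d) (ren S T x) = ren S T (mt (join N k c) x)" if "x \<in> ?K" for x
      using surgery_ren[OF inj assms(2,3) that, of "mt c" "mt d"] d(9,10) assms(4,5) by (simp add: join_def)
    show "mt (join N k c) (Lft i) \<in> Lft ` (- S)" if "i < nl (join N k c)" "i \<notin> S" for i
      using that off[of "Lft i"] d(11)[of i] by (simp add: join_def)
    show "mt (join N k c) (Rgt i) \<in> Rgt ` (- T)" if "i < nr (join N k c)" "i \<notin> T" for i
      using that off[of "Rgt i"] d(12)[of i] by (simp add: join_def)
  qed (use d in \<open>auto simp: join_def\<close>)
qed

text \<open>The two points of the return added by \<open>cap\<close> count as kept even though it is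
  a return, so that removing the older returns commutes with the whole step.\<close>

definition ext_left :: "nat \<Rightarrow> config \<Rightarrow> nat set \<Rightarrow> nat set" where
  "ext_left k c S = (if k = 0 then S \<union> {nl c, Suc (nl c)} else S)"

definition ext_right :: "nat \<Rightarrow> nat \<Rightarrow> config \<Rightarrow> nat set \<Rightarrow> nat set" where
  "ext_right N k c T = (if k = N then T \<union> {nr c, Suc (nr c)} else T)"

lemma removes_ext:
  assumes "removes N S T c d" "k \<le> N" "1 \<le> N"
  shows "removes N (ext_left k c S) (ext_right N k c T) (ext N k c) (ext N k d)"
proof -
  note d = removesD[OF assms(1)]
  have "removes N (ext_left k c S) (ext_right N k c T) (cap N k c) (cap N k d)"
    using assms removes_cap_left[OF assms(1)] removes_cap_right[OF assms(1)]
    by (auto simp: ext_left_def ext_right_def cap_def)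
  moreover have "gap_left k (cap N k c) \<in> kept_pts N (ext_left k c S) (ext_right N k c T)"
    "gap_right N k (cap N k c) \<in> kept_pts N (ext_left k c S) (ext_right N k c T)"
    "gap_left k (cap N k d) = ren (ext_left k c S) (ext_right N k c T) (gap_left k (cap N k c))"
    "gap_right N k (cap N k d) = ren (ext_left k c S) (ext_right N k c T) (gap_right N k (cap N k c))"
    using assms(2,3) d(7,8) rank_insert_top[OF d(3)] rank_insert_top[OF d(4)]
    by (auto simp: ext_left_def ext_right_def cap_def cap_left_def cap_right_def gap_left_def gap_right_def)
  ultimately show ?thesis
    unfolding ext_def using assms(2,3) by (intro removes_join) auto
qed

text \<open>Words act on reduced diagrams while products are computed in unreduced stacks; this
  allows returns to be removed before a generator is added or only afterwards.\<close>

lemma nf_ext_nf: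
  assumes "pairing N c" "k \<le> N" "1 \<le> N"
  shows "nf N (ext N k (nf N c)) = nf N (ext N k c)"
  using nf_removes[OF removes_ext[OF removes_nf[OF assms(1)] assms(2,3)]] by simp

lemma loop_at_nf:
  assumes "pairing N c"
  shows "loop_at N k (nf N c) \<longleftrightarrow> loop_at N k c"
proof -
  note d = removesD[OF removes_nf[OF assms]]
  have "mt (nf N c) (Top (k - 1)) = Top k \<longleftrightarrow> mt c (Top (k - 1)) = Top k" if "0 < k" "k < N"
    using d(9)[of "Top (k - 1)"] that by (cases "mt c (Top (k - 1))") auto
  then show ?thesis by (auto simp: loop_at_def)
qed


section \<open>Parities and weights\<close>

lemma even_card_involution:
  assumes "finite A" "\<And>x. x \<in> A \<Longrightarrow> f x \<in> A \<and> f x \<noteq> x \<and> f (f x) = x"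
  shows "even (card A)"
  using assms
proof (induction "card A" arbitrary: A rule: less_induct)
  case less
  show ?case
  proof (cases "A = {}")
    case False
    then obtain x where x: "x \<in> A" by blast
    let ?B = "A - {x, f x}"
    have fx: "f x \<in> A" "f x \<noteq> x" using less.prems(2)[OF x] by auto
    have "A = insert x (insert (f x) ?B)" using x fx by blast
    then have card: "card A = Suc (Suc (card ?B))"
      using less.prems(1) fx by (metis Diff_iff card_insert_disjoint finite_Diff finite_insert insertE insertI1 insertI2)
    have "f y \<in> ?B \<and> f y \<noteq> y \<and> f (f y) = y" if "y \<in> ?B" for y
      using that less.prems(2) x fx by (metis DiffD1 DiffD2 DiffI insertE insertI1 insertI2 singletonD)
    then have "even (card ?B)" using less.hyps[of ?B] less.prems(1) card by simp
    then show ?thesis using card by simp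
  qed simp
qed

lemma key_ren_less:
  assumes "finite S" "finite T" "x \<in> kept_pts N S T" "y \<in> kept_pts N S T"
  shows "key (ren S T x) < key (ren S T y) \<longleftrightarrow> key x < key y"
  using assms rank_less_iff by (cases x; cases y) auto

lemma planar_removes:
  assumes "removes N S T c d" "planar c"
  shows "planar d"
  unfolding planar_def
proof (intro allI impI)
  note d = removesD[OF assms(1)]
  fix x' y' assume B: "btw x' (mt d x') y'"
  then have "mt d x' \<noteq> x'" by auto
  then have "x' \<in> ren S T ` kept_pts N S T"
    using pairing_fix[OF d(2)] ren_image[OF d(5,6)] d(7,8) by simp
  then obtain x where x: "x \<in> kept_pts N S T" "x' = ren S T x" by blast
  show "btw x' (mt d x') (mt d y')"
  proof (cases "y' \<in> pts N (nl d) (nr d)")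
    case True
    then have "y' \<in> ren S T ` kept_pts N S T" using ren_image[OF d(5,6)] d(7,8) by simp
    then obtain y where y: "y \<in> kept_pts N S T" "y' = ren S T y" by blast
    have "btw (ren S T u) (ren S T v) (ren S T w) \<longleftrightarrow> btw u v w"
      if "u \<in> kept_pts N S T" "v \<in> kept_pts N S T" "w \<in> kept_pts N S T" for u v w
      using key_ren_less[OF d(5,6)] that by (simp add: btw_def)
    then show ?thesis using B assms(2) x y d(9,10) by (simp add: planar_def)
  next
    case False
    then have "mt d y' = y'" using pairing_fix[OF d(2)] by blast
    then show ?thesis using B by simp
  qed
qed

lemma rank_add_removed: "rank S i + card ({..<i} - S) = i"
proof -
  have "rank S i = card ({..<i} \<inter> S)" unfolding rank_def by (rule arg_cong[of _ _ card]) auto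
  then show ?thesis using card_Int_Diff[of "{..<i}" S] by simp
qed

text \<open>Planarity forces the partner of a removed point below \<open>i\<close> to lie below \<open>i\<close>, too.\<close>

lemma even_rank_left:
  assumes "pairing N c" "planar c" "i \<in> kept_left c \<or> i = nl c"
  shows "even (rank (kept_left c) i) \<longleftrightarrow> even i"
proof -
  have "\<exists>j'. mt c (Lft j) = Lft j' \<and> j' < i \<and> j' \<noteq> j \<and> j' \<notin> kept_left c" if j: "j < i" "j \<notin> kept_left c" for j
  proof -
    have jn: "j < nl c" using j(1) assms(3) by (auto simp: kept_left_def)
    then obtain j' where j': "mt c (Lft j) = Lft j'" using j(2) by (auto simp: kept_left_def)
    have sym: "mt c (Lft j') = Lft j" using j' assms(1) by (metis pairing_mt)
    have j'n: "j' < nl c" using pairing_mt_pts[OF assms(1), of "Lft j"] j' jn by simp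
    have "j' < i"
    proof (rule ccontr)
      assume "\<not> j' < i"
      moreover have "j' \<noteq> i" using sym assms(3) j'n by (auto simp: kept_left_def)
      ultimately have lt: "i < j'" by simp
      then have "i \<in> kept_left c" using assms(3) j'n by auto
      moreover have "btw (Lft j) (mt c (Lft j)) (Lft i)" using j(1) lt j' by (simp add: btw_def)
      then have "btw (Lft j) (Lft j') (mt c (Lft i))" using assms(2) j' unfolding planar_def by metis
      then have "mt c (Lft i) \<in> range Lft" by (cases "mt c (Lft i)") (auto simp: btw_def)
      ultimately show False by (auto simp: kept_left_def)
    qed
    moreover have "j' \<noteq> j" using j' jn pairing_fix[OF assms(1), of "Lft j"] by auto
    moreover have "j' \<notin> kept_left c" using sym by (auto simp: kept_left_def)
    ultimately show ?thesis using j' by blast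
  qed
  note A = this
  let ?f = "\<lambda>j. case mt c (Lft j) of Lft j' \<Rightarrow> j' | _ \<Rightarrow> 0"
  have "even (card ({..<i} - kept_left c))"
  proof (rule even_card_involution[of _ ?f])
    fix j assume "j \<in> {..<i} - kept_left c"
    then obtain j' where j': "mt c (Lft j) = Lft j'" "j' < i" "j' \<noteq> j" "j' \<notin> kept_left c" using A[of j] by auto
    moreover from this have "mt c (Lft j') = Lft j" using assms(1) by (metis pairing_mt)
    ultimately show "?f j \<in> {..<i} - kept_left c \<and> ?f j \<noteq> j \<and> ?f (?f j) = j" by simp
  qed simp
  then show ?thesis using rank_add_removed[of "kept_left c" i] by presburger
qed

lemma even_rank_right:
  assumes "pairing N c" "planar c" "i \<in> kept_right c \<or> i = nr c"
  shows "even (rank (kept_right c) i) \<longleftrightarrow> even i"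
proof -
  have "\<exists>j'. mt c (Rgt j) = Rgt j' \<and> j' < i \<and> j' \<noteq> j \<and> j' \<notin> kept_right c" if j: "j < i" "j \<notin> kept_right c" for j
  proof -
    have jn: "j < nr c" using j(1) assms(3) by (auto simp: kept_right_def)
    then obtain j' where j': "mt c (Rgt j) = Rgt j'" using j(2) by (auto simp: kept_right_def)
    have sym: "mt c (Rgt j') = Rgt j" using j' assms(1) by (metis pairing_mt)
    have j'n: "j' < nr c" using pairing_mt_pts[OF assms(1), of "Rgt j"] j' jn by simp
    have "j' < i"
    proof (rule ccontr)
      assume "\<not> j' < i"
      moreover have "j' \<noteq> i" using sym assms(3) j'n by (auto simp: kept_right_def)
      ultimately have lt: "i < j'" by simp
      then have "i \<in> kept_right c" using assms(3) j'n by auto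
      moreover have "btw (Rgt j) (mt c (Rgt j)) (Rgt i)" using j(1) lt j' by (simp add: btw_def)
      then have "btw (Rgt j) (Rgt j') (mt c (Rgt i))" using assms(2) j' unfolding planar_def by metis
      then have "mt c (Rgt i) \<in> range Rgt" by (cases "mt c (Rgt i)") (auto simp: btw_def)
      ultimately show False by (auto simp: kept_right_def)
    qed
    moreover have "j' \<noteq> j" using j' jn pairing_fix[OF assms(1), of "Rgt j"] by auto
    moreover have "j' \<notin> kept_right c" using sym by (auto simp: kept_right_def)
    ultimately show ?thesis using j' by blast
  qed
  note A = this
  let ?f = "\<lambda>j. case mt c (Rgt j) of Rgt j' \<Rightarrow> j' | _ \<Rightarrow> 0"
  have "even (card ({..<i} - kept_right c))"
  proof (rule even_card_involution[of _ ?f])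
    fix j assume "j \<in> {..<i} - kept_right c"
    then obtain j' where j': "mt c (Rgt j) = Rgt j'" "j' < i" "j' \<noteq> j" "j' \<notin> kept_right c" using A[of j] by auto
    moreover from this have "mt c (Rgt j') = Rgt j" using assms(1) by (metis pairing_mt)
    ultimately show "?f j \<in> {..<i} - kept_right c \<and> ?f j \<noteq> j \<and> ?f (?f j) = j" by simp
  qed simp
  then show ?thesis using rank_add_removed[of "kept_right c" i] by presburger
qed

lemma rank_all: "S \<subseteq> {..<n} \<Longrightarrow> rank S n = card S"
  unfolding rank_def by (rule arg_cong[of _ _ card]) auto

lemma nf_in_reduced_configs:
  assumes "planar_config N c"
  shows "nf N c \<in> reduced_configs N"
proof -
  have p: "pairing N c" "planar c" using assms by (auto simp: planar_config_def)
  note d = removesD[OF removes_nf[OF p(1)]]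
  have "even (nl (nf N c))" "even (nr (nf N c))"
    using even_rank_left[OF p, of "nl c"] even_rank_right[OF p, of "nr c"] d(3,4,7,8) assms
    by (simp_all add: rank_all planar_config_def)
  then show ?thesis
    using planar_removes[OF removes_nf[OF p(1)] p(2)] reduced_nf[OF p(1)] d(2)
    by (simp add: reduced_configs_def planar_config_def)
qed

section \<open>Odd returns and their scalar factors\<close>

definition odds_left :: "config \<Rightarrow> nat set" where
  "odds_left c = {i. odd i \<and> (\<exists>j>i. mt c (Lft i) = Lft j)}"

definition odds_right :: "config \<Rightarrow> nat set" where
  "odds_right c = {i. odd i \<and> (\<exists>j>i. mt c (Rgt i) = Rgt j)}"

text \<open>Accounts for returns only. Closed loops have already disappeared from the configuration
  and are counted by \<open>loop_at\<close>.\<close>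

definition weight :: "config \<Rightarrow> coeff" where
  "weight c = indet S1 ^ card (odds_left c) * indet S2 ^ card (odds_right c)"

lemma odds_bounds:
  assumes "pairing N c"
  shows "odds_left c \<subseteq> {..<nl c}" "odds_right c \<subseteq> {..<nr c}"
proof -
  have "i < nl c" if "mt c (Lft i) = Lft j" "i < j" for i j
    using that pairing_fix[OF assms, of "Lft i"] by auto
  then show "odds_left c \<subseteq> {..<nl c}" by (auto simp: odds_left_def)
  have "i < nr c" if "mt c (Rgt i) = Rgt j" "i < j" for i j
    using that pairing_fix[OF assms, of "Rgt i"] by auto
  then show "odds_right c \<subseteq> {..<nr c}" by (auto simp: odds_right_def)
qed

text \<open>Since renumbering preserves the parity of every remaining point, a return of
  \<open>d\<close> is odd exactly if the return of \<open>c\<close> that it comes from is. The odd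
  returns of \<open>c\<close> thus split into the removed ones and those of
  \<open>d\<close>.\<close>

lemma card_odds_removes:
  assumes "removes N S T c d" "\<And>i. i \<in> S \<Longrightarrow> even (rank S i) \<longleftrightarrow> even i"
    "\<And>i. i \<in> T \<Longrightarrow> even (rank T i) \<longleftrightarrow> even i"
  shows "card (odds_left c) = card (odds_left c - S) + card (odds_left d)"
    "card (odds_right c) = card (odds_right c - T) + card (odds_right d)"
proof -
  note d = removesD[OF assms(1)]
  have fin: "finite (odds_left c)" "finite (odds_right c)"
    using odds_bounds[OF d(1)] finite_subset by blast+
  have *: "i \<in> odds_left c \<longleftrightarrow> rank S i \<in> odds_left d" if i: "i \<in> S" for i
  proof -
    have k: "Lft i \<in> kept_pts N S T" using i by simp
    show ?thesis using d(9,10)[OF k] assms(2)[OF i] rank_less_iff[OF d(5) i] i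
      by (cases "mt c (Lft i)") (auto simp: odds_left_def)
  qed
  have "rank S ` (odds_left c \<inter> S) = odds_left d"
  proof (intro equalityI subsetI)
    fix j assume "j \<in> odds_left d"
    moreover from this have "j \<in> rank S ` S"
      using rank_image[OF d(5)] odds_bounds[OF d(2)] d(7) by auto
    ultimately show "j \<in> rank S ` (odds_left c \<inter> S)"
      using * by blast
  qed (use * in blast)
  moreover have "card (rank S ` (odds_left c \<inter> S)) = card (odds_left c \<inter> S)"
    using rank_eq_iff[OF d(5)] by (intro card_image) (auto simp: inj_on_def)
  ultimately show "card (odds_left c) = card (odds_left c - S) + card (odds_left d)"
    using card_Int_Diff[OF fin(1), of S] by simp
  have *: "i \<in> odds_right c \<longleftrightarrow> rank T i \<in> odds_right d" if i: "i \<in> T" for i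
  proof -
    have k: "Rgt i \<in> kept_pts N S T" using i by simp
    show ?thesis using d(9,10)[OF k] assms(3)[OF i] rank_less_iff[OF d(6) i] i
      by (cases "mt c (Rgt i)") (auto simp: odds_right_def)
  qed
  have "rank T ` (odds_right c \<inter> T) = odds_right d"
  proof (intro equalityI subsetI)
    fix j assume "j \<in> odds_right d"
    moreover from this have "j \<in> rank T ` T"
      using rank_image[OF d(6)] odds_bounds[OF d(2)] d(8) by auto
    ultimately show "j \<in> rank T ` (odds_right c \<inter> T)"
      using * by blast
  qed (use * in blast)
  moreover have "card (rank T ` (odds_right c \<inter> T)) = card (odds_right c \<inter> T)"
    using rank_eq_iff[OF d(6)] by (intro card_image) (auto simp: inj_on_def)
  ultimately show "card (odds_right c) = card (odds_right c - T) + card (odds_right d)"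
    using card_Int_Diff[OF fin(2), of T] by simp
qed

lemma ext_nl_nr: "nl (ext N k c) = (if k = 0 then nl c + 2 else nl c)"
    "1 \<le> N \<Longrightarrow> nr (ext N k c) = (if k = N then nr c + 2 else nr c)"
  by (auto simp: ext_def join_def cap_def cap_left_def cap_right_def)

lemma mt_ext_return:
  assumes "pairing N c" "k \<le> N" "1 \<le> N"
  shows "i < nl c \<Longrightarrow> mt c (Lft i) = Lft j \<Longrightarrow> mt (ext N k c) (Lft i) = Lft j"
    "i < nr c \<Longrightarrow> mt c (Rgt i) = Rgt j \<Longrightarrow> mt (ext N k c) (Rgt i) = Rgt j"
proof -
  let ?c = "cap N k c"
  let ?a = "gap_left k ?c" and ?b = "gap_right N k ?c"
  have off: "mt (ext N k c) x = mt ?c x" if "x \<noteq> ?a" "x \<noteq> ?b" "mt ?c x \<noteq> ?a" "mt ?c x \<noteq> ?b" for x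
    using that pairing_mt[OF pairing_cap[OF assms(1)]] by (auto simp: ext_def join_def surgery_def)
  show "mt (ext N k c) (Lft i) = Lft j" if i: "i < nl c" "mt c (Lft i) = Lft j"
  proof -
    have j: "j < nl c" using pairing_mt_pts[OF assms(1), of "Lft i"] i by simp
    have "mt ?c (Lft i) = Lft j" using i by (auto simp: cap_def cap_left_def cap_right_def)
    then show ?thesis using off[of "Lft i"] i j
      by (auto simp: cap_def cap_left_def cap_right_def gap_left_def gap_right_def)
  qed
  show "mt (ext N k c) (Rgt i) = Rgt j" if i: "i < nr c" "mt c (Rgt i) = Rgt j"
  proof -
    have j: "j < nr c" using pairing_mt_pts[OF assms(1), of "Rgt i"] i by simp
    have "mt ?c (Rgt i) = Rgt j" using i by (auto simp: cap_def cap_left_def cap_right_def)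
    then show ?thesis using off[of "Rgt i"] i j assms(2,3)
      by (auto simp: cap_def cap_left_def cap_right_def gap_left_def gap_right_def)
  qed
qed

text \<open>Returns of \<open>c\<close> stay in place under \<open>ext\<close>, with the same points
  below them. Removing them first leaves the parity of every other side point unchanged, by
  \<open>even_rank_left\<close> and \<open>even_rank_right\<close>, so the remaining odd returns can
  be counted in \<open>ext N k (nf N c)\<close>. This reconciles the parity rule, which refers to
  the full stack, with reduction after each letter.\<close>

lemma weight_ext:
  assumes "planar_config N c" "k \<le> N" "1 \<le> N"
  shows "weight (ext N k c) = weight c * weight (ext N k (nf N c))"
proof -
  have p: "pairing N c" "planar c" using assms by (auto simp: planar_config_def)
  note nf = removes_nf[OF p(1)]
  note d = removesD[OF nf]
  let ?S = "ext_left k c (kept_left c)" and ?T = "ext_right N k c (kept_right c)"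
  have par_S: "even (rank ?S i) \<longleftrightarrow> even i" if "i \<in> ?S" for i
  proof (cases "i \<in> kept_left c")
    case True
    then have "i < nl c" using d(3) by blast
    then show ?thesis
      using True even_rank_left[OF p, of i] rank_insert_top(1)[OF d(3)] by (simp add: ext_left_def)
  next
    case False
    then have "i = nl c \<or> i = Suc (nl c)" using that by (auto simp: ext_left_def split: if_splits)
    then show ?thesis
      using that False even_rank_left[OF p, of "nl c"] rank_insert_top(2,3)[OF d(3)] rank_all[OF d(3)]
      by (auto simp: ext_left_def split: if_splits)
  qed
  have par_T: "even (rank ?T i) \<longleftrightarrow> even i" if "i \<in> ?T" for i
  proof (cases "i \<in> kept_right c")
    case True
    then have "i < nr c" using d(4) by blast
    then show ?thesis
      using True even_rank_right[OF p, of i] rank_insert_top(1)[OF d(4)] by (simp add: ext_right_def)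
  next
    case False
    then have "i = nr c \<or> i = Suc (nr c)" using that by (auto simp: ext_right_def split: if_splits)
    then show ?thesis
      using that False even_rank_right[OF p, of "nr c"] rank_insert_top(2,3)[OF d(4)] rank_all[OF d(4)]
      by (auto simp: ext_right_def split: if_splits)
  qed
  note e = removes_ext[OF nf assms(2,3)]
  have "odds_left (ext N k c) - ?S = odds_left c"
  proof (intro equalityI subsetI)
    fix i assume i: "i \<in> odds_left (ext N k c) - ?S"
    then have "i < nl (ext N k c)" "i \<notin> ?S" using odds_bounds[OF removesD(1)[OF e]] by auto
    then have "i < nl c" "i \<notin> kept_left c" by (auto simp: ext_nl_nr ext_left_def split: if_splits)
    moreover from this obtain j where "mt c (Lft i) = Lft j" by (auto simp: kept_left_def)
    ultimately show "i \<in> odds_left c"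
      using i mt_ext_return(1)[OF p(1) assms(2,3)] by (auto simp: odds_left_def)
  next
    fix i assume i: "i \<in> odds_left c"
    then have "i < nl c" using odds_bounds[OF p(1)] by auto
    moreover have "i \<notin> kept_left c" using i by (auto simp: kept_left_def odds_left_def)
    ultimately show "i \<in> odds_left (ext N k c) - ?S"
      using i mt_ext_return(1)[OF p(1) assms(2,3)] by (auto simp: odds_left_def ext_left_def)
  qed
  moreover have "odds_right (ext N k c) - ?T = odds_right c"
  proof (intro equalityI subsetI)
    fix i assume i: "i \<in> odds_right (ext N k c) - ?T"
    then have "i < nr (ext N k c)" "i \<notin> ?T" using odds_bounds[OF removesD(1)[OF e]] by auto
    then have "i < nr c" "i \<notin> kept_right c" using assms(3) by (auto simp: ext_nl_nr ext_right_def split: if_splits)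
    moreover from this obtain j where "mt c (Rgt i) = Rgt j" by (auto simp: kept_right_def)
    ultimately show "i \<in> odds_right c"
      using i mt_ext_return(2)[OF p(1) assms(2,3)] by (auto simp: odds_right_def)
  next
    fix i assume i: "i \<in> odds_right c"
    then have "i < nr c" using odds_bounds[OF p(1)] by auto
    moreover have "i \<notin> kept_right c" using i by (auto simp: kept_right_def odds_right_def)
    ultimately show "i \<in> odds_right (ext N k c) - ?T"
      using i mt_ext_return(2)[OF p(1) assms(2,3)] by (auto simp: odds_right_def ext_right_def)
  qed
  ultimately show ?thesis
    using card_odds_removes[OF e par_S par_T] by (simp add: weight_def power_add mult_ac)
qed

lemma weight_reduced: "reduced c \<Longrightarrow> weight c = 1"
proof -
  assume "reduced c"
  then have "odds_left c = {}" "odds_right c = {}"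
    by (auto simp: reduced_def odds_left_def odds_right_def)
  then show ?thesis by (simp add: weight_def)
qed


section \<open>Composition of diagrams\<close>

lemma left_returns_mem: "pairing N c \<Longrightarrow> i < nl c \<Longrightarrow> Lft i \<in> \<Union> (left_returns (diagram_of c)) \<longleftrightarrow> mt c (Lft i) \<in> range Lft"
proof -
  assume c: "pairing N c" "i < nl c"
  have ne: "mt c (Lft i) \<noteq> Lft i" using pairing_fix[OF c(1)] c(2) by simp
  show ?thesis
  proof
    assume "Lft i \<in> \<Union> (left_returns (diagram_of c))"
    then obtain i' j' where "Lft i \<in> {Lft i', Lft j'}" "mt c (Lft i') = Lft j'"
      unfolding returns_diagram_of by blast
    moreover from this have "mt c (Lft j') = Lft i'" using c(1) by (metis pairing_mt)
    ultimately show "mt c (Lft i) \<in> range Lft" by auto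
  next
    assume "mt c (Lft i) \<in> range Lft"
    then obtain j where "mt c (Lft i) = Lft j" by blast
    moreover from this have "i \<noteq> j" using ne by auto
    ultimately show "Lft i \<in> \<Union> (left_returns (diagram_of c))"
      unfolding returns_diagram_of by blast
  qed
qed

lemma right_returns_mem: "pairing N c \<Longrightarrow> i < nr c \<Longrightarrow> Rgt i \<in> \<Union> (right_returns (diagram_of c)) \<longleftrightarrow> mt c (Rgt i) \<in> range Rgt"
proof -
  assume c: "pairing N c" "i < nr c"
  have ne: "mt c (Rgt i) \<noteq> Rgt i" using pairing_fix[OF c(1)] c(2) by simp
  show ?thesis
  proof
    assume "Rgt i \<in> \<Union> (right_returns (diagram_of c))"
    then obtain i' j' where "Rgt i \<in> {Rgt i', Rgt j'}" "mt c (Rgt i') = Rgt j'"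
      unfolding returns_diagram_of by blast
    moreover from this have "mt c (Rgt j') = Rgt i'" using c(1) by (metis pairing_mt)
    ultimately show "mt c (Rgt i) \<in> range Rgt" by auto
  next
    assume "mt c (Rgt i) \<in> range Rgt"
    then obtain j where "mt c (Rgt i) = Rgt j" by blast
    moreover from this have "i \<noteq> j" using ne by auto
    ultimately show "Rgt i \<in> \<Union> (right_returns (diagram_of c))"
      unfolding returns_diagram_of by blast
  qed
qed

lemma reduce_diagram_of:
  assumes c: "pairing N c"
  shows "reduce (diagram_of c) = diagram_of (nf N c)"
proof -
  note d = removesD[OF removes_nf[OF c]]
  let ?S = "kept_left c" and ?T = "kept_right c" and ?D = "diagram_of c"
  let ?K = "kept_pts N ?S ?T"
  have l: "{j. j < nl c \<and> Lft j \<notin> \<Union> (left_returns ?D)} = ?S"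
    using left_returns_mem[OF c] unfolding kept_left_def by blast
  have r: "{j. j < nr c \<and> Rgt j \<notin> \<Union> (right_returns ?D)} = ?T"
    using right_returns_mem[OF c] unfolding kept_right_def by blast
  have l': "{j. j < i \<and> Lft j \<notin> \<Union> (left_returns ?D)} = {j \<in> ?S. j < i}" if "i < nl c" for i
    using that unfolding l[symmetric] by auto
  have r': "{j. j < i \<and> Rgt j \<notin> \<Union> (right_returns ?D)} = {j \<in> ?T. j < i}" if "i < nr c" for i
    using that unfolding r[symmetric] by auto
  have KP: "x \<in> pts N (nl c) (nr c)" if "x \<in> ?K" for x
    using that d(3,4) by (cases x) auto
  have ren: "renumber ?D x = ren ?S ?T x" if "x \<in> ?K" for x
    using KP[OF that] l' r' by (cases x) (simp_all add: rank_def)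
  have "arcs ?D - left_returns ?D - right_returns ?D = (\<lambda>x. {x, mt c x}) ` ?K"
  proof (intro equalityI subsetI)
    fix s assume s: "s \<in> arcs ?D - left_returns ?D - right_returns ?D"
    then obtain x where x: "s = {x, mt c x}" "mt c x \<noteq> x" by (auto simp: diagram_of_def)
    then have "x \<in> pts N (nl c) (nr c)" using pairing_fix[OF c] by blast
    moreover have "mt c (Lft i) \<notin> range Lft" if "x = Lft i" for i
      using s x that unfolding left_returns_def by auto
    moreover have "mt c (Rgt i) \<notin> range Rgt" if "x = Rgt i" for i
      using s x that unfolding right_returns_def by auto
    ultimately have "x \<in> ?K" by (cases x) (auto simp: kept_left_def kept_right_def)
    then show "s \<in> (\<lambda>x. {x, mt c x}) ` ?K" using x by blast
  next
    fix s assume "s \<in> (\<lambda>x. {x, mt c x}) ` ?K"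
    then obtain x where x: "x \<in> ?K" "s = {x, mt c x}" by blast
    have "mt c x \<noteq> x" using KP[OF x(1)] pairing_fix[OF c] by blast
    moreover have "\<not> s \<subseteq> range Lft" "\<not> s \<subseteq> range Rgt"
      using x by (cases x; auto simp: kept_left_def kept_right_def)+
    ultimately show "s \<in> arcs ?D - left_returns ?D - right_returns ?D"
      using x unfolding left_returns_def right_returns_def diagram_of_def by auto
  qed
  then have "(`) (renumber ?D) ` (arcs ?D - left_returns ?D - right_returns ?D) =
      (\<lambda>x. {ren ?S ?T x, mt (nf N c) (ren ?S ?T x)}) ` ?K"
    using ren d(9,10) by (simp add: image_image cong: image_cong)
  also have "\<dots> = (\<lambda>y. {y, mt (nf N c) y}) ` pts N (nl (nf N c)) (nr (nf N c))"
    unfolding d(7,8) ren_image[OF d(5,6), symmetric] by (simp add: image_image)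
  also have "\<dots> = arcs (diagram_of (nf N c))"
    using pairing_fix[OF d(2)] by (auto simp: diagram_of_def)
  finally show ?thesis
    unfolding reduce_def lefts_rights_diagram_of l r by (intro diagram.expand) (simp add: d(7,8))
qed

text \<open>A return is determined by its lower end point, whose index is the minimum taken in
  \<open>odd_left\<close> and \<open>odd_right\<close>.\<close>

lemma card_odd_diagram_of:
  assumes c: "pairing N c"
  shows "card (odd_left (diagram_of c)) = card (odds_left c)"
    "card (odd_right (diagram_of c)) = card (odds_right c)"
proof -
  have l: "(LEAST k. Lft k \<in> {Lft i, Lft j}) = i" if "i < j" for i j
    using that by (intro Least_equality) auto
  have r: "(LEAST k. Rgt k \<in> {Rgt i, Rgt j}) = i" if "i < j" for i j
    using that by (intro Least_equality) auto
  have "odd_left (diagram_of c) = (\<lambda>i. {Lft i, mt c (Lft i)}) ` odds_left c"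
  proof (intro equalityI subsetI)
    fix s assume s: "s \<in> odd_left (diagram_of c)"
    then obtain i j where ij: "s = {Lft i, Lft j}" "mt c (Lft i) = Lft j" "i < j"
      unfolding odd_left_def returns_diagram_of
      using pairing_mt[OF c] by (clarsimp simp: linorder_neq_iff) (metis insert_commute)
    moreover from this have "odd i" using s l unfolding odd_left_def by auto
    ultimately show "s \<in> (\<lambda>i. {Lft i, mt c (Lft i)}) ` odds_left c"
      by (auto simp: odds_left_def intro!: image_eqI[of _ _ i])
  next
    fix s assume "s \<in> (\<lambda>i. {Lft i, mt c (Lft i)}) ` odds_left c"
    then obtain i j where "s = {Lft i, Lft j}" "mt c (Lft i) = Lft j" "i < j" "odd i"
      by (auto simp: odds_left_def)
    then show "s \<in> odd_left (diagram_of c)"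
      unfolding odd_left_def returns_diagram_of using l[of i j] by auto
  qed
  moreover have "inj_on (\<lambda>i. {Lft i, mt c (Lft i)}) (odds_left c)"
    using pairing_mt[OF c] by (auto simp: inj_on_def odds_left_def doubleton_eq_iff; force)
  ultimately show "card (odd_left (diagram_of c)) = card (odds_left c)"
    by (simp add: card_image)
  have "odd_right (diagram_of c) = (\<lambda>i. {Rgt i, mt c (Rgt i)}) ` odds_right c"
  proof (intro equalityI subsetI)
    fix s assume s: "s \<in> odd_right (diagram_of c)"
    then obtain i j where ij: "s = {Rgt i, Rgt j}" "mt c (Rgt i) = Rgt j" "i < j"
      unfolding odd_right_def returns_diagram_of
      using pairing_mt[OF c] by (clarsimp simp: linorder_neq_iff) (metis insert_commute)
    moreover from this have "odd i" using s r unfolding odd_right_def by auto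
    ultimately show "s \<in> (\<lambda>i. {Rgt i, mt c (Rgt i)}) ` odds_right c"
      by (auto simp: odds_right_def intro!: image_eqI[of _ _ i])
  next
    fix s assume "s \<in> (\<lambda>i. {Rgt i, mt c (Rgt i)}) ` odds_right c"
    then obtain i j where "s = {Rgt i, Rgt j}" "mt c (Rgt i) = Rgt j" "i < j" "odd i"
      by (auto simp: odds_right_def)
    then show "s \<in> odd_right (diagram_of c)"
      unfolding odd_right_def returns_diagram_of using r[of i j] by auto
  qed
  moreover have "inj_on (\<lambda>i. {Rgt i, mt c (Rgt i)}) (odds_right c)"
    using pairing_mt[OF c] by (auto simp: inj_on_def odds_right_def doubleton_eq_iff; force)
  ultimately show "card (odd_right (diagram_of c)) = card (odds_right c)"
    by (simp add: card_image)
qed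

lemma compose_stacks_to:
  assumes "stacks_to N a b c"
  shows "compose N (diagram_of a) (diagram_of b) =
    (indet Delta ^ card (closed_loops N (diagram_of a) (diagram_of b)) * weight c, diagram_of (nf N c))"
proof -
  have c: "pairing N c" using assms by (simp add: stacks_to_def)
  show ?thesis
    unfolding compose_def stack_eqI[OF assms]
    by (simp add: reduce_diagram_of[OF c] card_odd_diagram_of[OF c] weight_def mult.assoc)
qed

section \<open>The action of letters and words on reduced diagrams\<close>

definition act1 :: "nat \<Rightarrow> nat \<Rightarrow> config \<Rightarrow> coeff \<times> config" where
  "act1 N k c = ((if loop_at N k c then indet Delta else 1) * weight (ext N k c), nf N (ext N k c))"

text \<open>The new generator sits on top of the stack \<open>c\<close>. Whether it closes a loop
  there is not affected by reducing \<open>c\<close> first, and the weights multiply by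
  \<open>weight_ext\<close>.\<close>

lemma compose_ext:
  assumes "stacks_to N a b c" "planar_config N c" "k \<le> N" "1 \<le> N" "\<not> loop_at N k b"
  shows "compose N (diagram_of a) (diagram_of (ext N k b)) =
    (fst (compose N (diagram_of a) (diagram_of b)) * fst (act1 N k (nf N c)),
     diagram_of (snd (act1 N k (nf N c))))"
proof -
  have c: "pairing N c" using assms by (simp add: stacks_to_def)
  note ext = stacks_to_ext[OF assms(1,3-5)]
  show ?thesis
    unfolding compose_stacks_to[OF ext(1)] compose_stacks_to[OF assms(1)] ext(2)
    using weight_ext[OF assms(2-4)] nf_ext_nf[OF c assms(3,4)] loop_at_nf[OF c]
    by (simp add: act1_def mult_ac)
qed

fun act :: "nat \<Rightarrow> config \<Rightarrow> nat list \<Rightarrow> coeff \<times> config" where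
  "act N c [] = (1, c)"
| "act N c (k # u) = (fst (act1 N k c) * fst (act N (snd (act1 N k c)) u), snd (act N (snd (act1 N k c)) u))"

lemma act_append:
  "fst (act N c (u @ v)) = fst (act N c u) * fst (act N (snd (act N c u)) v)"
  "snd (act N c (u @ v)) = snd (act N (snd (act N c u)) v)"
  by (induction u arbitrary: c) (simp_all add: mult.assoc)

lemma snd_act1_reduced_configs:
  assumes "c \<in> reduced_configs N" "k \<le> N" "1 \<le> N"
  shows "snd (act1 N k c) \<in> reduced_configs N"
  using assms planar_config_ext nf_in_reduced_configs by (simp add: act1_def reduced_configs_def)

lemma snd_act_reduced_configs:
  assumes "c \<in> reduced_configs N" "u \<in> lists {0..N}" "1 \<le> N"
  shows "snd (act N c u) \<in> reduced_configs N"
  using assms(2,1)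
  by (induction u arbitrary: c rule: list.induct) (use snd_act1_reduced_configs assms(3) in auto)


section \<open>Cups and cuts\<close>

text \<open>Both sides say that the pairs \<open>x\<close>, \<open>y\<close> and \<open>a\<close>,
  \<open>p\<close> interleave, a condition symmetric in the two pairs. The instances of totality and
  transitivity are supplied explicitly, so that a propositional problem remains.\<close>

lemma between_cross:
  fixes x y a p :: "'a :: linorder"
  assumes "x \<noteq> a" "x \<noteq> p" "y \<noteq> a" "y \<noteq> p" "x \<noteq> y" "a \<noteq> p"
  shows "((x < a \<and> a < y \<or> y < a \<and> a < x) \<noteq> (x < p \<and> p < y \<or> y < p \<and> p < x)) \<longleftrightarrow>
    ((a < x \<and> x < p \<or> p < x \<and> x < a) \<noteq> (a < y \<and> y < p \<or> p < y \<and> y < a))"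
proof -
  have less: "u < v \<longleftrightarrow> \<not> v < u" if "u \<noteq> v" for u v :: 'a
    using that by auto
  have trans: "u < v \<Longrightarrow> v < w \<Longrightarrow> u < w" for u v w :: 'a by simp
  show ?thesis
    using less[OF assms(1)] less[OF assms(2)] less[OF assms(3)] less[OF assms(4)] less[OF assms(5)]
      less[OF assms(6)] trans[of x y a] trans[of x y p] trans[of x a y] trans[of x a p]
      trans[of x p y] trans[of x p a] trans[of y x a] trans[of y x p] trans[of y a x] trans[of y a p]
      trans[of y p x] trans[of y p a] trans[of a x y] trans[of a x p] trans[of a y x] trans[of a y p]
      trans[of a p x] trans[of a p y] trans[of p x y] trans[of p x a] trans[of p y x] trans[of p y a]
      trans[of p a x] trans[of p a y]
    by argo
qed

lemma btw_cross:
  assumes "x \<noteq> a" "x \<noteq> p" "y \<noteq> a" "y \<noteq> p" "x \<noteq> y" "a \<noteq> p"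
  shows "(btw x y a \<noteq> btw x y p) \<longleftrightarrow> (btw a p x \<noteq> btw a p y)"
  unfolding btw_def using assms by (intro between_cross) simp_all

text \<open>Converse to \<open>planar_surgery\<close>.\<close>

lemma planar_cut:
  assumes p: "pairing N c" and pl: "planar c" and sab: "mt c a = b" and spq: "mt c p = q"
    and ne: "a \<noteq> b" "p \<noteq> q" "p \<noteq> a" "p \<noteq> b"
    and adj: "\<And>y. y \<in> pts N (nl c) (nr c) \<Longrightarrow> \<not> btw a b y"
    and bq: "\<And>y. y \<notin> {a, b, p, q} \<Longrightarrow> btw b q y \<longleftrightarrow> btw b q (mt c y)"
    and bq': "\<not> btw b q a" "\<not> btw b q p"
  shows "planar (Config (nl c) (nr c) (surgery a p (mt c)))"
proof -
  define s where "s = mt c"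
  define P where "P = pts N (nl c) (nr c)"
  have ss: "s (s x) = x" for x using p by (simp add: s_def)
  have sP: "s x \<in> P \<longleftrightarrow> x \<in> P" for x using p by (simp add: s_def P_def pairing_mt_pts)
  have sfix: "s x = x \<longleftrightarrow> x \<notin> P" for x using p by (simp add: s_def P_def pairing_fix)
  have inv: "btw x (s x) (s y) = btw x (s x) y" for x y
    using pl p by (simp add: s_def planar_btw_iff)
  have s: "s a = b" "s b = a" "s p = q" "s q = p" using sab spq ss by (auto simp: s_def)
  have ne': "q \<noteq> a" "q \<noteq> b" using s ss ne by metis+
  have P4: "a \<in> P" "b \<in> P" "p \<in> P" "q \<in> P" using sfix s ne by metis+
  define t where "t = surgery a p s"
  have t: "t a = p" "t p = a" "t b = q" "t q = b" "\<And>x. x \<notin> {a, b, p, q} \<Longrightarrow> t x = s x"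
    using s ne ne' by (auto simp: t_def surgery_def)
  have other: "s x \<notin> {a, b, p, q}" if "x \<notin> {a, b, p, q}" for x
    using that ss s by (metis insert_iff empty_iff)
  have BQ: "btw b q y = btw b q (s y)" if "y \<notin> {a, b, p, q}" for y
    using bq[OF that] by (simp add: s_def)
  \<comment> \<open>Along \<open>a\<close>, \<open>b\<close>, \<open>q\<close>, \<open>p\<close> the
    interval from \<open>a\<close> to \<open>p\<close> is, modulo 2 and on marked points, the sum of
    an empty one, the one from \<open>b\<close> to \<open>q\<close> and the one under the old arc
    from \<open>p\<close> to \<open>q\<close>.\<close>
  have AP: "btw a p y = btw a p (s y)" if y: "y \<notin> {a, b, p, q}" for y
  proof (cases "y \<in> P")
    case True
    have "btw a p z = (btw b q z \<noteq> btw p q z)" if "z \<in> P" "z \<notin> {a, b, p, q}" for z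
      using btw_xor[of z b a p] btw_xor[of z q b p] adj[of z] that btw_commute[of q p]
      by (auto simp: P_def)
    then have "btw a p y = (btw b q y \<noteq> btw p q y)" "btw a p (s y) = (btw b q (s y) \<noteq> btw p q (s y))"
      using True y other[OF y] sP by auto
    then show ?thesis using BQ[OF y] inv[of p y] s by simp
  next
    case False
    then show ?thesis using sfix by metis
  qed
  have main: "btw x (t x) y \<longrightarrow> btw x (t x) (t y)" for x y
  proof (cases "y \<in> {a, b, p, q}")
    case y: True
    consider "x \<in> {a, p}" | "x \<in> {b, q}" | "x \<notin> {a, b, p, q}" by blast
    then show ?thesis
    proof cases
      case 1
      have "btw a p b = btw a p q"
        using btw_cross[of a b q p] bq' ne ne' by metis
      then have "btw a p y \<longrightarrow> btw a p (t y)"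
        using y t(1-4) btw_irrefl by (metis empty_iff insert_iff)
      then show ?thesis using 1 t(1,2) btw_commute[of p a] by (metis empty_iff insert_iff)
    next
      case 2
      have "btw b q y \<longrightarrow> btw b q (t y)"
        using y t(1-4) bq' btw_irrefl by (metis empty_iff insert_iff)
      then show ?thesis using 2 t(3,4) btw_commute[of q b] by (metis empty_iff insert_iff)
    next
      case 3
      have sx: "s x \<notin> {a, b, p, q}" using other[OF 3] .
      have eq: "btw x (s x) b = btw x (s x) a" "btw x (s x) q = btw x (s x) p"
        using inv[of x a] inv[of x p] s by auto
      \<comment> \<open>By \<open>AP\<close> the chord from \<open>a\<close> to \<open>p\<close>
        does not separate \<open>x\<close> from \<open>s x\<close>; by the symmetry of interleaving
        the arc at \<open>x\<close> does not separate \<open>a\<close> from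
        \<open>p\<close>.\<close>
      have "btw x (s x) a = btw x (s x) p"
      proof (cases "s x = x")
        case False
        then show ?thesis using btw_cross[of x a p "s x"] AP[OF 3] 3 sx ne by auto
      qed simp
      then show ?thesis using eq t(1-4) t(5)[OF 3] y by (metis empty_iff insert_iff)
    qed
  next
    case y: False
    have ty: "t y = s y" using t(5)[OF y] .
    consider "x \<in> {a, p}" | "x \<in> {b, q}" | "x \<notin> {a, b, p, q}" by blast
    then show ?thesis
    proof cases
      case 1
      then show ?thesis using AP[OF y] t(1,2) ty btw_commute[of p a] by (metis empty_iff insert_iff)
    next
      case 2
      then show ?thesis using BQ[OF y] t(3,4) ty btw_commute[of q b] by (metis empty_iff insert_iff)
    next
      case 3
      then show ?thesis using inv[of x y] t(5)[OF 3] ty by simp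
    qed
  qed
  then show ?thesis by (simp add: planar_def t_def s_def)
qed

text \<open>Horizontal position, with the two sides as the outermost columns: gap \<open>k\<close>
  lies between columns \<open>k\<close> and \<open>k + 1\<close>.\<close>

fun col :: "nat \<Rightarrow> point \<Rightarrow> nat" where
  "col N (Lft i) = 0"
| "col N (Top i) = Suc i"
| "col N (Bot i) = Suc i"
| "col N (Rgt i) = Suc N"

text \<open>The positivity conditions guard the truncated subtractions in \<open>nl c - 1\<close>
  and \<open>nr c - 1\<close>.\<close>

definition cup_at :: "nat \<Rightarrow> nat \<Rightarrow> config \<Rightarrow> bool" where
  "cup_at N k c \<longleftrightarrow> mt c (gap_left k c) = gap_right N k c \<and> (k = 0 \<longrightarrow> 0 < nl c) \<and> (k = N \<longrightarrow> 0 < nr c)"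

text \<open>If some line from the upper edge leads left, take the leftmost such \<open>i\<close>.
  The upper point before it does not lead left, and planarity joins the two; for
  \<open>i = 0\<close> the line ends at the topmost left point. If none leads left but some lead
  right, take the rightmost of these: a vertical line next to it would block it, so it starts at the
  last upper point and ends at the topmost right point. If all are vertical, they bar every line
  between the sides, and only the identity remains.\<close>

lemma exists_cup:
  assumes c: "c \<in> reduced_configs N" and N: "1 \<le> N" and not_id: "c \<noteq> id_config N"
  shows "\<exists>k\<le>N. cup_at N k c"
proof -
  have p: "pairing N c" and pl: "planar c" and red: "reduced c"
    using c by (auto simp: reduced_configs_def planar_config_def)
  define s where "s = mt c"
  have ss: "s (s x) = x" for x using p by (simp add: s_def)
  have sP: "s x \<in> pts N (nl c) (nr c) \<longleftrightarrow> x \<in> pts N (nl c) (nr c)" for x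
    using p by (simp add: s_def pairing_mt_pts)
  have sfix: "s x = x \<longleftrightarrow> x \<notin> pts N (nl c) (nr c)" for x using p by (simp add: s_def pairing_fix)
  have inv: "btw x (s x) (s y) = btw x (s x) y" for x y
    using pl p by (simp add: s_def planar_btw_iff)
  have seq: "s x = y \<longleftrightarrow> x = s y" for x y using ss by metis
  have noL: "s (Lft i) \<noteq> Lft j" if "i < nl c" for i j
    using red sfix[of "Lft i"] that by (auto simp: reduced_def s_def)
  have noR: "s (Rgt i) \<noteq> Rgt j" if "i < nr c" for i j
    using red sfix[of "Rgt i"] that by (auto simp: reduced_def s_def)
  have top: "s (Top i) \<noteq> Top i" "s (Top i) \<in> pts N (nl c) (nr c)" if "i < N" for i
    using sfix[of "Top i"] sP[of "Top i"] that by auto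
  show ?thesis
  proof (cases "\<exists>i<N. col N (s (Top i)) < Suc i")
    case True
    define i where "i = (LEAST i. i < N \<and> col N (s (Top i)) < Suc i)"
    have i: "i < N" "col N (s (Top i)) < Suc i"
      using LeastI_ex[of "\<lambda>i. i < N \<and> col N (s (Top i)) < Suc i"] True unfolding i_def by auto
    have least: "Suc j \<le> col N (s (Top j))" if "j < i" for j
      using not_less_Least[of j "\<lambda>i. i < N \<and> col N (s (Top i)) < Suc i"] that i(1) by (simp add: i_def)
    show ?thesis
    proof (cases i)
      case 0
      then obtain j where j: "s (Top 0) = Lft j" "j < nl c"
        using i top(2)[OF i(1)] by (cases "s (Top i)") auto
      \<comment> \<open>A left point above \<open>j\<close> would be enclosed by the line from
        \<open>Top 0\<close>, hence joined to another left point, against reducedness.\<close>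
      have "j = nl c - 1"
      proof (rule ccontr)
        assume "j \<noteq> nl c - 1"
        then have "btw (Top 0) (s (Top 0)) (Lft (nl c - 1))" using j by (auto simp: btw_def)
        then have "btw (Top 0) (Lft j) (s (Lft (nl c - 1)))" using inv j by metis
        then show False using noL[of "nl c - 1"] j by (cases "s (Lft (nl c - 1))") (auto simp: btw_def)
      qed
      then have "cup_at N 0 c"
        using j N seq unfolding cup_at_def gap_left_def gap_right_def s_def[symmetric] by auto
      then show ?thesis by blast
    next
      case (Suc h)
      have h: "h < N" "Suc h \<le> col N (s (Top h))" using least[of h] i Suc by auto
      have "s (Top h) = Top i"
      proof (rule ccontr)
        assume ne: "s (Top h) \<noteq> Top i"
        then have ne': "s (Top i) \<noteq> Top h" using seq by metis
        have I: "btw (Top i) (s (Top i)) (s (Top h)) = btw (Top i) (s (Top i)) (Top h)" by (rule inv)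
        show False
        proof (cases "s (Top i)")
          case (Lft j)
          then show False using I h Suc top[OF h(1)] by (cases "s (Top h)") (auto simp: btw_def)
        next
          case (Top j)
          then have "j < h" using ne' i Suc top[OF i(1)] by auto
          then show False using I h Suc Top top[OF h(1)] by (cases "s (Top h)") (auto simp: btw_def)
        next
          case (Rgt j)
          then show False using i by simp
        next
          case (Bot j)
          moreover have "s (Top h) \<noteq> Bot j" using Bot seq Suc by (metis n_not_Suc_n point.inject(2))
          ultimately show False using I h Suc i ne top[OF h(1)] by (cases "s (Top h)") (auto simp: btw_def)
        qed
      qed
      then have "cup_at N i c"
        using Suc i unfolding cup_at_def gap_left_def gap_right_def s_def[symmetric] by auto
      then show ?thesis using i(1) by (metis less_imp_le)
    qed
  next
    case False
    then have ge: "Suc i \<le> col N (s (Top i))" if "i < N" for i using that by auto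
    show ?thesis
    proof (cases "\<exists>i<N. Suc i < col N (s (Top i))")
      case True
      define i where "i = (GREATEST i. i < N \<and> Suc i < col N (s (Top i)))"
      have i: "i < N" "Suc i < col N (s (Top i))"
        using GreatestI_ex_nat[of "\<lambda>i. i < N \<and> Suc i < col N (s (Top i))" N] True unfolding i_def by auto
      have greatest: "col N (s (Top j)) = Suc j" if "i < j" "j < N" for j
        using Greatest_le_nat[of "\<lambda>i. i < N \<and> Suc i < col N (s (Top i))" j N] that ge[of j] unfolding i_def
        by (metis le_neq_implies_less less_imp_le linorder_not_less)
      have notTop: "s (Top i) \<noteq> Top j" for j
      proof
        assume j: "s (Top i) = Top j"
        then have "s (Top j) = Top i" using ss by metis
        have "j < N" using top(2)[OF i(1)] j by simp
        note this \<open>s (Top j) = Top i\<close>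
        then show False using ge[of j] i j by simp
      qed
      show ?thesis
      proof (cases "Suc i = N")
        case True
        then obtain j where j: "s (Top i) = Rgt j" "j < nr c"
          using i notTop top(2)[OF i(1)] by (cases "s (Top i)") auto
        have "j = nr c - 1"
        proof (rule ccontr)
          assume "j \<noteq> nr c - 1"
          then have "btw (Top i) (s (Top i)) (Rgt (nr c - 1))" using j by (auto simp: btw_def)
          then have "btw (Top i) (Rgt j) (s (Rgt (nr c - 1)))" using inv j by metis
          then show False using noR[of "nr c - 1"] j True sP[of "Rgt (nr c - 1)"]
            by (cases "s (Rgt (nr c - 1))") (auto simp: btw_def)
        qed
        then have "cup_at N N c"
          using j N True i unfolding cup_at_def gap_left_def gap_right_def s_def[symmetric] by auto
        then show ?thesis by blast
      next
        case False
        then have i': "Suc i < N" using i by simp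
        then have B: "s (Top (Suc i)) = Bot (Suc i)"
          using greatest[of "Suc i"] top[OF i'] by (cases "s (Top (Suc i))") auto
        have "btw (Top (Suc i)) (Bot (Suc i)) (s (Top i)) = btw (Top (Suc i)) (Bot (Suc i)) (Top i)"
          using inv[of "Top (Suc i)" "Top i"] B by simp
        moreover have "s (Top i) \<noteq> Bot (Suc i)" using B seq by (metis n_not_Suc_n point.inject(2))
        ultimately have False
          using i notTop by (cases "s (Top i)") (auto simp: btw_def)
        then show ?thesis ..
      qed
    next
      case no_R: False
      then have eq: "col N (s (Top i)) = Suc i" if "i < N" for i
        using that ge[OF that] no_R by (metis le_antisym not_less)
      have T: "s (Top i) = Bot i" if "i < N" for i
        using eq[OF that] top[OF that] that by (cases "s (Top i)") auto
      then have B: "s (Bot i) = Top i" if "i < N" for i using that seq by metis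
      have l: "nl c = 0"
      proof (rule ccontr)
        assume "nl c \<noteq> 0"
        then have L: "0 < nl c" by simp
        have "s (Lft 0) \<noteq> Top i" "s (Lft 0) \<noteq> Bot i" for i
          using T B seq sP[of "Lft 0"] L by (metis point.distinct pts_simps)+
        then obtain j where "s (Lft 0) = Rgt j" using noL[OF L] by (cases "s (Lft 0)") auto
        then show False using inv[of "Top 0" "Lft 0"] T[of 0] N by (auto simp: btw_def)
      qed
      have r: "nr c = 0"
      proof (rule ccontr)
        assume "nr c \<noteq> 0"
        then have R: "0 < nr c" by simp
        have "s (Rgt 0) \<noteq> Top i" "s (Rgt 0) \<noteq> Bot i" for i
          using T B seq sP[of "Rgt 0"] R by (metis point.distinct pts_simps)+
        moreover have "s (Rgt 0) \<noteq> Lft i" for i using sP[of "Rgt 0"] R l by auto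
        ultimately show False using noR[OF R] by (cases "s (Rgt 0)") auto
      qed
      have "s x = mt (id_config N) x" for x
        using T B l r sfix by (cases x) (auto simp: id_config_def)
      then have "c = id_config N"
        using l r by (intro config.expand) (auto simp: s_def)
      then show ?thesis using not_id by blast
    qed
  qed
qed


text \<open>The measure on which peeling off cups terminates: total horizontal extent of the lines,
  each counted from both ends. The two truncated differences add up to the absolute
  difference.\<close>

definition spread :: "nat \<Rightarrow> config \<Rightarrow> nat" where
  "spread N c = (\<Sum>x\<in>pts N (nl c) (nr c). (col N x - col N (mt c x)) + (col N (mt c x) - col N x))"

text \<open>In clockwise order the points to the right of a gap are consecutive: the end of the
  upper edge, the right side, the beginning of the lower edge.\<close>

lemma right_interval:
  assumes "u \<in> pts N l r" "v \<in> pts N l r" "x \<in> pts N l r" "k < col N u" "k < col N v" "col N x \<le> k" "k \<le> N"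
  shows "\<not> btw u v x"
  using assms by (cases u; cases v; cases x) (auto simp: btw_def)

lemma card_left_part:
  assumes "k \<le> N"
  shows "card {x \<in> pts N l r. col N x \<le> k} = l + 2 * k"
proof -
  have "{x \<in> pts N l r. col N x \<le> k} = Lft ` {..<l} \<union> (Top ` {..<k} \<union> Bot ` {..<k})"
  proof (intro Set.set_eqI)
    fix x show "x \<in> {x \<in> pts N l r. col N x \<le> k} \<longleftrightarrow> x \<in> Lft ` {..<l} \<union> (Top ` {..<k} \<union> Bot ` {..<k})"
      using assms by (cases x) auto
  qed
  moreover have "card (Lft ` {..<l} \<union> (Top ` {..<k} \<union> Bot ` {..<k})) =
      card (Lft ` {..<l}) + (card (Top ` {..<k}) + card (Bot ` {..<k}))"
    by (subst card_Un_disjoint; (subst card_Un_disjoint)?; auto)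
  moreover have "card (Lft ` {..<l}) = l" "card (Top ` {..<k}) = k" "card (Bot ` {..<k}) = k"
    by (simp_all add: card_image inj_on_def)
  ultimately show ?thesis by simp
qed

text \<open>Undoes a reconnection at the gap. Besides the cup from \<open>a\<close> to
  \<open>b\<close> some other line passes from the left to the right of the gap; \<open>p\<close>
  and \<open>q\<close> are the ends of the one closest to the cup, and the cut replaces both by arcs
  \<open>a p\<close> and \<open>b q\<close> that stay on one side each. Closeness is what keeps the
  result planar.\<close>

lemma exists_cut:
  assumes c: "c \<in> reduced_configs N" and k: "k \<le> N" "1 \<le> N" and cup: "cup_at N k c"
  obtains p q t where "mt c p = q" "p \<noteq> gap_left k c" "q \<noteq> gap_right N k c" "col N p \<le> k" "k < col N q"
    "p \<in> pts N (nl c) (nr c)" "q \<in> pts N (nl c) (nr c)"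
    "t (gap_left k c) = p" "t p = gap_left k c" "t (gap_right N k c) = q" "t q = gap_right N k c"
    "\<And>x. x \<notin> {gap_left k c, gap_right N k c, p, q} \<Longrightarrow> t x = mt c x"
    "planar (Config (nl c) (nr c) t)" "pairing N (Config (nl c) (nr c) t)"
    "surgery (gap_left k c) (gap_right N k c) t = mt c"
    "spread N (Config (nl c) (nr c) t) < spread N c"
proof -
  have pr: "pairing N c" and pl: "planar c" and red: "reduced c" and ev: "even (nl c)"
    using c by (auto simp: reduced_configs_def planar_config_def)
  define s where "s = mt c"
  define P where "P = pts N (nl c) (nr c)"
  define a b where "a = gap_left k c" and "b = gap_right N k c"
  have ss: "s (s x) = x" for x using pr by (simp add: s_def)
  have sP: "s x \<in> P \<longleftrightarrow> x \<in> P" for x using pr by (simp add: s_def P_def pairing_mt_pts)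
  have sfix: "s x = x \<longleftrightarrow> x \<notin> P" for x using pr by (simp add: s_def P_def pairing_fix)
  have inv: "btw x (s x) (s y) = btw x (s x) y" for x y
    using pl pr by (simp add: s_def planar_btw_iff)
  have sab: "s a = b" using cup by (simp add: cup_at_def s_def a_def b_def)
  then have sba: "s b = a" using ss by metis
  have ab: "a \<in> P" "b \<in> P" "a \<noteq> b" "col N a = k" "col N b = Suc k"
    using cup k gap_in_pts(3)[OF k] by (auto simp: cup_at_def a_def b_def P_def gap_left_def gap_right_def)
  let ?L = "{x \<in> P. col N x \<le> k}"
  \<comment> \<open>An even number of points lie left of the gap, as \<open>nl c\<close> is even.
    Without \<open>a\<close>, whose partner lies right of the gap, an odd number is left, so these
    cannot all be joined among themselves.\<close>
  have "\<exists>p\<in>?L - {a}. s p \<notin> ?L"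
  proof (rule ccontr)
    assume *: "\<not> ?thesis"
    have "even (card (?L - {a}))"
    proof (rule even_card_involution[of _ s])
      fix x assume x: "x \<in> ?L - {a}"
      then have "s x \<in> ?L" using * by blast
      moreover have "s x \<noteq> a" using x sab ss ab by (metis DiffD1 mem_Collect_eq not_less_eq_eq order_refl)
      ultimately show "s x \<in> ?L - {a} \<and> s x \<noteq> x \<and> s (s x) = x" using x sfix ss by blast
    qed (simp add: P_def)
    moreover have "card ?L = nl c + 2 * k" using card_left_part[OF k(1)] by (simp add: P_def)
    moreover have "card (?L - {a}) = card ?L - 1" "0 < card ?L"
      using ab by (auto simp: P_def card_gt_0_iff)
    ultimately show False using ev by presburger
  qed
  then obtain p0 where p0: "p0 \<in> P" "col N p0 \<le> k" "p0 \<noteq> a" "\<not> col N (s p0) \<le> k" using sP by blast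
  \<comment> \<open>Right ends of the lines that cross the gap, the cup excepted. The clockwise
    first of them belongs to the line closest to the cup.\<close>
  define Q where "Q = {q \<in> P. k < col N q \<and> q \<noteq> b \<and> col N (s q) \<le> k}"
  have "s p0 \<in> Q" using p0 sP ss sba unfolding Q_def by (metis (mono_tags, lifting) mem_Collect_eq not_le)
  moreover have "finite Q" by (simp add: Q_def P_def)
  ultimately have "Min (key ` Q) \<in> key ` Q" by (intro Min_in) auto
  then obtain q where q: "q \<in> Q" "key q = Min (key ` Q)" by auto
  have q_min: "key q \<le> key y" if "y \<in> Q" for y
    using q that \<open>finite Q\<close> by simp
  define p where "p = s q"
  have qP: "q \<in> P" "k < col N q" "q \<noteq> b" and pP: "p \<in> P" "col N p \<le> k"
    using q(1) sP by (auto simp: Q_def p_def)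
  have spq: "s p = q" using ss by (simp add: p_def)
  have ne: "p \<noteq> a" "p \<noteq> b" "p \<noteq> q" "q \<noteq> a"
    using qP pP ab spq sab by auto
  have int: "\<not> btw u v x" if "u \<in> P" "v \<in> P" "x \<in> P" "k < col N u" "k < col N v" "col N x \<le> k" for u v x
    using right_interval[of u N "nl c" "nr c" v x k] that k by (simp add: P_def)
  have b_first: "key b < key x" if "x \<in> P" "k < col N x" "x \<noteq> b" for x
    using that by (cases x) (auto simp: b_def gap_right_def P_def)
  \<comment> \<open>A point between \<open>b\<close> and \<open>q\<close> comes before
    \<open>q\<close>, so by minimality its partner also lies right of the gap; and the partner
    cannot lie beyond \<open>q\<close>, since the two would then be separated by the line from
    \<open>q\<close> to \<open>p\<close>.\<close>
  have bq: "btw b q (s y)" if y: "btw b q y" "y \<notin> {a, b, p, q}" for y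
  proof (cases "y \<in> P")
    case True
    have "\<not> col N y \<le> k" using int[of b q y] True y(1) ab qP by auto
    then have coly: "k < col N y" by simp
    have "key y < key q" using y(1) b_first[OF qP] by (auto simp: btw_def)
    then have "y \<notin> Q" using q_min by (meson leD)
    then have colsy: "k < col N (s y)" using True coly y(2) by (auto simp: Q_def)
    have "s y \<noteq> b" "s y \<noteq> q" using y(2) sba ss by (metis insertI1 insertI2 p_def)+
    then have lt: "key b < key (s y)" using b_first sP True colsy by auto
    have "\<not> key q < key (s y)"
    proof
      assume "key q < key (s y)"
      then have "btw y (s y) q" using \<open>key y < key q\<close> by (simp add: btw_def)
      then have "btw y (s y) p" using inv by (simp add: p_def)
      then show False using int[of y "s y" p] True sP coly colsy pP by auto
    qed
    then have "key (s y) < key q" using \<open>s y \<noteq> q\<close> key_inject[of "s y" q] by (simp del: key_inject)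
    then show ?thesis using lt by (simp add: btw_def)
  next
    case False
    then have "s y = y" using sfix by blast
    then show ?thesis using y by simp
  qed
  have bq_iff: "btw b q y \<longleftrightarrow> btw b q (s y)" if y: "y \<notin> {a, b, p, q}" for y
  proof -
    have "s y \<notin> {a, b, p, q}" using y sab sba spq ss by (metis insert_iff empty_iff p_def)
    then show ?thesis using bq[of y] bq[of "s y"] y ss by auto
  qed
  define t where "t = surgery a p s"
  have t: "t a = p" "t p = a" "t b = q" "t q = b" "\<And>x. x \<notin> {a, b, p, q} \<Longrightarrow> t x = s x"
    using sab spq sba ne ab(3) qP(3) by (auto simp: t_def surgery_def p_def[symmetric])
  have planar_t: "planar (Config (nl c) (nr c) t)"
    unfolding t_def s_def
  proof (rule planar_cut[OF pr pl, of a b p q])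
    show "\<not> btw a b y" if "y \<in> pts N (nl c) (nr c)" for y
      unfolding a_def b_def by (rule gap_adjacent[OF that k(2)])
    show "btw b q y \<longleftrightarrow> btw b q (mt c y)" if "y \<notin> {a, b, p, q}" for y
      using bq_iff[OF that] by (simp add: s_def)
    show "\<not> btw b q a" "\<not> btw b q p" using int ab qP pP by auto
  qed (use sab spq ne ab in \<open>auto simp: s_def\<close>)
  have pairing_t: "pairing N (Config (nl c) (nr c) t)"
    unfolding t_def s_def using pr ab pP ne by (intro pairing_surgery) (auto simp: P_def)
  have back_t: "surgery a b t = s"
  proof
    fix x show "surgery a b t x = s x"
      using t sab sba spq ne ab(3) qP(3) by (cases "x \<in> {a, b, p, q}") (auto simp: surgery_def p_def[symmetric])
  qed
  define f where "f u x = (col N x - col N (u x)) + (col N (u x) - col N x)" for u x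
  have split: "sum g P = sum g (P - {a, b, p, q}) + (g a + g b + g p + g q)" for g :: "point \<Rightarrow> nat"
  proof -
    have "sum g {a, b, p, q} = g a + g b + g p + g q" using ne ab(3) qP(3) by (auto simp: add_ac)
    then show ?thesis
      using sum.subset_diff[of "{a, b, p, q}" P g] ab qP pP by (simp add: P_def)
  qed
  have "sum (f t) (P - {a, b, p, q}) = sum (f s) (P - {a, b, p, q})"
    using t(5) by (intro sum.cong) (auto simp: f_def)
  \<comment> \<open>Each new arc stops short of the gap: the two together are shorter by two columns
    than the two old ones, and both ends of every arc are counted.\<close>
  moreover have "f t a + f t b + f t p + f t q < f s a + f s b + f s p + f s q"
    unfolding f_def t(1-4) sab sba spq p_def[symmetric] using ab(4,5) pP(2) qP(2) by auto
  ultimately have "sum (f t) P < sum (f s) P" unfolding split[of "f t"] split[of "f s"] by simp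
  then have "spread N (Config (nl c) (nr c) t) < spread N c"
    by (simp add: spread_def f_def P_def s_def)
  then show thesis
    using that[of p q t] spq ne qP pP t planar_t pairing_t back_t unfolding s_def a_def b_def P_def by blast
qed


section \<open>Factorisation of reduced diagrams\<close>

lemma planar_uncap:
  assumes p: "pairing N c" and pl: "planar c" and st: "mt c u = v" "mt c v = u" "u \<noteq> v"
    and pts: "pts N (nl c) (nr c) = insert u (insert v (pts N l r))" "u \<notin> pts N l r" "v \<notin> pts N l r"
  shows "pairing N (Config l r ((mt c)(u := u, v := v)))" "planar (Config l r ((mt c)(u := u, v := v)))"
proof -
  have eq: "mt c x = y \<longleftrightarrow> x = mt c y" for x y using p by (metis pairing_mt)
  have ne: "mt c x \<noteq> u \<and> mt c x \<noteq> v" if "x \<noteq> u" "x \<noteq> v" for x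
    using that st eq by metis
  show "pairing N (Config l r ((mt c)(u := u, v := v)))"
    using p pts ne unfolding pairing_def by auto
  show "planar (Config l r ((mt c)(u := u, v := v)))"
    unfolding planar_def using pl by (auto simp: planar_def)
qed

lemma spread_uncap:
  assumes "mt c u = v" "mt c v = u" "u \<noteq> v" "col N u = col N v"
    and pts: "pts N (nl c) (nr c) = insert u (insert v (pts N l r))" "u \<notin> pts N l r" "v \<notin> pts N l r"
  shows "spread N (Config l r ((mt c)(u := u, v := v))) = spread N c"
proof -
  let ?f = "\<lambda>s x. (col N x - col N (s x)) + (col N (s x) - col N x)"
  have "sum (?f ((mt c)(u := u, v := v))) (pts N l r) = sum (?f (mt c)) (pts N l r)"
    using pts by (intro sum.cong) auto
  then show ?thesis using assms by (simp add: spread_def)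
qed

text \<open>For an inner gap the cut configuration is already the simpler diagram. At
  \<open>k = 0\<close> only the left side lies left of the gap, so the cut produces a return at its
  top; this return joins adjacent points, since a point enclosed by it would lie on a return of the
  reduced \<open>c\<close>. Deleting it undoes \<open>cap_left\<close> and leaves
  \<open>spread\<close> unchanged, because a return stays in one column. The right side is
  symmetric.\<close>

lemma factor:
  assumes c: "c \<in> reduced_configs N" and k: "k \<le> N" "1 \<le> N" and cup: "cup_at N k c"
  shows "\<exists>d\<in>reduced_configs N. c = ext N k d \<and> \<not> loop_at N k d \<and> spread N d < spread N c"
proof -
  have pr: "pairing N c" and red: "reduced c" and ev: "even (nl c)" "even (nr c)"
    using c by (auto simp: reduced_configs_def planar_config_def)
  obtain p q t where pq: "mt c p = q" "p \<noteq> gap_left k c" "q \<noteq> gap_right N k c" "col N p \<le> k" "k < col N q"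
    and P: "p \<in> pts N (nl c) (nr c)" "q \<in> pts N (nl c) (nr c)"
    and t: "t (gap_left k c) = p" "t p = gap_left k c" "t (gap_right N k c) = q" "t q = gap_right N k c"
    and other: "\<And>x. x \<notin> {gap_left k c, gap_right N k c, p, q} \<Longrightarrow> t x = mt c x"
    and planar_t: "planar (Config (nl c) (nr c) t)" and pairing_t: "pairing N (Config (nl c) (nr c) t)"
    and surg: "surgery (gap_left k c) (gap_right N k c) t = mt c"
    and spr: "spread N (Config (nl c) (nr c) t) < spread N c"
    by (rule exists_cut[OF c k cup]) (rule that)
  let ?t = "Config (nl c) (nr c) t"
  have join_t: "join N k ?t = c"
  proof -
    have "gap_left k ?t = gap_left k c" "gap_right N k ?t = gap_right N k c"
      by (simp_all add: gap_left_def gap_right_def)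
    then show ?thesis by (simp add: join_def surg)
  qed
  have noL: "mt c (Lft i) \<noteq> Lft j" if "i < nl c" for i j
    using red pairing_fix[OF pr, of "Lft i"] that by (auto simp: reduced_def)
  have noR: "mt c (Rgt i) \<noteq> Rgt j" if "i < nr c" for i j
    using red pairing_fix[OF pr, of "Rgt i"] that by (auto simp: reduced_def)
  have btw_t: "btw x (t x) y \<Longrightarrow> btw x (t x) (t y)" for x y
    using planar_t by (simp add: planar_def)
  have colb: "col N (gap_right N k c) = Suc k" "col N (gap_left k c) = k"
    by (auto simp: gap_left_def gap_right_def)
  have fixL: "i = j" if "t (Lft i) = Lft j" "Lft i \<notin> {gap_left k c, p}" for i j
  proof -
    have "Lft i \<noteq> gap_right N k c" "Lft i \<noteq> q" using pq(5) by (auto simp: gap_right_def)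
    then have "mt c (Lft i) = Lft j" using other[of "Lft i"] that by auto
    then show ?thesis using red by (simp add: reduced_def)
  qed
  have fixR: "i = j" if "t (Rgt i) = Rgt j" "Rgt i \<notin> {gap_right N k c, q}" for i j
  proof -
    have "Rgt i \<noteq> gap_left k c" "Rgt i \<noteq> p" using pq(4) k by (auto simp: gap_left_def)
    then have "mt c (Rgt i) = Rgt j" using other[of "Rgt i"] that by auto
    then show ?thesis using red by (simp add: reduced_def)
  qed
  consider "k = 0" | "k = N" "k \<noteq> 0" | "0 < k" "k < N" using k by linarith
  then show ?thesis
  proof cases
    case 1
    then obtain j where j: "p = Lft j" "j < nl c" using pq(4) P by (cases p) auto
    have j1: "j \<noteq> nl c - 1" using pq(2) j 1 by (auto simp: gap_left_def)
    have "j = nl c - 2"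
    proof (rule ccontr)
      assume "j \<noteq> nl c - 2"
      then have "j < nl c - 2" using j j1 by simp
      moreover have tp: "t p = Lft (nl c - 1)" using t(2) 1 by (simp add: gap_left_def)
      ultimately have "btw p (t p) (Lft (nl c - 2))" using j by (auto simp: btw_def)
      then have "btw p (t p) (t (Lft (nl c - 2)))" by (rule btw_t)
      then have "btw p (Lft (nl c - 1)) (t (Lft (nl c - 2)))" by (simp only: tp)
      then obtain i where i: "t (Lft (nl c - 2)) = Lft i"
        unfolding j(1) by (cases "t (Lft (nl c - 2))") (auto simp: btw_def)
      have "Lft (nl c - 2) \<notin> {gap_left k c, p}" using j j1 \<open>j \<noteq> nl c - 2\<close> 1 by (auto simp: gap_left_def)
      moreover have "Lft (nl c - 2) \<noteq> gap_right N k c" "Lft (nl c - 2) \<noteq> q" using pq(5) by (auto simp: gap_right_def)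
      ultimately have "mt c (Lft (nl c - 2)) = Lft i" using other i by auto
      then show False using noL[of "nl c - 2"] j by auto
    qed
    then have n: "2 \<le> nl c" "p = Lft (nl c - 2)" "gap_left k c = Lft (nl c - 1)"
      using j j1 1 by (auto simp: gap_left_def)
    let ?d = "Config (nl c - 2) (nr c) (t(Lft (nl c - 2) := Lft (nl c - 2), Lft (nl c - 1) := Lft (nl c - 1)))"
    have tt: "t (Lft (nl c - 2)) = Lft (nl c - 1)" "t (Lft (nl c - 1)) = Lft (nl c - 2)" using t n by auto
    have pts: "pts N (nl c) (nr c) = insert (Lft (nl c - 2)) (insert (Lft (nl c - 1)) (pts N (nl c - 2) (nr c)))"
    proof (intro Set.set_eqI)
      fix x show "x \<in> pts N (nl c) (nr c) \<longleftrightarrow> x \<in> insert (Lft (nl c - 2)) (insert (Lft (nl c - 1)) (pts N (nl c - 2) (nr c)))"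
        using n(1) by (cases x) auto
    qed
    have "pairing N ?d" "planar ?d"
      using planar_uncap[OF pairing_t planar_t, of "Lft (nl c - 2)" "Lft (nl c - 1)" "nl c - 2" "nr c"] tt pts n(1) by auto
    moreover have "reduced ?d"
    proof -
      have "Rgt i \<notin> {gap_right N k c, q}" if "t (Rgt i) = Rgt j" for i j
      proof
        assume "Rgt i \<in> {gap_right N k c, q}"
        then have "Rgt i = q" using 1 k by (auto simp: gap_right_def)
        then show False using t(4) that 1 k by (simp add: gap_right_def)
      qed
      then show ?thesis
        using fixL fixR n(2,3) unfolding reduced_def by auto
    qed
    ultimately have d: "?d \<in> reduced_configs N"
      using ev n(1) by (simp add: reduced_configs_def planar_config_def)
    have "cap N k ?d = ?t"
    proof -
      have "Suc (Suc (nl c - 2)) = nl c" "Suc (nl c - 2) = nl c - 1" using n(1) by auto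
      then show ?thesis using tt 1 by (auto simp: cap_def cap_left_def fun_eq_iff)
    qed
    then have "c = ext N k ?d" using join_t by (simp add: ext_def)
    moreover have "spread N ?d = spread N ?t"
      using spread_uncap[of ?t "Lft (nl c - 2)" "Lft (nl c - 1)" N "nl c - 2" "nr c"] tt pts n(1) by auto
    ultimately show ?thesis using d spr 1 by (intro bexI[of _ ?d]) (auto simp: loop_at_def)
  next
    case 2
    then obtain j where j: "q = Rgt j" "j < nr c" using pq(5) P by (cases q) auto
    have j1: "j \<noteq> nr c - 1" using pq(3) j 2 by (auto simp: gap_right_def)
    have "j = nr c - 2"
    proof (rule ccontr)
      assume "j \<noteq> nr c - 2"
      then have "j < nr c - 2" using j j1 by simp
      moreover have tp: "t q = Rgt (nr c - 1)" using t(4) 2 by (simp add: gap_right_def)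
      ultimately have "btw q (t q) (Rgt (nr c - 2))" using j by (auto simp: btw_def)
      then have "btw q (t q) (t (Rgt (nr c - 2)))" by (rule btw_t)
      then have "btw q (Rgt (nr c - 1)) (t (Rgt (nr c - 2)))" by (simp only: tp)
      then obtain i where i: "t (Rgt (nr c - 2)) = Rgt i"
        unfolding j(1) by (cases "t (Rgt (nr c - 2))") (auto simp: btw_def)
      have "Rgt (nr c - 2) \<notin> {gap_right N k c, q}" using j j1 \<open>j \<noteq> nr c - 2\<close> 2 by (auto simp: gap_right_def)
      moreover have "Rgt (nr c - 2) \<noteq> gap_left k c" "Rgt (nr c - 2) \<noteq> p" using pq(4) k by (auto simp: gap_left_def)
      ultimately have "mt c (Rgt (nr c - 2)) = Rgt i" using other i by auto
      then show False using noR[of "nr c - 2"] j by auto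
    qed
    then have n: "2 \<le> nr c" "q = Rgt (nr c - 2)" "gap_right N k c = Rgt (nr c - 1)"
      using j j1 2 by (auto simp: gap_right_def)
    let ?d = "Config (nl c) (nr c - 2) (t(Rgt (nr c - 2) := Rgt (nr c - 2), Rgt (nr c - 1) := Rgt (nr c - 1)))"
    have tt: "t (Rgt (nr c - 2)) = Rgt (nr c - 1)" "t (Rgt (nr c - 1)) = Rgt (nr c - 2)" using t n by auto
    have pts: "pts N (nl c) (nr c) = insert (Rgt (nr c - 2)) (insert (Rgt (nr c - 1)) (pts N (nl c) (nr c - 2)))"
    proof (intro Set.set_eqI)
      fix x show "x \<in> pts N (nl c) (nr c) \<longleftrightarrow> x \<in> insert (Rgt (nr c - 2)) (insert (Rgt (nr c - 1)) (pts N (nl c) (nr c - 2)))"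
        using n(1) by (cases x) auto
    qed
    have "pairing N ?d" "planar ?d"
      using planar_uncap[OF pairing_t planar_t, of "Rgt (nr c - 2)" "Rgt (nr c - 1)" "nl c" "nr c - 2"] tt pts n(1) by auto
    moreover have "reduced ?d"
    proof -
      have "Lft i \<notin> {gap_left k c, p}" if "t (Lft i) = Lft j" for i j
      proof
        assume "Lft i \<in> {gap_left k c, p}"
        then have "Lft i = p" using 2 by (auto simp: gap_left_def)
        then show False using t(2) that 2 by (simp add: gap_left_def)
      qed
      then show ?thesis
        using fixL fixR n(2,3) unfolding reduced_def by auto
    qed
    ultimately have d: "?d \<in> reduced_configs N"
      using ev n(1) by (simp add: reduced_configs_def planar_config_def)
    have "cap N k ?d = ?t"
    proof -
      have "Suc (Suc (nr c - 2)) = nr c" "Suc (nr c - 2) = nr c - 1" using n(1) by auto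
      then show ?thesis using tt 2 by (auto simp: cap_def cap_right_def fun_eq_iff)
    qed
    then have "c = ext N k ?d" using join_t by (simp add: ext_def)
    moreover have "spread N ?d = spread N ?t"
      using spread_uncap[of ?t "Rgt (nr c - 2)" "Rgt (nr c - 1)" N "nl c" "nr c - 2"] tt pts n(1) by auto
    ultimately show ?thesis using d spr 2 by (intro bexI[of _ ?d]) (auto simp: loop_at_def)
  next
    case 3
    have "Lft i \<notin> {gap_left k c, p}" if "t (Lft i) = Lft j" for i j
    proof
      assume "Lft i \<in> {gap_left k c, p}"
      then have "Lft i = p" using 3 by (auto simp: gap_left_def)
      then show False using t(2) that 3 by (simp add: gap_left_def)
    qed
    moreover have "Rgt i \<notin> {gap_right N k c, q}" if "t (Rgt i) = Rgt j" for i j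
    proof
      assume "Rgt i \<in> {gap_right N k c, q}"
      then have "Rgt i = q" using 3 by (auto simp: gap_right_def)
      then show False using t(4) that 3 by (simp add: gap_right_def)
    qed
    ultimately have "reduced ?t" using fixL fixR unfolding reduced_def by auto
    then have "?t \<in> reduced_configs N"
      using pairing_t planar_t ev by (simp add: reduced_configs_def planar_config_def)
    moreover have "c = ext N k ?t" using join_t 3 by (simp add: ext_def cap_def)
    moreover have "\<not> loop_at N k ?t"
      using t(1) pq(4) colb 3 by (auto simp: loop_at_def gap_left_def)
    ultimately show ?thesis using spr by blast
  qed
qed

lemma id_in_reduced_configs: "id_config N \<in> reduced_configs N"
proof -
  have "btw x (mt (id_config N) x) y \<Longrightarrow> btw x (mt (id_config N) x) (mt (id_config N) y)" for x y
    by (cases x; cases y) (auto simp: id_config_def btw_def split: if_splits)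
  then show ?thesis
    using pairing_id_config
    by (auto simp: reduced_configs_def planar_config_def planar_def reduced_def id_config_def)
qed

text \<open>Multiplication by a reduced diagram is the action of any word that arises from peeling off cups.\<close>

lemma reduced_config_word:
  assumes "b \<in> reduced_configs N" "1 \<le> N"
  shows "\<exists>u\<in>lists {0..N}. act N (id_config N) u = (1, b) \<and>
    (\<forall>a\<in>reduced_configs N. \<exists>c. stacks_to N a b c \<and> planar_config N c \<and> nf N c = snd (act N a u) \<and>
       compose N (diagram_of a) (diagram_of b) = (fst (act N a u), diagram_of (snd (act N a u))))"
  using assms(1)
proof (induction "spread N b" arbitrary: b rule: less_induct)
  case less
  show ?case
  proof (cases "b = id_config N")
    case True
    have "\<exists>c. stacks_to N a b c \<and> planar_config N c \<and> nf N c = a \<and>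
       compose N (diagram_of a) (diagram_of b) = (1, diagram_of a)" if a: "a \<in> reduced_configs N" for a
    proof -
      have p: "pairing N a" "planar_config N a" "reduced a"
        using a by (auto simp: reduced_configs_def planar_config_def)
      have n: "nf N a = a" using nf_reduced p by blast
      have "compose N (diagram_of a) (diagram_of b) = (1, diagram_of a)"
        using compose_stacks_to[OF stacks_to_id(1)[OF p(1)]] stacks_to_id(2)[OF p(1)] weight_reduced[OF p(3)] n True
        by simp
      then show ?thesis using True stacks_to_id(1)[OF p(1)] p n by blast
    qed
    then show ?thesis using True by (intro bexI[of _ "[]"]) auto
  next
    case False
    then obtain k where k: "k \<le> N" "cup_at N k b" using exists_cup[OF less.prems assms(2)] by blast
    from factor[OF less.prems k(1) assms(2) k(2)] obtain d where
      d: "d \<in> reduced_configs N" "b = ext N k d" "\<not> loop_at N k d" "spread N d < spread N b" by blast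
    from less.hyps[OF d(4,1)] obtain u where u: "u \<in> lists {0..N}" "act N (id_config N) u = (1, d)"
      "\<And>a. a \<in> reduced_configs N \<Longrightarrow> \<exists>c. stacks_to N a d c \<and> planar_config N c \<and> nf N c = snd (act N a u) \<and>
       compose N (diagram_of a) (diagram_of d) = (fst (act N a u), diagram_of (snd (act N a u)))" by blast
    have b: "pairing N b" "reduced b" using less.prems by (auto simp: reduced_configs_def planar_config_def)
    \<comment> \<open>Building up the reduced \<open>b\<close> again closes no loop and leaves no
      return, so no scalar arises.\<close>
    have "act1 N k d = (1, b)"
      using d(2,3) weight_reduced[OF b(2)] nf_reduced[OF b] by (simp add: act1_def)
    then have "act N (id_config N) (u @ [k]) = (1, b)"
      using u(2) by (intro prod_eqI) (simp_all add: act_append)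
    moreover have "\<exists>c. stacks_to N a b c \<and> planar_config N c \<and> nf N c = snd (act N a (u @ [k])) \<and>
       compose N (diagram_of a) (diagram_of b) = (fst (act N a (u @ [k])), diagram_of (snd (act N a (u @ [k]))))"
      if a: "a \<in> reduced_configs N" for a
    proof -
      obtain c where c: "stacks_to N a d c" "planar_config N c" "nf N c = snd (act N a u)"
        "compose N (diagram_of a) (diagram_of d) = (fst (act N a u), diagram_of (snd (act N a u)))"
        using u(3)[OF a] by blast
      have p: "pairing N c" using c(1) by (simp add: stacks_to_def)
      have "stacks_to N a b (ext N k c)" unfolding d(2) by (rule stacks_to_ext(1)[OF c(1) k(1) assms(2) d(3)])
      moreover have "planar_config N (ext N k c)" by (rule planar_config_ext[OF c(2) k(1) assms(2)])
      moreover have "nf N (ext N k c) = snd (act N a (u @ [k]))"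
        using nf_ext_nf[OF p k(1) assms(2)] c(3) by (simp add: act_append act1_def)
      moreover have "compose N (diagram_of a) (diagram_of b) = (fst (act N a (u @ [k])), diagram_of (snd (act N a (u @ [k]))))"
        unfolding d(2) compose_ext[OF c(1,2) k(1) assms(2) d(3)] c(3,4) by (simp add: act_append)
      ultimately show ?thesis by blast
    qed
    moreover have "u @ [k] \<in> lists {0..N}" using u(1) k(1) by simp
    ultimately show ?thesis by blast
  qed
qed


section \<open>The relations\<close>

text \<open>Joining \<open>b\<close> to \<open>c\<close> hands the old partner of \<open>c\<close>
  over to \<open>a\<close>, the old partner of \<open>b\<close>. Joining \<open>a\<close> to
  \<open>b\<close> again releases \<open>c\<close> and its old partner to each other.\<close>

lemma surgery_braid:
  assumes inv: "\<And>x. s (s x) = x" and "s a = b" "a \<noteq> b" "c \<noteq> a" "c \<noteq> b" "s c \<noteq> c"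
  shows "surgery a b (surgery b c s) = s" "surgery a b (surgery c a s) = s"
    "surgery b c s a \<noteq> b" "surgery c a s a \<noteq> b"
proof -
  have sb: "s b = a" and z: "s c \<noteq> a" "s c \<noteq> b" using assms by metis+
  show "surgery a b (surgery b c s) = s" "surgery a b (surgery c a s) = s"
    using assms(2-) sb z inv by (auto simp: surgery_def fun_eq_iff)
  show "surgery b c s a \<noteq> b" "surgery c a s a \<noteq> b"
    using assms(2-) sb z by (auto simp: surgery_def)
qed

lemma surgery_commute:
  assumes inv: "\<And>x. s (s x) = x" and fx: "s a \<noteq> a" "s b \<noteq> b" "s c \<noteq> c" "s d \<noteq> d"
    and ne: "a \<noteq> b" "a \<noteq> c" "a \<noteq> d" "b \<noteq> c" "b \<noteq> d" "c \<noteq> d"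
  shows "surgery a b (surgery c d s) = surgery c d (surgery a b s)"
proof -
  have eq: "s x = y \<longleftrightarrow> x = s y" for x y using inv by metis
  have inj: "s x = s y \<longleftrightarrow> x = y" for x y using inv by metis
  show ?thesis
  proof
    fix x
    show "surgery a b (surgery c d s) x = surgery c d (surgery a b s) x"
      unfolding surgery_def
      using ne fx inv[of a] inv[of b] inv[of c] inv[of d] inv[of x]
      by (smt (verit, best))
  qed
qed

text \<open>Both sides count the loops closed by the two caps together. A loop through one cap is
  closed by that cap in either order, a loop through both by whichever comes last.\<close>

lemma surgery_loops_commute:
  assumes inv: "\<And>x. s (s x) = x" and fx: "s a \<noteq> a" "s b \<noteq> b" "s c \<noteq> c" "s d \<noteq> d"
    and ne: "a \<noteq> b" "a \<noteq> c" "a \<noteq> d" "b \<noteq> c" "b \<noteq> d" "c \<noteq> d"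
  shows "of_bool (s a = b) + of_bool (surgery a b s c = d) = (of_bool (s c = d) + of_bool (surgery c d s a = b) :: nat)"
  using ne fx inv[of a] inv[of b] inv[of c] inv[of d] unfolding surgery_def
  by (smt (verit, best) of_bool_eq add.commute)

section \<open>Removal of a return between adjacent points\<close>

fun shift_left :: "nat \<Rightarrow> point \<Rightarrow> point" where
  "shift_left m (Lft i) = Lft (if i < m then i else i + 2)"
| "shift_left m x = x"

fun shift_right :: "nat \<Rightarrow> point \<Rightarrow> point" where
  "shift_right m (Rgt i) = Rgt (if i < m then i else i + 2)"
| "shift_right m x = x"

lemma rank_shift:
  assumes "i < n" "m \<le> n" "S = {..<n + 2} - {m, Suc m}"
  shows "rank S (if i < m then i else i + 2) = i" "card S = n"
proof -
  show "card S = n" using assms(2) unfolding assms(3) by (subst card_Diff_subset) auto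
  show "rank S (if i < m then i else i + 2) = i"
  proof (cases "i < m")
    case True
    then have e: "{..<i} - S = {}" using assms by auto
    show ?thesis using True rank_add_removed[of S i] unfolding e by simp
  next
    case False
    then have "{..<i + 2} - S = {m, Suc m}" using assms by auto
    then have "card ({..<i + 2} - S) = 2" by (simp only:) simp
    then show ?thesis using False rank_add_removed[of S "i + 2"] by simp
  qed
qed

lemma rank_id: "i \<le> n \<Longrightarrow> rank {..<n} i = i"
  using rank_add_removed[of "{..<n}" i] by (auto simp: Diff_eq_empty_iff[THEN iffD2])

text \<open>Exactly \<open>m\<close> points lie below the return, so it is odd if and only if
  \<open>m\<close> is. The points above it move down by two, which preserves all other
  parities.\<close>

lemma remove_adjacent_left:
  assumes p: "pairing N c'" "pairing N c" and n: "nl c' = nl c + 2" "nr c' = nr c" "m \<le> nl c"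
    and m: "mt c' (Lft m) = Lft (Suc m)"
    and sh: "\<And>x. x \<in> pts N (nl c) (nr c) \<Longrightarrow> mt c' (shift_left m x) = shift_left m (mt c x)"
  shows "nf N c' = nf N c" "weight c' = (if odd m then indet S1 else 1) * weight c"
proof -
  let ?S = "{..<nl c + 2} - {m, Suc m}" and ?T = "{..<nr c}"
  note r = rank_shift[of _ "nl c" m ?S, OF _ n(3) refl]
  have ren: "ren ?S ?T (shift_left m x) = x" if "x \<in> pts N (nl c) (nr c)" for x
    using that r(1) rank_id[of _ "nr c"] by (cases x) auto
  have kept: "\<exists>y\<in>pts N (nl c) (nr c). x = shift_left m y" if x: "x \<in> kept_pts N ?S ?T" for x
  proof (cases x)
    case (Lft i)
    then have "i < nl c + 2" "i \<noteq> m" "i \<noteq> Suc m" using x by auto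
    then have "Lft (if i < m then i else i - 2) \<in> pts N (nl c) (nr c)"
      "x = shift_left m (Lft (if i < m then i else i - 2))" using Lft n(3) by auto
    then show ?thesis by blast
  qed (use x in \<open>auto intro!: bexI[of _ x]\<close>)
  have m': "mt c' (Lft (Suc m)) = Lft m" using m p(1) by (metis pairing_mt)
  have "removes N ?S ?T c' c"
    unfolding removes_def
  proof (intro conjI ballI allI impI)
    fix x assume "x \<in> kept_pts N ?S ?T"
    then obtain y where y: "y \<in> pts N (nl c) (nr c)" "x = shift_left m y" using kept by blast
    then show "mt c (ren ?S ?T x) = ren ?S ?T (mt c' x)"
      using ren[of y] ren[of "mt c y"] sh[of y] pairing_mt_pts[OF p(2)] by simp
  next
    fix i assume "i < nl c'" "i \<notin> ?S"
    then have "i = m \<or> i = Suc m" using n by auto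
    then show "mt c' (Lft i) \<in> Lft ` (- ?S)" using m m' by auto
  qed (use p n r(2) in auto)
  note rem = this
  show "nf N c' = nf N c" by (rule nf_removes[OF rem])
  have "odds_left c' - ?S = (if odd m then {m} else {})"
  proof -
    have "odds_left c' \<subseteq> {..<nl c + 2}" using odds_bounds[OF p(1)] n by simp
    then have "odds_left c' - ?S = odds_left c' \<inter> {m, Suc m}" using n(3) by auto
    then show ?thesis using m m' by (auto simp: odds_left_def)
  qed
  moreover have "card (odds_right c' - ?T) = 0"
  proof -
    have "odds_right c' - ?T = {}" using odds_bounds[OF p(1)] n by auto
    then show ?thesis by (simp only: card.empty)
  qed
  moreover have "even (rank ?S i) \<longleftrightarrow> even i" if i: "i \<in> ?S" for i
  proof -
    have "\<exists>j<nl c. i = (if j < m then j else j + 2)"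
      using i n(3) by (intro exI[of _ "if i < m then i else i - 2"]) auto
    then obtain j where j: "j < nl c" "i = (if j < m then j else j + 2)" by blast
    then show ?thesis using r(1)[OF j(1)] by (simp split: if_splits)
  qed
  moreover have "even (rank ?T i) \<longleftrightarrow> even i" if "i \<in> ?T" for i using that rank_id[of i "nr c"] by simp
  ultimately show "weight c' = (if odd m then indet S1 else 1) * weight c"
    using card_odds_removes[OF rem] by (simp add: weight_def mult.assoc)
qed

lemma remove_adjacent_right:
  assumes p: "pairing N c'" "pairing N c" and n: "nl c' = nl c" "nr c' = nr c + 2" "m \<le> nr c"
    and m: "mt c' (Rgt m) = Rgt (Suc m)"
    and sh: "\<And>x. x \<in> pts N (nl c) (nr c) \<Longrightarrow> mt c' (shift_right m x) = shift_right m (mt c x)"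
  shows "nf N c' = nf N c" "weight c' = (if odd m then indet S2 else 1) * weight c"
proof -
  let ?S = "{..<nl c}" and ?T = "{..<nr c + 2} - {m, Suc m}"
  note r = rank_shift[of _ "nr c" m ?T, OF _ n(3) refl]
  have ren: "ren ?S ?T (shift_right m x) = x" if "x \<in> pts N (nl c) (nr c)" for x
    using that r(1) rank_id[of _ "nl c"] by (cases x) auto
  have kept: "\<exists>y\<in>pts N (nl c) (nr c). x = shift_right m y" if x: "x \<in> kept_pts N ?S ?T" for x
  proof (cases x)
    case (Rgt i)
    then have "i < nr c + 2" "i \<noteq> m" "i \<noteq> Suc m" using x by auto
    then have "Rgt (if i < m then i else i - 2) \<in> pts N (nl c) (nr c)"
      "x = shift_right m (Rgt (if i < m then i else i - 2))" using Rgt n(3) by auto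
    then show ?thesis by blast
  qed (use x in \<open>auto intro!: bexI[of _ x]\<close>)
  have m': "mt c' (Rgt (Suc m)) = Rgt m" using m p(1) by (metis pairing_mt)
  have "removes N ?S ?T c' c"
    unfolding removes_def
  proof (intro conjI ballI allI impI)
    fix x assume "x \<in> kept_pts N ?S ?T"
    then obtain y where y: "y \<in> pts N (nl c) (nr c)" "x = shift_right m y" using kept by blast
    then show "mt c (ren ?S ?T x) = ren ?S ?T (mt c' x)"
      using ren[of y] ren[of "mt c y"] sh[of y] pairing_mt_pts[OF p(2)] by simp
  next
    fix i assume "i < nr c'" "i \<notin> ?T"
    then have "i = m \<or> i = Suc m" using n by auto
    then show "mt c' (Rgt i) \<in> Rgt ` (- ?T)" using m m' by auto
  qed (use p n r(2) in auto)
  note rem = this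
  show "nf N c' = nf N c" by (rule nf_removes[OF rem])
  have "odds_right c' - ?T = (if odd m then {m} else {})"
  proof -
    have "odds_right c' \<subseteq> {..<nr c + 2}" using odds_bounds[OF p(1)] n by simp
    then have "odds_right c' - ?T = odds_right c' \<inter> {m, Suc m}" using n(3) by auto
    then show ?thesis using m m' by (auto simp: odds_right_def)
  qed
  moreover have "card (odds_left c' - ?S) = 0"
  proof -
    have "odds_left c' - ?S = {}" using odds_bounds[OF p(1)] n by auto
    then show ?thesis by (simp only: card.empty)
  qed
  moreover have "even (rank ?T i) \<longleftrightarrow> even i" if i: "i \<in> ?T" for i
  proof -
    have "\<exists>j<nr c. i = (if j < m then j else j + 2)"
      using i n(3) by (intro exI[of _ "if i < m then i else i - 2"]) auto
    then obtain j where j: "j < nr c" "i = (if j < m then j else j + 2)" by blast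
    then show ?thesis using r(1)[OF j(1)] by (simp split: if_splits)
  qed
  moreover have "even (rank ?S i) \<longleftrightarrow> even i" if "i \<in> ?S" for i using that rank_id[of i "nl c"] by simp
  ultimately show "weight c' = (if odd m then indet S2 else 1) * weight c"
    using card_odds_removes[OF rem] by (simp add: weight_def mult_ac)
qed

text \<open>The added return has all previous points of its side below it, an even number, so it
  disappears without a factor. This is why the braid relation through \<open>e_0\<close> or
  \<open>e_N\<close> has coefficient 1.\<close>

lemma nf_cap:
  assumes "planar_config N c"
  shows "nf N (cap N k c) = nf N c \<and> weight (cap N k c) = weight c"
proof -
  have p: "pairing N c" and ev: "even (nl c)" "even (nr c)" using assms by (auto simp: planar_config_def)
  have pt: "mt c x \<in> pts N (nl c) (nr c)" if "x \<in> pts N (nl c) (nr c)" for x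
    using that pairing_mt_pts[OF p] by simp
  have idl: "shift_left (nl c) x = x" and idr: "shift_right (nr c) x = x" if "x \<in> pts N (nl c) (nr c)" for x
    using that by (cases x; simp)+
  have "mt (cap_left c) (shift_left (nl c) x) = shift_left (nl c) (mt c x)"
    "mt (cap_right c) (shift_right (nr c) x) = shift_right (nr c) (mt c x)" if "x \<in> pts N (nl c) (nr c)" for x
    using that by (auto simp: idl[OF that] idl[OF pt[OF that]] idr[OF that] idr[OF pt[OF that]]
        cap_left_def cap_right_def)
  note sh = this
  have "nf N (cap_left c) = nf N c \<and> weight (cap_left c) = weight c"
    using remove_adjacent_left[OF pairing_cap_left[OF p] p _ _ _ _ sh(1)] ev by (simp add: cap_left_def)
  moreover have "nf N (cap_right c) = nf N c \<and> weight (cap_right c) = weight c"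
    using remove_adjacent_right[OF pairing_cap_right[OF p] p _ _ _ _ sh(2)] ev by (simp add: cap_right_def)
  ultimately show ?thesis by (simp add: cap_def)
qed

text \<open>The cup at the corner ends in the left point \<open>n = nl E - 1\<close>, and
  \<open>n\<close> is odd since \<open>nl E\<close> is even. A second \<open>e_0\<close> moves that
  line to the new topmost point and leaves a return between \<open>n\<close> and
  \<open>n + 1\<close>: an odd one, hence the factor \<open>indet S1\<close>.\<close>

lemma ext_square_left:
  assumes E: "planar_config N E" and cup: "cup_at N 0 E" and N: "1 \<le> N"
  shows "nf N (ext N 0 E) = nf N E" "weight (ext N 0 E) = indet S1 * weight E"
proof -
  have p: "pairing N E" and ev: "even (nl E)" using E by (auto simp: planar_config_def)
  define n where "n = nl E - 1"
  have n: "nl E = Suc n" "odd n" using cup ev by (auto simp: cup_at_def n_def)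
  have top: "mt E (Lft n) = Top 0" "mt E (Top 0) = Lft n"
    using cup N pairing_mt[OF p] by (auto simp: cup_at_def gap_left_def gap_right_def n_def) (metis pairing_mt[OF p])
  have ne: "mt E x \<noteq> Lft n" "mt E x \<noteq> Top 0" if "x \<noteq> Lft n" "x \<noteq> Top 0" for x
    using that top pairing_mt[OF p] by metis+
  have mt: "mt (ext N 0 E) x = (if x = Lft (n + 2) then Top 0 else if x = Top 0 then Lft (n + 2) else
     if x = Lft (Suc n) then Lft n else if x = Lft n then Lft (Suc n) else mt E x)" for x
    using N n top by (auto simp: ext_def join_def cap_def cap_left_def gap_left_def gap_right_def surgery_def)
  have sh: "mt (ext N 0 E) (shift_left n x) = shift_left n (mt E x)" if x: "x \<in> pts N (nl E) (nr E)" for x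
  proof (cases "x = Lft n \<or> x = Top 0")
    case True
    then show ?thesis using top mt by auto
  next
    case False
    have "shift_left n y = y" if "y \<in> pts N (nl E) (nr E)" "y \<noteq> Lft n" for y
      using that n by (cases y) auto
    then have "shift_left n x = x" "shift_left n (mt E x) = mt E x"
      using False x ne pairing_mt_pts[OF p] by auto
    moreover have "x \<noteq> Lft (Suc n)" "x \<noteq> Lft (n + 2)" using x n by auto
    ultimately show ?thesis using mt[of x] False by simp
  qed
  have "nl (ext N 0 E) = nl E + 2" "nr (ext N 0 E) = nr E" using N by (auto simp: ext_nl_nr)
  from remove_adjacent_left[OF pairing_ext[OF p _ N] p this _ _ sh] n mt
  show "nf N (ext N 0 E) = nf N E" "weight (ext N 0 E) = indet S1 * weight E" by auto
qed

lemma ext_square_right: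
  assumes E: "planar_config N E" and cup: "cup_at N N E" and N: "1 \<le> N"
  shows "nf N (ext N N E) = nf N E" "weight (ext N N E) = indet S2 * weight E"
proof -
  have p: "pairing N E" and ev: "even (nr E)" using E by (auto simp: planar_config_def)
  define n where "n = nr E - 1"
  have n: "nr E = Suc n" "odd n" using cup ev by (auto simp: cup_at_def n_def)
  let ?t = "Top (N - 1)"
  have top: "mt E (Rgt n) = ?t" "mt E ?t = Rgt n"
    using cup N pairing_mt[OF p] by (auto simp: cup_at_def gap_left_def gap_right_def n_def) (metis pairing_mt[OF p])
  have ne: "mt E x \<noteq> Rgt n" "mt E x \<noteq> ?t" if "x \<noteq> Rgt n" "x \<noteq> ?t" for x
    using that top pairing_mt[OF p] by metis+
  have mt: "mt (ext N N E) x = (if x = Rgt (n + 2) then ?t else if x = ?t then Rgt (n + 2) else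
     if x = Rgt (Suc n) then Rgt n else if x = Rgt n then Rgt (Suc n) else mt E x)" for x
    using N n top by (auto simp: ext_def join_def cap_def cap_right_def gap_left_def gap_right_def surgery_def)
  have sh: "mt (ext N N E) (shift_right n x) = shift_right n (mt E x)" if x: "x \<in> pts N (nl E) (nr E)" for x
  proof (cases "x = Rgt n \<or> x = ?t")
    case True
    then show ?thesis using top mt by auto
  next
    case False
    have "shift_right n y = y" if "y \<in> pts N (nl E) (nr E)" "y \<noteq> Rgt n" for y
      using that n by (cases y) auto
    then have "shift_right n x = x" "shift_right n (mt E x) = mt E x"
      using False x ne pairing_mt_pts[OF p] by auto
    moreover have "x \<noteq> Rgt (Suc n)" "x \<noteq> Rgt (n + 2)" using x n by auto
    ultimately show ?thesis using mt[of x] False by simp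
  qed
  have "nl (ext N N E) = nl E" "nr (ext N N E) = nr E + 2" using N by (auto simp: ext_nl_nr)
  from remove_adjacent_right[OF pairing_ext[OF p _ N] p this _ _ sh] n mt
  show "nf N (ext N N E) = nf N E" "weight (ext N N E) = indet S2 * weight E" by auto
qed

lemma cup_at_ext: "k \<le> N \<Longrightarrow> 1 \<le> N \<Longrightarrow> cup_at N k (ext N k c)"
  by (auto simp: cup_at_def ext_def join_def cap_def cap_left_def cap_right_def gap_left_def gap_right_def surgery_def)

lemma ext_square_inner:
  assumes "pairing N E" "cup_at N k E" "0 < k" "k < N"
  shows "ext N k E = E" "loop_at N k E"
proof -
  have "mt E (gap_left k E) = gap_right N k E" using assms(2) by (simp add: cup_at_def)
  then have "surgery (gap_left k E) (gap_right N k E) (mt E) = mt E"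
    using assms(1) by (intro surgery_trivial) auto
  then show "ext N k E = E" using assms(3,4) by (simp add: ext_def join_def cap_def)
  show "loop_at N k E"
    using assms by (simp add: cup_at_def loop_at_def gap_left_def gap_right_def)
qed

text \<open>A zigzag is pulled straight: \<open>E\<close> is recovered up to the return that
  \<open>cap\<close> adds if \<open>j\<close> is \<open>0\<close> or \<open>N\<close>. No loop
  closes, since the gaps \<open>i\<close> and \<open>j\<close> share only one point.\<close>

lemma ext_braid:
  assumes p: "pairing N E" and cup: "cup_at N i E" and i: "0 < i" "i < N" and j: "j = Suc i \<or> i = Suc j"
  shows "ext N i (ext N j E) = cap N j E" "\<not> loop_at N j E" "\<not> loop_at N i (ext N j E)"
proof -
  have jN: "j \<le> N" "1 \<le> N" using i j by auto
  define F where "F = cap N j E"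
  have pF: "pairing N F" using pairing_cap[OF p] by (simp add: F_def)
  let ?a = "Top (i - 1)" and ?b = "Top i"
  have "mt E ?a = ?b" using cup i by (simp add: cup_at_def gap_left_def gap_right_def)
  then have ab: "mt F ?a = ?b" by (auto simp: F_def cap_def cap_left_def cap_right_def)
  have extj: "ext N j E = join N j F" by (simp add: ext_def F_def)
  \<comment> \<open>The point of gap \<open>j\<close> that does not belong to gap
    \<open>i\<close>.\<close>
  define c where "c = (if j = Suc i then gap_right N j F else gap_left j F)"
  have c: "c \<in> pts N (nl F) (nr F)" 
    using gap_in_pts(1,2)[OF jN, of E] unfolding c_def F_def by presburger
  then have "mt F c \<noteq> c" using pairing_fix[OF pF] by blast
  moreover have "c \<noteq> ?a" "c \<noteq> ?b" using i j by (auto simp: c_def gap_left_def gap_right_def)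
  moreover have "?a \<noteq> ?b" using i by simp
  ultimately have br: "surgery ?a ?b (surgery ?b c (mt F)) = mt F" "surgery ?a ?b (surgery c ?a (mt F)) = mt F"
    "surgery ?b c (mt F) ?a \<noteq> ?b" "surgery c ?a (mt F) ?a \<noteq> ?b" and ne: "c \<noteq> ?a" "c \<noteq> ?b" "?a \<noteq> ?b"
    using surgery_braid[of "mt F" ?a ?b c] pairing_mt[OF pF] ab by auto
  have mtj: "mt (ext N j E) = (if j = Suc i then surgery ?b c (mt F) else surgery c ?a (mt F))"
    unfolding extj join_def using i j by (auto simp: c_def gap_left_def gap_right_def)
  have gi: "gap_left i G = ?a" "gap_right N i G = ?b" for G using i by (auto simp: gap_left_def gap_right_def)
  have "ext N i (ext N j E) = Config (nl F) (nr F) (surgery ?a ?b (mt (ext N j E)))"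
    using i unfolding ext_def[of N i] join_def[of N i] gi by (simp add: cap_def extj join_def)
  moreover have "surgery ?a ?b (mt (ext N j E)) = mt F" unfolding mtj using br(1,2) by simp
  ultimately show "ext N i (ext N j E) = cap N j E" by (simp only: F_def config.collapse)
  show "\<not> loop_at N i (ext N j E)" using br mtj by (auto simp: loop_at_def)
  show "\<not> loop_at N j E"
  proof
    assume "loop_at N j E"
    then have "mt F (gap_left j F) = gap_right N j F" using loop_at_cap[OF p jN] by (simp add: F_def)
    moreover from this have "mt F (gap_right N j F) = gap_left j F" using pairing_mt[OF pF] by metis
    ultimately have "mt F c = (if j = Suc i then ?b else ?a)"
      using i j by (auto simp: c_def gap_left_def gap_right_def)
    moreover have "mt F ?b = ?a" using ab pairing_mt[OF pF] by metis
    ultimately show False using ab ne pairing_mt_eq[OF pF] by (metis)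
  qed
qed

lemma cap_commute: "i \<noteq> j \<Longrightarrow> cap N i (cap N j c) = cap N j (cap N i c)"
  by (auto simp: cap_def cap_left_def cap_right_def)

lemma gap_cap: "i \<noteq> j \<Longrightarrow> gap_left j (cap N i c) = gap_left j c" "i \<noteq> j \<Longrightarrow> gap_right N j (cap N i c) = gap_right N j c"
  by (auto simp: cap_def cap_left_def cap_right_def gap_left_def gap_right_def)

lemma gap_join: "gap_left j (join N i c) = gap_left j c" "gap_right N j (join N i c) = gap_right N j c"
  by (auto simp: join_def gap_left_def gap_right_def)

lemma cap_join:
  assumes p: "pairing N c" and ij: "i \<noteq> j" "i \<le> N" "1 \<le> N"
    and g: "gap_left j c \<in> pts N (nl c) (nr c)" "gap_right N j c \<in> pts N (nl c) (nr c)"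
  shows "cap N i (join N j c) = join N j (cap N i c)"
proof -
  let ?a = "gap_left j c" and ?b = "gap_right N j c"
  have "surgery ?a ?b ((mt c)(u := v, v := u)) = (surgery ?a ?b (mt c))(u := v, v := u)"
    if "u \<notin> pts N (nl c) (nr c)" "v \<notin> pts N (nl c) (nr c)" for u v
  proof -
    have "u \<noteq> ?a" "u \<noteq> ?b" "v \<noteq> ?a" "v \<noteq> ?b" using that g by auto
    moreover have "mt c ?a \<noteq> u" "mt c ?a \<noteq> v" "mt c ?b \<noteq> u" "mt c ?b \<noteq> v"
      using that g pairing_mt_pts[OF p] by metis+
    ultimately show ?thesis by (auto simp: surgery_def fun_eq_iff)
  qed
  then have s: "surgery ?a ?b ((mt c)(Lft (nl c) := Lft (Suc (nl c)), Lft (Suc (nl c)) := Lft (nl c))) =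
      (surgery ?a ?b (mt c))(Lft (nl c) := Lft (Suc (nl c)), Lft (Suc (nl c)) := Lft (nl c))"
    "surgery ?a ?b ((mt c)(Rgt (nr c) := Rgt (Suc (nr c)), Rgt (Suc (nr c)) := Rgt (nr c))) =
      (surgery ?a ?b (mt c))(Rgt (nr c) := Rgt (Suc (nr c)), Rgt (Suc (nr c)) := Rgt (nr c))"
    by simp_all
  show ?thesis
    unfolding join_def[of N j] gap_cap[OF ij(1)] using s by (auto simp: cap_def cap_left_def cap_right_def)
qed

text \<open>Both returns can be added first, since \<open>cap\<close> and \<open>join\<close> at
  different gaps do not interfere; what remains is two surgeries. Gaps more than one apart have no
  point in common, which makes the four points distinct.\<close>

lemma ext_commute:
  assumes p: "pairing N c" and ij: "i \<le> N" "j \<le> N" "Suc i < j \<or> Suc j < i"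
  shows "ext N i (ext N j c) = ext N j (ext N i c)"
    "of_bool (loop_at N i c) + of_bool (loop_at N j (ext N i c)) =
      (of_bool (loop_at N j c) + of_bool (loop_at N i (ext N j c)) :: nat)"
proof -
  have N: "1 \<le> N" "i \<noteq> j" "j \<noteq> i" using ij by auto
  define F where "F = cap N i (cap N j c)"
  have F: "F = cap N j (cap N i c)" using cap_commute[OF N(2)] by (simp add: F_def)
  have pF: "pairing N F" using pairing_cap p by (simp add: F_def)
  let ?a = "gap_left i F" and ?b = "gap_right N i F" and ?c = "gap_left j F" and ?d = "gap_right N j F"
  have gi: "gap_left i (cap N i c) = ?a" "gap_right N i (cap N i c) = ?b" unfolding F using gap_cap[of j i] N by auto
  have gj: "gap_left j (cap N j c) = ?c" "gap_right N j (cap N j c) = ?d" unfolding F_def using gap_cap[of i j] N by auto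
  have mem: "?a \<in> pts N (nl F) (nr F)" "?b \<in> pts N (nl F) (nr F)" "?c \<in> pts N (nl F) (nr F)" "?d \<in> pts N (nl F) (nr F)"
    using gap_in_pts(1,2)[OF ij(1) N(1), of "cap N j c"] gap_in_pts(1,2)[OF ij(2) N(1), of "cap N i c"]
    by (simp_all add: F[symmetric] F_def[symmetric])
  then have fx: "mt F ?a \<noteq> ?a" "mt F ?b \<noteq> ?b" "mt F ?c \<noteq> ?c" "mt F ?d \<noteq> ?d"
    using pairing_fix[OF pF] by blast+
  have ne: "?a \<noteq> ?b" "?a \<noteq> ?c" "?a \<noteq> ?d" "?b \<noteq> ?c" "?b \<noteq> ?d" "?c \<noteq> ?d"
    using ij by (auto simp: gap_left_def gap_right_def)
  have capi: "cap N i (ext N j c) = join N j F"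
    unfolding ext_def F_def
    using gap_in_pts(1,2)[OF ij(2) N(1)] by (intro cap_join pairing_cap p N ij)
  have capj: "cap N j (ext N i c) = join N i F"
    unfolding ext_def F
    using gap_in_pts(1,2)[OF ij(1) N(1)] by (intro cap_join pairing_cap p N ij)
  have "ext N i (ext N j c) = join N i (join N j F)" "ext N j (ext N i c) = join N j (join N i F)"
    using capi capj by (simp_all add: ext_def[of N i "ext N j c"] ext_def[of N j "ext N i c"])
  then show "ext N i (ext N j c) = ext N j (ext N i c)"
    using surgery_commute[OF pairing_mt[OF pF] fx ne]
    by (simp add: join_def[of N i "join N j F"] join_def[of N j "join N i F"] gap_join) (simp add: join_def)
  have "loop_at N i c \<longleftrightarrow> mt F ?a = ?b"
  proof -
    have "loop_at N i c \<longleftrightarrow> loop_at N i (cap N j c)"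
      using N by (auto simp: loop_at_def cap_def cap_left_def cap_right_def)
    then show ?thesis using loop_at_cap[OF pairing_cap[OF p] ij(1) N(1)] by (simp add: F_def)
  qed
  moreover have "loop_at N j c \<longleftrightarrow> mt F ?c = ?d"
  proof -
    have "loop_at N j c \<longleftrightarrow> loop_at N j (cap N i c)"
      using N by (auto simp: loop_at_def cap_def cap_left_def cap_right_def)
    then show ?thesis using loop_at_cap[OF pairing_cap[OF p] ij(2) N(1)] by (simp add: F)
  qed
  moreover have "loop_at N j (ext N i c) \<longleftrightarrow> surgery ?a ?b (mt F) ?c = ?d"
    using loop_at_cap[OF pairing_ext[OF p ij(1) N(1)] ij(2) N(1)] capj by (simp add: gap_join) (simp add: join_def)
  moreover have "loop_at N i (ext N j c) \<longleftrightarrow> surgery ?c ?d (mt F) ?a = ?b"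
    using loop_at_cap[OF pairing_ext[OF p ij(2) N(1)] ij(1) N(1)] capi by (simp add: gap_join) (simp add: join_def)
  ultimately show "of_bool (loop_at N i c) + of_bool (loop_at N j (ext N i c)) =
      (of_bool (loop_at N j c) + of_bool (loop_at N i (ext N j c)) :: nat)"
    using surgery_loops_commute[OF pairing_mt[OF pF] fx ne] by simp
qed

text \<open>Value of a word on a diagram that need not be reduced, with the weight of its returns
  included. By \<open>val_simps\<close> a letter then acts as plain \<open>ext\<close> with a loop
  factor and reduction is postponed to the end, so the relations can be checked on unreduced
  diagrams.\<close>

definition val :: "nat \<Rightarrow> config \<Rightarrow> nat list \<Rightarrow> coeff \<times> config" where
  "val N E u = (weight E * fst (act N (nf N E) u), snd (act N (nf N E) u))"

lemma val_simps:
  "val N E [] = (weight E, nf N E)"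
  "planar_config N E \<Longrightarrow> k \<le> N \<Longrightarrow> 1 \<le> N \<Longrightarrow>
    val N E (k # u) = (indet Delta ^ of_bool (loop_at N k E) * fst (val N (ext N k E) u), snd (val N (ext N k E) u))"
proof -
  assume E: "planar_config N E" "k \<le> N" "1 \<le> N"
  then have p: "pairing N E" by (simp add: planar_config_def)
  show "val N E (k # u) = (indet Delta ^ of_bool (loop_at N k E) * fst (val N (ext N k E) u), snd (val N (ext N k E) u))"
    using weight_ext[OF E] nf_ext_nf[OF p E(2,3)] loop_at_nf[OF p]
    by (simp add: val_def act1_def mult_ac)
qed (simp add: val_def)

lemma act_eq_val: "c \<in> reduced_configs N \<Longrightarrow> act N c u = val N c u"
  using weight_reduced nf_reduced by (simp add: val_def reduced_configs_def planar_config_def)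

lemma val_relation:
  assumes "2 \<le> N" "(l, w, r) \<in> tl2_rewrites N" "planar_config N D"
  shows "val N D l = (w * fst (val N D r), snd (val N D r))"
  using assms(2)
proof (cases rule: tl2_rewrites.cases)
  case (square i)
  have i: "0 < i" "i < N" "i \<le> N" "1 \<le> N" using square assms(1) by auto
  have E: "planar_config N (ext N i D)" using planar_config_ext assms(3) i by blast
  have "ext N i (ext N i D) = ext N i D" "loop_at N i (ext N i D)"
    using ext_square_inner[OF _ cup_at_ext i(1,2)] E i by (auto simp: planar_config_def)
  then show ?thesis using square i E assms(3) by (simp add: val_simps mult_ac)
next
  case square_0
  have E: "planar_config N (ext N 0 D)" using planar_config_ext assms by simp
  have "\<not> loop_at N 0 c" for c by (simp add: loop_at_def)
  then show ?thesis
    using square_0 assms E ext_square_left[OF E cup_at_ext] by (simp add: val_simps)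
next
  case square_N
  have E: "planar_config N (ext N N D)" using planar_config_ext assms by simp
  have "\<not> loop_at N N c" for c by (simp add: loop_at_def)
  then show ?thesis
    using square_N assms E ext_square_right[OF E cup_at_ext] by (simp add: val_simps)
next
  case (braid i j)
  have i: "0 < i" "i < N" "i \<le> N" "1 \<le> N" "j \<le> N" using braid assms(1) by auto
  have j: "j = Suc i \<or> i = Suc j" using braid by simp
  have E: "planar_config N (ext N i D)" using planar_config_ext assms(3) i by blast
  have F: "planar_config N (ext N j (ext N i D))" using planar_config_ext E i by blast
  have p: "pairing N (ext N i D)" using E by (simp add: planar_config_def)
  note br = ext_braid[OF p cup_at_ext[OF i(3,4)] i(1,2) j]
  show ?thesis
    using braid i E F assms(3) br nf_cap[OF E, of j] by (simp add: val_simps)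
next
  case (commute i j)
  have N: "1 \<le> N" using assms(1) by simp
  have p: "pairing N D" using assms(3) by (simp add: planar_config_def)
  have E: "planar_config N (ext N i D)" "planar_config N (ext N j D)"
    using planar_config_ext assms(3) commute N by auto
  show ?thesis
    using commute N E assms(3) ext_commute[OF p, of i j]
    by (simp add: val_simps power_add[symmetric] mult.assoc[symmetric] add.commute)
qed

lemma act_reduces:
  assumes "reduces N u c v" "2 \<le> N" "D \<in> reduced_configs N"
  shows "act N D u = (c * fst (act N D v), snd (act N D v))"
  using assms(1,3)
proof (induction arbitrary: D rule: reduces.induct)
  case (rw_refl u)
  then show ?case by simp
next
  case (rw_step l c r x y)
  let ?D = "snd (act N D x)"
  have D: "?D \<in> reduced_configs N" using snd_act_reduced_configs rw_step(2,4) assms(2) by auto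
  then have "planar_config N ?D" by (simp add: reduced_configs_def)
  from val_relation[OF assms(2) rw_step(1) this]
  have "act N ?D l = (c * fst (act N ?D r), snd (act N ?D r))" using act_eq_val[OF D] by simp
  then show ?case by (simp add: act_append prod_eq_iff mult_ac)
next
  case (rw_trans u c v d w)
  then show ?case by (simp add: mult.assoc)
qed


section \<open>Diagrams of alternating words\<close>

text \<open>The occurrences of \<open>b\<close> fill the places between those of \<open>a\<close>,
  so the end letters fix the difference of the two counts. This passes from the number of letters
  \<open>i\<close> to that of letters \<open>Suc i\<close>.\<close>

lemma length_two_letters:
  assumes "distinct_adj w" "set w \<subseteq> {a, b}" "a \<noteq> b" "w \<noteq> []"
  shows "length w + of_bool (hd w = a) + of_bool (last w = a) = 2 * count_list w a + 1"
  using assms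
proof (induction w rule: induct_list012)
  case (3 x y zs)
  then show ?case by (auto split: if_splits)
qed auto

lemma two_letters_eq:
  assumes "length w = length w'" "distinct_adj w" "distinct_adj w'" "set w \<subseteq> {a, b}" "set w' \<subseteq> {a, b}"
    "w \<noteq> [] \<Longrightarrow> hd w = hd w'"
  shows "w = w'"
  using assms
proof (induction w w' rule: list_induct2)
  case (Cons x xs y ys)
  have "xs \<noteq> [] \<Longrightarrow> hd xs = hd ys"
    using Cons.prems Cons.hyps by (cases xs; cases ys) auto
  then have "xs = ys" using Cons.prems by (intro Cons.IH) (auto simp: distinct_adj_Cons)
  then show ?case using Cons.prems by simp
qed simp

lemma count_list_filter: "P a \<Longrightarrow> count_list (filter P u) a = count_list u a"
  by (induction u) auto

lemma hd_last_proj: "proj i u \<noteq> [] \<Longrightarrow> (hd (proj i u) = i \<or> hd (proj i u) = Suc i) \<and>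
    (last (proj i u) = i \<or> last (proj i u) = Suc i)"
  using hd_in_set[of "proj i u"] last_in_set[of "proj i u"] by auto

text \<open>The side on which the partner of \<open>Top i\<close> or \<open>Bot i\<close> lies is read off from the extreme
  letters of the projection to \<open>{i, Suc i}\<close>; without such letters the line is vertical.\<close>

definition tracks :: "nat \<Rightarrow> nat list \<Rightarrow> config \<Rightarrow> bool" where
  "tracks N u c \<longleftrightarrow> nl c = 2 * count_list u 0 \<and> (\<forall>i<N.
     (proj i u = [] \<longleftrightarrow> col N (mt c (Top i)) = Suc i) \<and>
     (proj i u \<noteq> [] \<and> last (proj i u) = i \<longleftrightarrow> col N (mt c (Top i)) < Suc i) \<and>
     (proj i u = [] \<longleftrightarrow> col N (mt c (Bot i)) = Suc i) \<and>
     (proj i u \<noteq> [] \<and> hd (proj i u) = i \<longleftrightarrow> col N (mt c (Bot i)) < Suc i))"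

text \<open>Induction along the letters: the number of letters \<open>i\<close> and the end letters
  determine the projection to \<open>i\<close>, \<open>Suc i\<close>, hence the number of letters
  \<open>Suc i\<close>, which starts the next pair. The left side of the diagram provides the number
  of letters \<open>0\<close>.\<close>

lemma tracks_inject:
  assumes "tracks N u c" "tracks N v c" "alternating N u" "alternating N v" "i < N"
  shows "proj i u = proj i v"
proof -
  have main: "proj i u = proj i v" if i: "i < N" "count_list u i = count_list v i" for i
  proof -
    note U = assms(1)[unfolded tracks_def, THEN conjunct2, rule_format, OF i(1)]
      and V = assms(2)[unfolded tracks_def, THEN conjunct2, rule_format, OF i(1)]
    have empty: "proj i u = [] \<longleftrightarrow> proj i v = []" using U V by blast
    show ?thesis
    proof (cases "proj i u = []")
      case True
      then show ?thesis using empty by simp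
    next
      case False
      then have ne: "proj i u \<noteq> []" "proj i v \<noteq> []" using empty by auto
      have hd: "hd (proj i u) = hd (proj i v)"
      proof (cases "hd (proj i u) = i")
        case True
        then have "hd (proj i v) = i" using U V ne by blast
        then show ?thesis using True by simp
      next
        case False
        then have "hd (proj i v) \<noteq> i" using U V ne by blast
        then show ?thesis using False hd_last_proj[OF ne(1)] hd_last_proj[OF ne(2)] by auto
      qed
      have last: "last (proj i u) = i \<longleftrightarrow> last (proj i v) = i"
        using U V ne by blast
      have d: "distinct_adj (proj i u)" "distinct_adj (proj i v)"
        using assms(3,4) i(1) by (auto simp: alternating_def)
      have s: "set (proj i u) \<subseteq> {i, Suc i}" "set (proj i v) \<subseteq> {i, Suc i}" by auto
      have "length (proj i u) = length (proj i v)"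
        using length_two_letters[OF d(1) s(1) _ ne(1)] length_two_letters[OF d(2) s(2) _ ne(2)] hd last i(2)
        by (simp add: count_list_filter)
      then show ?thesis using two_letters_eq[OF _ d s] hd by blast
    qed
  qed
  have "count_list u i = count_list v i" using assms(5)
  proof (induction i)
    case 0
    then show ?case using assms(1,2) by (simp add: tracks_def)
  next
    case (Suc i)
    then have "proj i u = proj i v" using main by simp
    then have "count_list (proj i u) (Suc i) = count_list (proj i v) (Suc i)" by simp
    then show ?case by (simp add: count_list_filter)
  qed
  then show ?thesis using main assms(5) by blast
qed

text \<open>When \<open>k\<close> is appended, alternation says that \<open>k\<close> is not the
  last letter of its projections. By \<open>tracks\<close> the line at the left gap point therefore
  stays left of the gap, and that at the right gap point stays right of it. So the two points are
  not joined, and the line linking their partners crosses the gap: neither a loop nor a return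
  arises.\<close>

lemma alternating_tracks:
  assumes "alternating N u" "1 \<le> N"
  shows "fst (act N (id_config N) u) = 1 \<and> tracks N u (snd (act N (id_config N) u))"
  using assms(1)
proof (induction u rule: rev_induct)
  case Nil
  then show ?case by (simp add: tracks_def)
next
  case (snoc k u)
  have alt: "alternating N u" and k: "k \<le> N" and u: "u \<in> lists {0..N}"
    using snoc.prems by (auto simp: alternating_def distinct_adj_append_iff)
  define c where "c = snd (act N (id_config N) u)"
  have IH: "fst (act N (id_config N) u) = 1" "tracks N u c" using snoc.IH[OF alt] by (auto simp: c_def)
  have c: "c \<in> reduced_configs N" unfolding c_def by (rule snd_act_reduced_configs[OF id_in_reduced_configs u assms(2)])
  then have p: "pairing N c" and red: "reduced c" and pl: "planar_config N c"
    by (auto simp: reduced_configs_def planar_config_def)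
  define F where "F = cap N k c"
  have pF: "pairing N F" using pairing_cap[OF p] by (simp add: F_def)
  define a b where "a = gap_left k F" and "b = gap_right N k F"
  define s where "s = mt F"
  have ss: "s (s x) = x" for x using pF by (simp add: s_def)
  have F_top: "s (Top i) = mt c (Top i)" "s (Bot i) = mt c (Bot i)" for i
    by (auto simp: s_def F_def cap_def cap_left_def cap_right_def)
  have "a \<in> pts N (nl F) (nr F)" "b \<in> pts N (nl F) (nr F)"
    unfolding a_def b_def F_def by (rule gap_in_pts[OF k assms(2)])+
  then have "s a \<noteq> a" "s b \<noteq> b" using pairing_fix[OF pF] unfolding s_def by blast+
  moreover have "col N a = k" "col N b = Suc k" using k by (auto simp: a_def b_def gap_left_def gap_right_def)
  ultimately have ab: "a \<noteq> b" "s a \<noteq> a" "s b \<noteq> b" "col N a = k" "col N b = Suc k" by auto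
  have last_ne: "last (proj i u) \<noteq> k" if "i < N" "k = i \<or> k = Suc i" "proj i u \<noteq> []" for i
    using snoc.prems that by (auto simp: alternating_def distinct_adj_append_iff)
  have colp: "col N (s a) \<le> k"
  proof (cases "k = 0")
    case True
    then show ?thesis by (simp add: a_def s_def F_def cap_def cap_left_def gap_left_def)
  next
    case False
    then have i: "k - 1 < N" "a = Top (k - 1)" using k by (auto simp: a_def gap_left_def)
    have "last (proj (k - 1) u) = k - 1" if "proj (k - 1) u \<noteq> []"
      using last_ne[OF i(1) _ that] hd_last_proj[OF that] False by auto
    then have "col N (mt c (Top (k - 1))) \<le> k"
      using IH(2)[unfolded tracks_def, THEN conjunct2, rule_format, OF i(1)] False
      by (cases "proj (k - 1) u = []") auto
    then show ?thesis using F_top i by simp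
  qed
  have colq: "Suc k \<le> col N (s b)"
  proof (cases "k = N")
    case True
    then show ?thesis using assms(2) by (simp add: b_def s_def F_def cap_def cap_right_def gap_right_def)
  next
    case False
    then have i: "k < N" "b = Top k" using k by (auto simp: b_def gap_right_def)
    have "\<not> (proj k u \<noteq> [] \<and> last (proj k u) = k)" using last_ne[OF i(1)] by blast
    then have "\<not> col N (mt c (Top k)) < Suc k" using IH(2) i(1) unfolding tracks_def by blast
    then show ?thesis using F_top i by simp
  qed
  have sab: "s a \<noteq> b" using colp ab by auto
  define t where "t = surgery a b s"
  note t = surgery_values(1-5)[OF ss ab(1-3) sab, folded t_def]
  have ext: "ext N k c = Config (nl F) (nr F) t"
    by (simp add: ext_def join_def F_def t_def a_def b_def s_def)
  have F_left: "i = j" if "s (Lft i) = Lft j" "Lft i \<noteq> a" "Lft i \<noteq> s a" for i j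
  proof -
    have "mt c (Lft i) = Lft j"
      using that by (auto simp: s_def F_def a_def cap_def cap_left_def cap_right_def gap_left_def split: if_splits)
    then show ?thesis using red by (simp add: reduced_def)
  qed
  have F_right: "i = j" if "s (Rgt i) = Rgt j" "Rgt i \<noteq> b" "Rgt i \<noteq> s b" for i j
  proof -
    have "mt c (Rgt i) = Rgt j"
      using that assms(2) by (auto simp: s_def F_def b_def cap_def cap_left_def cap_right_def gap_right_def split: if_splits)
    then show ?thesis using red by (simp add: reduced_def)
  qed
  have "reduced (ext N k c)"
    unfolding ext reduced_def config.sel
  proof (intro conjI allI impI)
    fix i j
    show "i = j" if tij: "t (Lft i) = Lft j"
    proof -
      have "Lft i \<noteq> a" using tij t(1) ab(5) by auto
      moreover have "Lft i \<noteq> b" using ab(5) by (cases b) auto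
      moreover have "Lft i \<noteq> s a" using tij t(3) colq by auto
      moreover have "Lft i \<noteq> s b" using colq by (cases "s b") auto
      ultimately show ?thesis using F_left[of i j] t(5)[of "Lft i"] tij by simp
    qed
    show "i = j" if tij: "t (Rgt i) = Rgt j"
    proof -
      have "Rgt i \<noteq> a" using ab(4) k by (cases a) auto
      moreover have "Rgt i \<noteq> b" using tij t(2) ab(4) k by auto
      moreover have "Rgt i \<noteq> s a" using colp k by (cases "s a") auto
      moreover have "Rgt i \<noteq> s b" using tij t(4) colp k by auto
      ultimately show ?thesis using F_right[of i j] t(5)[of "Rgt i"] tij by simp
    qed
  qed
  then have act1: "act1 N k c = (1, ext N k c)"
    using weight_reduced nf_reduced pairing_ext[OF p k assms(2)] loop_at_cap[OF p k assms(2)] sab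
    by (simp add: act1_def s_def a_def b_def F_def)
  \<comment> \<open>Apart from the gap points only \<open>s a\<close> and \<open>s b\<close> change
    partners. The line at \<open>s a\<close> led right to \<open>a\<close> and now continues further
    right to \<open>s b\<close>, so it keeps its direction unless it was vertical; likewise for
    \<open>s b\<close>.\<close>
  have same: "(col N (t x) < Suc i \<longleftrightarrow> col N (s x) < Suc i) \<and> (col N (t x) = Suc i \<longleftrightarrow> col N (s x) = Suc i)"
    if x: "col N x = Suc i" "x \<noteq> a" "x \<noteq> b" and ki: "col N (s x) \<noteq> Suc i \<or> k \<noteq> i \<and> k \<noteq> Suc i" for x i
  proof -
    consider "x = s a" | "x = s b" | "x \<notin> {a, b, s a, s b}" using x by blast
    then show ?thesis
    proof cases
      case 1
      then have sx: "s x = a" using ss by simp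
      then show ?thesis using 1 sx t(3) ab(4) colp colq ki x by auto
    next
      case 2
      then have sx: "s x = b" using ss by simp
      then show ?thesis using 2 sx t(4) ab(5) colp colq ki x by auto
    next
      case 3
      then show ?thesis using t(5) by simp
    qed
  qed
  have a_top: "a = Top i" if "k = Suc i" for i using that by (simp add: a_def gap_left_def)
  have b_top: "b = Top k" if "k < N" using that by (simp add: b_def gap_right_def)
  have a_ne: "Top i \<noteq> a" if "k \<noteq> Suc i" for i using that by (auto simp: a_def gap_left_def)
  have b_ne: "Top i \<noteq> b" if "k \<noteq> i" for i using that by (auto simp: b_def gap_right_def)
  have bot_ne: "Bot i \<noteq> a" "Bot i \<noteq> b" for i by (auto simp: a_def b_def gap_left_def gap_right_def)
  have tracks: "nl (ext N k c) = 2 * count_list (u @ [k]) 0"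
    using IH(2) by (simp add: tracks_def ext_nl_nr)
  have old: "(proj i u = [] \<longleftrightarrow> col N (s (Top i)) = Suc i) \<and>
     (proj i u \<noteq> [] \<and> last (proj i u) = i \<longleftrightarrow> col N (s (Top i)) < Suc i) \<and>
     (proj i u = [] \<longleftrightarrow> col N (s (Bot i)) = Suc i) \<and>
     (proj i u \<noteq> [] \<and> hd (proj i u) = i \<longleftrightarrow> col N (s (Bot i)) < Suc i)" if "i < N" for i
    using IH(2) that unfolding tracks_def F_top by blast
  have top: "(proj i (u @ [k]) = [] \<longleftrightarrow> col N (t (Top i)) = Suc i) \<and>
     (proj i (u @ [k]) \<noteq> [] \<and> last (proj i (u @ [k])) = i \<longleftrightarrow> col N (t (Top i)) < Suc i)" if i: "i < N" for i
  proof -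
    consider "k = i" | "k = Suc i" | "k \<noteq> i" "k \<noteq> Suc i" by blast
    then show ?thesis
    proof cases
      case 1
      then show ?thesis using b_top i t(2) ab(4) by simp
    next
      case 2
      then show ?thesis using a_top[OF 2] t(1) ab(5) by simp
    next
      case 3
      then have pr: "proj i (u @ [k]) = proj i u" by simp
      have "(col N (t (Top i)) < Suc i \<longleftrightarrow> col N (s (Top i)) < Suc i) \<and>
          (col N (t (Top i)) = Suc i \<longleftrightarrow> col N (s (Top i)) = Suc i)"
        using 3 a_ne[of i] b_ne[of i] by (intro same) auto
      then show ?thesis unfolding pr using old[OF i] by blast
    qed
  qed
  have bot: "(proj i (u @ [k]) = [] \<longleftrightarrow> col N (t (Bot i)) = Suc i) \<and>
     (proj i (u @ [k]) \<noteq> [] \<and> hd (proj i (u @ [k])) = i \<longleftrightarrow> col N (t (Bot i)) < Suc i)" if i: "i < N" for i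
  proof (cases "proj i u = [] \<and> (k = i \<or> k = Suc i)")
    \<comment> \<open>The first of the letters \<open>i\<close>, \<open>Suc i\<close> to occur:
      until now the line at \<open>Bot i\<close> was vertical, and it is redirected to the side that
      this letter prescribes.\<close>
    case True
    then have "col N (s (Bot i)) = Suc i" using old[OF i] by blast
    moreover have "s (Bot i) \<noteq> Bot i" using pairing_fix[OF pF, of "Bot i"] i by (simp add: s_def)
    ultimately have "s (Bot i) = Top i" using i by (cases "s (Bot i)") auto
    then have st: "s (Top i) = Bot i" using ss by metis
    show ?thesis
    proof (cases "k = i")
      case True
      then have "t (Bot i) = s a" using st b_top i t(4) by simp
      then show ?thesis using colp True \<open>proj i u = [] \<and> _\<close> by simp
    next
      case False
      then have "t (Bot i) = s b" using st a_top[of i] t(3) True by simp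
      then show ?thesis using colq False True by simp
    qed
  next
    case False
    then have *: "col N (s (Bot i)) \<noteq> Suc i \<or> k \<noteq> i \<and> k \<noteq> Suc i" using old[OF i] by blast
    have "proj i (u @ [k]) = [] \<longleftrightarrow> proj i u = []" "proj i u \<noteq> [] \<Longrightarrow> hd (proj i (u @ [k])) = hd (proj i u)"
      using False by auto
    moreover have "(col N (t (Bot i)) < Suc i \<longleftrightarrow> col N (s (Bot i)) < Suc i) \<and>
          (col N (t (Bot i)) = Suc i \<longleftrightarrow> col N (s (Bot i)) = Suc i)"
      using same[OF _ bot_ne *] by simp
    moreover note old[OF i]
    ultimately show ?thesis by (cases "proj i u = []") (simp_all only: simp_thms)
  qed
  have "tracks N (u @ [k]) (ext N k c)"
    unfolding tracks_def
  proof (intro conjI[OF tracks] allI impI)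
    fix i assume i: "i < N"
    have "mt (ext N k c) = t" by (simp add: ext)
    then show "(proj i (u @ [k]) = [] \<longleftrightarrow> col N (mt (ext N k c) (Top i)) = Suc i) \<and>
      (proj i (u @ [k]) \<noteq> [] \<and> last (proj i (u @ [k])) = i \<longleftrightarrow> col N (mt (ext N k c) (Top i)) < Suc i) \<and>
      (proj i (u @ [k]) = [] \<longleftrightarrow> col N (mt (ext N k c) (Bot i)) = Suc i) \<and>
      (proj i (u @ [k]) \<noteq> [] \<and> hd (proj i (u @ [k])) = i \<longleftrightarrow> col N (mt (ext N k c) (Bot i)) < Suc i)"
      using top[OF i] bot[OF i] unfolding \<open>mt (ext N k c) = t\<close> by blast
  qed
  then show ?case using act1 IH(1) by (simp add: act_append c_def[symmetric])
qed


section \<open>Based algebras\<close>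

abbreviation keys where "keys \<equiv> Poly_Mapping.keys"
abbreviation lookup where "lookup \<equiv> Poly_Mapping.lookup"
abbreviation single where "single \<equiv> Poly_Mapping.single"

text \<open>\<open>g u a\<close> is the value on \<open>a\<close> times the basis element
  \<open>u\<close>. With the coefficient as an argument, one scheme serves for maps into any target
  and, nested, for bilinear products.\<close>

definition lin :: "('s \<Rightarrow> 'a :: comm_monoid_add \<Rightarrow> 'b :: comm_monoid_add) \<Rightarrow> ('s \<Rightarrow>\<^sub>0 'a) \<Rightarrow> 'b" where
  "lin g p = (\<Sum>u\<in>keys p. g u (lookup p u))"

lemma lin_superset:
  assumes "finite A" "keys p \<subseteq> A" "\<And>u. g u 0 = 0"
  shows "lin g p = (\<Sum>u\<in>A. g u (lookup p u))"
  unfolding lin_def using assms by (intro sum.mono_neutral_left) (auto simp: in_keys_iff)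

lemma lin_add:
  assumes "\<And>u. g u 0 = 0" "\<And>u a b. g u (a + b) = g u a + g u b"
  shows "lin g (p + q) = lin g p + lin g q"
proof -
  let ?A = "keys p \<union> keys q"
  have "lin g (p + q) = (\<Sum>u\<in>?A. g u (lookup (p + q) u))"
    using assms(1) keys_add[of p q] by (intro lin_superset) auto
  also have "\<dots> = (\<Sum>u\<in>?A. g u (lookup p u)) + (\<Sum>u\<in>?A. g u (lookup q u))"
    by (simp add: lookup_add assms(2) sum.distrib)
  also have "\<dots> = lin g p + lin g q"
    using assms(1) by (simp add: lin_superset[of ?A p g] lin_superset[of ?A q g])
  finally show ?thesis .
qed

lemma lin_single: "g u 0 = 0 \<Longrightarrow> lin g (single u a) = g u a"
  by (cases "a = 0") (simp_all add: lin_def)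

lemma lin_zero [simp]: "lin g 0 = 0"
  by (simp add: lin_def)

lemma poly_mapping_sum_singles:
  fixes p :: "'s \<Rightarrow>\<^sub>0 'a :: comm_monoid_add"
  shows "p = (\<Sum>u\<in>keys p. single u (lookup p u))"
proof (rule poly_mapping_eqI)
  fix k
  have "lookup (\<Sum>u\<in>keys p. single u (lookup p u)) k = (\<Sum>u\<in>keys p. if u = k then lookup p u else 0)"
    unfolding lookup_sum by (intro sum.cong) (auto simp: lookup_single when_def)
  then show "lookup p k = lookup (\<Sum>u\<in>keys p. single u (lookup p u)) k"
    by (auto simp: in_keys_iff)
qed

lemma keys_induct [consumes 1, case_names zero single add]:
  fixes p :: "'s \<Rightarrow>\<^sub>0 'a :: comm_monoid_add"
  assumes "keys p \<subseteq> S" "P 0" "\<And>u a. u \<in> S \<Longrightarrow> P (single u a)" "\<And>p q. P p \<Longrightarrow> P q \<Longrightarrow> P (p + q)"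
  shows "P p"
proof -
  have "P (\<Sum>u\<in>A. single u (lookup p u))" if "finite A" "A \<subseteq> S" for A
    using that by (induction A rule: finite_induct) (use assms in auto)
  then show ?thesis using assms(1) poly_mapping_sum_singles[of p] by (metis finite_keys)
qed

definition scale :: "coeff \<Rightarrow> ('s \<Rightarrow>\<^sub>0 coeff) \<Rightarrow> ('s \<Rightarrow>\<^sub>0 coeff)" where
  "scale c p = Poly_Mapping.map (\<lambda>a. c * a) p"

lemma lookup_scale: "lookup (scale c p) u = c * lookup p u"
  unfolding scale_def by (simp add: Poly_Mapping.map.rep_eq when_def)

lemma keys_scale: "keys (scale c p) \<subseteq> keys p"
  by (auto simp: in_keys_iff lookup_scale)

lemma scale_simps: "scale c 0 = 0" "scale c (single u a) = single u (c * a)" "scale c (p + q) = scale c p + scale c q"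
    "scale (c + d) p = scale c p + scale d p" "scale (c * d) p = scale c (scale d p)" "scale 1 p = p"
  by (auto intro!: poly_mapping_eqI simp: lookup_scale lookup_add lookup_single when_def algebra_simps)

definition mul :: "('s \<Rightarrow> 's \<Rightarrow> coeff \<times> 's) \<Rightarrow> ('s \<Rightarrow>\<^sub>0 coeff) \<Rightarrow> ('s \<Rightarrow>\<^sub>0 coeff) \<Rightarrow> ('s \<Rightarrow>\<^sub>0 coeff)" where
  "mul m p q = lin (\<lambda>u a. lin (\<lambda>v b. single (snd (m u v)) (a * b * fst (m u v))) q) p"

lemma mul_add_right: "mul m p (q + r) = mul m p q + mul m p r"
proof -
  have "lin (\<lambda>v b. single (snd (m u v)) (a * b * fst (m u v))) (q + r) =
      lin (\<lambda>v b. single (snd (m u v)) (a * b * fst (m u v))) q +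
      lin (\<lambda>v b. single (snd (m u v)) (a * b * fst (m u v))) r" for u a
    by (intro lin_add) (simp_all add: single_add algebra_simps)
  then show ?thesis unfolding mul_def by (simp add: lin_def sum.distrib)
qed

lemma mul_add_left: "mul m (p + q) r = mul m p r + mul m q r"
  unfolding mul_def
  by (intro lin_add) (simp_all add: lin_def single_add algebra_simps sum.distrib)

lemma mul_zero [simp]: "mul m 0 q = 0" "mul m p 0 = 0"
  by (simp_all add: mul_def lin_def)

lemma mul_single: "mul m (single u a) (single v b) = single (snd (m u v)) (a * b * fst (m u v))"
  by (simp add: mul_def lin_single)

lemma mul_scale: "mul m (scale c p) q = scale c (mul m p q)" "mul m p (scale c q) = scale c (mul m p q)"
proof -
  have "mul m (scale c p) q = scale c (mul m p q) \<and> mul m p (scale c q) = scale c (mul m p q)"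
  proof (induction p rule: keys_induct[OF subset_UNIV])
    case (2 u a)
    show ?case
      by (induction q rule: keys_induct[OF subset_UNIV])
        (simp_all add: scale_simps mul_add_right mul_single mult_ac)
  qed (simp_all add: scale_simps mul_add_left)
  then show "mul m (scale c p) q = scale c (mul m p q)" "mul m p (scale c q) = scale c (mul m p q)" by auto
qed

lemma based_algebra_simps:
  "carrier (based_algebra S e m) = {p. keys p \<subseteq> S}" "monoid.mult (based_algebra S e m) = mul m"
  "\<one>\<^bsub>based_algebra S e m\<^esub> = single e 1" "\<zero>\<^bsub>based_algebra S e m\<^esub> = 0" "add (based_algebra S e m) = (+)"
  "module.smult (based_algebra S e m) = scale"
  by (simp_all add: based_algebra_def mul_def lin_def scale_def fun_eq_iff)

text \<open>A monoid up to scalars. The last equation is the 2-cocycle condition on the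
  coefficients; with associativity of the basis part it makes the bilinear product
  associative.\<close>

definition twisted_monoid :: "'s set \<Rightarrow> 's \<Rightarrow> ('s \<Rightarrow> 's \<Rightarrow> coeff \<times> 's) \<Rightarrow> bool" where
  "twisted_monoid S e m \<longleftrightarrow> e \<in> S \<and> (\<forall>u\<in>S. m e u = (1, u) \<and> m u e = (1, u)) \<and>
    (\<forall>u\<in>S. \<forall>v\<in>S. snd (m u v) \<in> S) \<and>
    (\<forall>u\<in>S. \<forall>v\<in>S. \<forall>w\<in>S. snd (m (snd (m u v)) w) = snd (m u (snd (m v w))) \<and>
       fst (m u v) * fst (m (snd (m u v)) w) = fst (m v w) * fst (m u (snd (m v w))))"

lemma keys_add_subset: "keys p \<subseteq> S \<Longrightarrow> keys q \<subseteq> S \<Longrightarrow> keys (p + q) \<subseteq> S"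
  using keys_add[of p q] by blast

lemma keys_single_subset: "u \<in> S \<Longrightarrow> keys (single u a) \<subseteq> S"
  by (simp add: keys_single)

lemma keys_mul_subset:
  assumes "twisted_monoid S e m" "keys p \<subseteq> S" "keys q \<subseteq> S"
  shows "keys (mul m p q) \<subseteq> S"
  using assms(2)
proof (induction p rule: keys_induct)
  case (single u a)
  from assms(3) show ?case
  proof (induction q rule: keys_induct)
    case (single v b)
    then show ?case using assms(1) \<open>u \<in> S\<close> unfolding mul_single twisted_monoid_def
      by (intro keys_single_subset) blast
  qed (simp_all add: mul_add_right keys_add_subset)
qed (simp_all add: mul_add_left keys_add_subset)

lemma mul_assoc:
  assumes "twisted_monoid S e m" "keys p \<subseteq> S" "keys q \<subseteq> S" "keys r \<subseteq> S"
  shows "mul m (mul m p q) r = mul m p (mul m q r)"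
  using assms(2)
proof (induction p rule: keys_induct)
  case (single u a)
  from assms(3) show ?case
  proof (induction q rule: keys_induct)
    case (single v b)
    from assms(4) show ?case
    proof (induction r rule: keys_induct)
      case (single w c)
      have "snd (m (snd (m u v)) w) = snd (m u (snd (m v w)))"
        "fst (m u v) * fst (m (snd (m u v)) w) = fst (m v w) * fst (m u (snd (m v w)))"
        using assms(1) \<open>u \<in> S\<close> \<open>v \<in> S\<close> \<open>w \<in> S\<close> unfolding twisted_monoid_def by blast+
      moreover from this(2) have "a * b * fst (m u v) * c * fst (m (snd (m u v)) w) =
          a * (b * c * fst (m v w)) * fst (m u (snd (m v w)))"
        by (metis (no_types, lifting) mult.assoc mult.commute)
      ultimately show ?case by (simp add: mul_single)
    qed (simp_all add: mul_add_right)
  qed (simp_all add: mul_add_left mul_add_right)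
qed (simp_all add: mul_add_left)

lemma mul_unit:
  assumes "twisted_monoid S e m" "keys p \<subseteq> S"
  shows "mul m (single e 1) p = p" "mul m p (single e 1) = p"
  using assms(2)
proof (induction p rule: keys_induct)
  case (single u a)
  have *: "m e u = (1, u)" "m u e = (1, u)" using assms(1) single unfolding twisted_monoid_def by blast+
  { case 1 then show ?case using * by (simp add: mul_single) }
  { case 2 then show ?case using * by (simp add: mul_single) }
qed (simp_all add: mul_add_left mul_add_right)

lemma cring_ground_ring: "cring ground_ring"
  unfolding ground_ring_def by (rule cring_from_type_algebra)

lemma ring_based_algebra:
  assumes tm: "twisted_monoid S e m"
  shows "ring (based_algebra S e m)"
proof (rule ringI)
  have e: "e \<in> S" using tm by (simp add: twisted_monoid_def)
  show "abelian_group (based_algebra S e m)"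
  proof (rule abelian_groupI; unfold based_algebra_simps)
    fix x :: "'a \<Rightarrow>\<^sub>0 coeff" assume "x \<in> {p. keys p \<subseteq> S}"
    then have "keys (- x) \<subseteq> S" by (auto simp: in_keys_iff)
    then show "\<exists>y\<in>{p. keys p \<subseteq> S}. y + x = 0" by (intro bexI[of _ "- x"]) auto
  qed (auto simp: add_ac dest: subsetD[OF keys_add])
  show "monoid (based_algebra S e m)"
    by (rule monoidI; unfold based_algebra_simps)
      (use keys_mul_subset[OF tm] mul_assoc[OF tm] mul_unit[OF tm] e in \<open>auto simp: keys_single\<close>)
qed (simp_all add: based_algebra_simps mul_add_left mul_add_right)

lemma assoc_algebra_based_algebra:
  assumes tm: "twisted_monoid S e m"
  shows "assoc_algebra ground_ring (based_algebra S e m)"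
proof -
  have "module ground_ring (based_algebra S e m)"
  proof (rule moduleI)
    show "abelian_group (based_algebra S e m)" using ring_based_algebra[OF tm] by (rule ring.is_abelian_group)
    show "cring ground_ring" by (rule cring_ground_ring)
    show "a \<odot>\<^bsub>based_algebra S e m\<^esub> x \<in> carrier (based_algebra S e m)"
      if "x \<in> carrier (based_algebra S e m)" for a x
      using that keys_scale[of a x] by (auto simp: based_algebra_simps)
  qed (auto simp: based_algebra_simps scale_simps ground_ring_def ring_of_type_algebra_def)
  then show ?thesis
    unfolding assoc_algebra_def using ring_based_algebra[OF tm]
    by (auto simp: based_algebra_simps mul_scale)
qed


section \<open>The product of diagrams in terms of words\<close>

lemma alternating_unique:
  assumes "2 \<le> N" "alternating N u" "alternating N v"
    "snd (act N (id_config N) u) = snd (act N (id_config N) v)"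
  shows "reduces N u 1 v"
proof (rule reduces_of_proj_eq)
  have N: "1 \<le> N" using assms(1) by simp
  then show "1 \<le> N" .
  show "u \<in> lists {0..N}" "v \<in> lists {0..N}" using assms(2,3) by (auto simp: alternating_def)
  show "proj i u = proj i v" if "i < N" for i
    using tracks_inject[OF _ _ assms(2,3) that] alternating_tracks[OF assms(2) N]
      alternating_tracks[OF assms(3) N] assms(4) by metis
qed

section \<open>Diagrams of words\<close>

definition word_diagram :: "nat \<Rightarrow> nat list \<Rightarrow> coeff \<times> diagram" where
  "word_diagram N u = (fst (act N (id_config N) u), diagram_of (snd (act N (id_config N) u)))"

lemma word_diagram_alternating: "1 \<le> N \<Longrightarrow> alternating N u \<Longrightarrow> fst (word_diagram N u) = 1"
  using alternating_tracks by (simp add: word_diagram_def)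

lemma snd_word_diagram: "1 \<le> N \<Longrightarrow> u \<in> lists {0..N} \<Longrightarrow> snd (word_diagram N u) \<in> reduced_diagrams N"
  using snd_act_reduced_configs id_in_reduced_configs by (auto simp: word_diagram_def reduced_diagrams_eq)

lemma word_diagram_reduces:
  assumes "2 \<le> N" "reduces N u c v"
  shows "word_diagram N u = (c * fst (word_diagram N v), snd (word_diagram N v))"
  using act_reduces[OF assms(2,1) id_in_reduced_configs] by (simp add: word_diagram_def)

lemma word_diagram_unique:
  assumes "2 \<le> N" "alternating N u" "alternating N v" "snd (word_diagram N u) = snd (word_diagram N v)"
  shows "reduces N u 1 v"
proof (rule alternating_unique[OF assms(1-3)])
  have "snd (act N (id_config N) w) \<in> reduced_configs N" if "alternating N w" for w
    using snd_act_reduced_configs[OF id_in_reduced_configs] that assms(1) by (auto simp: alternating_def)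
  then show "snd (act N (id_config N) u) = snd (act N (id_config N) v)"
    using assms inj_on_diagram_of[of N] by (auto simp: word_diagram_def inj_on_def)
qed

lemma alternating_exists:
  assumes "2 \<le> N" "D \<in> reduced_diagrams N"
  shows "\<exists>u. alternating N u \<and> word_diagram N u = (1, D)"
proof -
  obtain b where b: "b \<in> reduced_configs N" "D = diagram_of b" using assms(2) by (auto simp: reduced_diagrams_eq)
  obtain u where u: "u \<in> lists {0..N}" "act N (id_config N) u = (1, b)"
    using reduced_config_word[OF b(1)] assms(1) by auto
  obtain c v where v: "reduces N u c v" "alternating N v" using reduces_alternating[OF assms(1) u(1)] by blast
  have "word_diagram N u = (1, D)" using u b by (simp add: word_diagram_def)
  then have "word_diagram N v = (1, D)"
    using word_diagram_reduces[OF assms(1) v(1)] word_diagram_alternating[OF _ v(2)] assms(1)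
    by (auto simp: prod_eq_iff)
  then show ?thesis using v(2) by blast
qed

text \<open>\<open>reduced_config_word\<close> computes the product only with the particular word
  \<open>u\<close> found by peeling off cups. Both \<open>u\<close> and the given \<open>v\<close>
  reduce to alternating words with the same diagram, which are equivalent by
  \<open>alternating_unique\<close> and so act alike on \<open>a\<close>; the scalar lost from
  \<open>u\<close> is 1, as \<open>u\<close> yields \<open>b\<close> with coefficient 1.\<close>

lemma compose_word_diagram:
  assumes N: "2 \<le> N" and a: "a \<in> reduced_configs N" and v: "v \<in> lists {0..N}"
  shows "fst (act N a v) = fst (word_diagram N v) * fst (compose N (diagram_of a) (snd (word_diagram N v)))"
    "diagram_of (snd (act N a v)) = snd (compose N (diagram_of a) (snd (word_diagram N v)))"
proof -
  define b where "b = snd (act N (id_config N) v)"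
  have b: "b \<in> reduced_configs N" unfolding b_def
    using snd_act_reduced_configs[OF id_in_reduced_configs v] N by simp
  obtain u where u: "u \<in> lists {0..N}" "act N (id_config N) u = (1, b)"
    "compose N (diagram_of a) (diagram_of b) = (fst (act N a u), diagram_of (snd (act N a u)))"
    using reduced_config_word[OF b] a N by auto
  obtain c v' where v': "reduces N v c v'" "alternating N v'" using reduces_alternating[OF N v] by blast
  obtain d u' where u': "reduces N u d u'" "alternating N u'" using reduces_alternating[OF N u(1)] by blast
  have one: "fst (act N (id_config N) v') = 1" "fst (act N (id_config N) u') = 1"
    using alternating_tracks v'(2) u'(2) N by auto
  have V: "act N (id_config N) v = (c, snd (act N (id_config N) v'))"
    using act_reduces[OF v'(1) N id_in_reduced_configs] one by simp
  have U: "act N (id_config N) u = (d, snd (act N (id_config N) u'))"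
    using act_reduces[OF u'(1) N id_in_reduced_configs] one by simp
  have d: "d = 1" using U u(2) by simp
  have "snd (act N (id_config N) u') = snd (act N (id_config N) v')" using U V u(2) by (simp add: b_def)
  from alternating_unique[OF N u'(2) v'(2) this] have "act N a u' = act N a v'"
    using act_reduces[OF _ N a] by simp
  then have "act N a u = act N a v'" using act_reduces[OF u'(1) N a] d by simp
  moreover have "act N a v = (c * fst (act N a v'), snd (act N a v'))" by (rule act_reduces[OF v'(1) N a])
  moreover have "fst (word_diagram N v) = c" "snd (word_diagram N v) = diagram_of b"
    using V by (simp_all add: word_diagram_def b_def)
  ultimately show "fst (act N a v) = fst (word_diagram N v) * fst (compose N (diagram_of a) (snd (word_diagram N v)))"
    "diagram_of (snd (act N a v)) = snd (compose N (diagram_of a) (snd (word_diagram N v)))"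
    using u(3) by simp_all
qed

lemma word_diagram_append:
  assumes "2 \<le> N" "u \<in> lists {0..N}" "v \<in> lists {0..N}"
  shows "fst (word_diagram N (u @ v)) = fst (word_diagram N u) * fst (word_diagram N v) *
      fst (compose N (snd (word_diagram N u)) (snd (word_diagram N v)))"
    "snd (word_diagram N (u @ v)) = snd (compose N (snd (word_diagram N u)) (snd (word_diagram N v)))"
proof -
  have "snd (act N (id_config N) u) \<in> reduced_configs N"
    using snd_act_reduced_configs[OF id_in_reduced_configs assms(2)] assms(1) by simp
  from compose_word_diagram[OF assms(1) this assms(3)] show
    "fst (word_diagram N (u @ v)) = fst (word_diagram N u) * fst (word_diagram N v) *
      fst (compose N (snd (word_diagram N u)) (snd (word_diagram N v)))"
    "snd (word_diagram N (u @ v)) = snd (compose N (snd (word_diagram N u)) (snd (word_diagram N v)))"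
    by (simp_all add: word_diagram_def act_append mult.assoc)
qed

text \<open>Each reduced diagram is the diagram of a word with coefficient 1, and composing such
  diagrams amounts to concatenating the words. Associativity and the cocycle condition thus come
  from evaluating one concatenation of three words with two bracketings.\<close>

lemma twisted_monoid_diagrams:
  assumes N: "2 \<le> N"
  shows "twisted_monoid (reduced_diagrams N) (id_diagram N) (compose N)"
proof -
  have word: "\<exists>u. u \<in> lists {0..N} \<and> word_diagram N u = (1, D)" if "D \<in> reduced_diagrams N" for D
    using alternating_exists[OF N that] by (auto simp: alternating_def)
  have nil: "word_diagram N [] = (1, id_diagram N)" by (simp add: word_diagram_def diagram_of_id_config)
  have comp: "compose N (snd (word_diagram N u)) (snd (word_diagram N v)) = word_diagram N (u @ v)"
    if "u \<in> lists {0..N}" "v \<in> lists {0..N}" "fst (word_diagram N u) = 1" "fst (word_diagram N v) = 1" for u v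
    using word_diagram_append[OF N that(1,2)] that(3,4) by (simp add: prod_eq_iff)
  have N1: "1 \<le> N" using N by simp
  show ?thesis
    unfolding twisted_monoid_def
  proof (intro conjI ballI)
    show "id_diagram N \<in> reduced_diagrams N" using snd_word_diagram[OF N1, of "[]"] nil by simp
  next
    fix D assume "D \<in> reduced_diagrams N"
    then obtain u where u: "u \<in> lists {0..N}" "word_diagram N u = (1, D)" using word by blast
    show "compose N (id_diagram N) D = (1, D)" "compose N D (id_diagram N) = (1, D)"
      using comp[of "[]" u] comp[of u "[]"] u nil by simp_all
  next
    fix D E assume "D \<in> reduced_diagrams N" "E \<in> reduced_diagrams N"
    then obtain u v where "u \<in> lists {0..N}" "word_diagram N u = (1, D)" "v \<in> lists {0..N}" "word_diagram N v = (1, E)"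
      using word by meson
    then show "snd (compose N D E) \<in> reduced_diagrams N"
      using comp[of u v] snd_word_diagram[OF N1, of "u @ v"] by simp
  next
    fix D E F assume "D \<in> reduced_diagrams N" "E \<in> reduced_diagrams N" "F \<in> reduced_diagrams N"
    then obtain u v w where u: "u \<in> lists {0..N}" "word_diagram N u = (1, D)"
      and v: "v \<in> lists {0..N}" "word_diagram N v = (1, E)"
      and w: "w \<in> lists {0..N}" "word_diagram N w = (1, F)"
      using word by meson
    have uv: "compose N D E = word_diagram N (u @ v)" using comp[of u v] u v by simp
    have vw: "compose N E F = word_diagram N (v @ w)" using comp[of v w] v w by simp
    have "word_diagram N ((u @ v) @ w) = word_diagram N (u @ (v @ w))" by simp
    then show "snd (compose N (snd (compose N D E)) F) = snd (compose N D (snd (compose N E F)))"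
      "fst (compose N D E) * fst (compose N (snd (compose N D E)) F) =
       fst (compose N E F) * fst (compose N D (snd (compose N E F)))"
      using word_diagram_append[OF N, of "u @ v" w] word_diagram_append[OF N, of u "v @ w"] u v w uv vw
      by simp_all
  qed
qed

lemma twisted_monoid_words: "twisted_monoid (lists S) [] (\<lambda>u v. (1, u @ v))"
  by (auto simp: twisted_monoid_def)


section \<open>The isomorphism\<close>

lemma mul_diff: "mul m (p - q) r = mul m p r - mul m q r" "mul m r (p - q) = mul m r p - mul m r q"
  using mul_add_left[of m "p - q" q r] mul_add_right[of m r "p - q" q] by (simp_all add: algebra_simps)

lemma scale_diff: "scale c (p - q) = scale c p - scale c q"
  using scale_simps(3)[of c "p - q" q] by (simp add: algebra_simps)

lemma free_algebra_simps:
  "carrier (free_algebra N) = {p. keys p \<subseteq> lists {0..N}}"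
  "monoid.mult (free_algebra N) = mul (\<lambda>u v. (1, u @ v))"
  "\<one>\<^bsub>free_algebra N\<^esub> = single [] 1" "\<zero>\<^bsub>free_algebra N\<^esub> = 0" "add (free_algebra N) = (+)"
  "module.smult (free_algebra N) = scale"
  by (simp_all add: free_algebra_def based_algebra_simps)

lemma diagram_algebra_simps:
  "carrier (diagram_algebra N) = {p. keys p \<subseteq> reduced_diagrams N}"
  "monoid.mult (diagram_algebra N) = mul (compose N)"
  "\<one>\<^bsub>diagram_algebra N\<^esub> = single (id_diagram N) 1" "\<zero>\<^bsub>diagram_algebra N\<^esub> = 0"
  "add (diagram_algebra N) = (+)" "module.smult (diagram_algebra N) = scale"
  by (simp_all add: diagram_algebra_def based_algebra_simps)

lemma ring_free_algebra: "ring (free_algebra N)"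
  unfolding free_algebra_def by (rule ring_based_algebra[OF twisted_monoid_words])

lemma ring_diagram_algebra: "2 \<le> N \<Longrightarrow> ring (diagram_algebra N)"
  unfolding diagram_algebra_def by (rule ring_based_algebra[OF twisted_monoid_diagrams])

lemma free_algebra_minus:
  assumes "p \<in> carrier (free_algebra N)" "q \<in> carrier (free_algebra N)"
  shows "p \<ominus>\<^bsub>free_algebra N\<^esub> q = p - q"
proof -
  interpret ring "free_algebra N" by (rule ring_free_algebra)
  have "- q \<in> carrier (free_algebra N)" using assms(2) by (auto simp: free_algebra_simps in_keys_iff)
  then have "\<ominus>\<^bsub>free_algebra N\<^esub> q = - q"
    using minus_equality[of "- q" q] assms(2) by (simp add: free_algebra_simps)
  then show ?thesis by (simp add: a_minus_def free_algebra_simps)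
qed

section \<open>The ideal of the relations\<close>

lemma tl2_relations_eq:
  assumes "2 \<le> N"
  shows "tl2_relations N = {(single l 1, single r c) | l c r. (l, c, r) \<in> tl2_rewrites N}"
proof -
  have g: "gen i \<otimes>\<^bsub>free_algebra N\<^esub> gen j = single [i, j] 1"
    "single [i, j] 1 \<otimes>\<^bsub>free_algebra N\<^esub> gen i = single [i, j, i] 1"
    "c \<odot>\<^bsub>free_algebra N\<^esub> gen i = single [i] c" for i j c
    by (simp_all add: free_algebra_simps gen_def mul_single scale_simps)
  have far: "\<bar>int i - int j\<bar> > 1 \<longleftrightarrow> Suc i < j \<or> Suc j < i" for i j by auto
  show ?thesis
    unfolding tl2_relations_def Let_def g far
  proof (intro equalityI subsetI)
    fix x
    assume "x \<in> {(single l 1, single r c) | l c r. (l, c, r) \<in> tl2_rewrites N}"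
    then obtain l c r where x: "x = (single l 1, single r c)" "(l, c, r) \<in> tl2_rewrites N" by blast
    from x(2) show "x \<in> {(single [i, i] 1, single [i] (indet Delta)) | i. 1 \<le> i \<and> i \<le> N - 1} \<union>
      {(single [i, j, i] 1, gen i) | i j. 1 \<le> i \<and> i \<le> N - 1 \<and> j \<le> N \<and> (j = i + 1 \<or> i = j + 1)} \<union>
      {(single [0, 0] 1, single [0] (indet S1))} \<union> {(single [N, N] 1, single [N] (indet S2))} \<union>
      {(single [i, j] 1, single [j, i] 1) | i j. i \<le> N \<and> j \<le> N \<and> (Suc i < j \<or> Suc j < i)}"
      (is "x \<in> ?A \<union> ?B \<union> ?C \<union> ?D \<union> ?E")
    proof (cases rule: tl2_rewrites.cases)
      case (square i)
      then have "x \<in> ?A" using x(1) by blast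
      then show ?thesis by blast
    next
      case (braid i j)
      then have "j \<le> N" "j = i + 1 \<or> i = j + 1" by auto
      then have "x \<in> ?B" using braid x(1) unfolding gen_def by blast
      then show ?thesis by blast
    next
      case (commute i j)
      then have "x \<in> ?E" using x(1) by blast
      then show ?thesis by blast
    next
      case square_0
      then show ?thesis using x(1) by simp
    next
      case square_N
      then show ?thesis using x(1) by simp
    qed
  next
    fix x
    assume "x \<in> {(single [i, i] 1, single [i] (indet Delta)) | i. 1 \<le> i \<and> i \<le> N - 1} \<union>
      {(single [i, j, i] 1, gen i) | i j. 1 \<le> i \<and> i \<le> N - 1 \<and> j \<le> N \<and> (j = i + 1 \<or> i = j + 1)} \<union>
      {(single [0, 0] 1, single [0] (indet S1))} \<union> {(single [N, N] 1, single [N] (indet S2))} \<union>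
      {(single [i, j] 1, single [j, i] 1) | i j. i \<le> N \<and> j \<le> N \<and> (Suc i < j \<or> Suc j < i)}"
    then consider i where "x = (single [i, i] 1, single [i] (indet Delta))" "1 \<le> i" "i \<le> N - 1"
      | i j where "x = (single [i, j, i] 1, single [i] 1)" "1 \<le> i" "i \<le> N - 1" "j = Suc i \<or> i = Suc j"
      | "x = (single [0, 0] 1, single [0] (indet S1))" | "x = (single [N, N] 1, single [N] (indet S2))"
      | i j where "x = (single [i, j] 1, single [j, i] 1)" "i \<le> N" "j \<le> N" "Suc i < j \<or> Suc j < i"
      unfolding gen_def by fastforce
    then show "x \<in> {(single l 1, single r c) | l c r. (l, c, r) \<in> tl2_rewrites N}"
      by cases (use tl2_rewrites.intros in blast)+
  qed
qed

lemma tl2_rewrites_lists: "2 \<le> N \<Longrightarrow> (l, c, r) \<in> tl2_rewrites N \<Longrightarrow> l \<in> lists {0..N} \<and> r \<in> lists {0..N}"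
  by (erule tl2_rewrites.cases) auto

lemma tl2_ideal_eq:
  assumes "2 \<le> N"
  shows "tl2_ideal N = Idl\<^bsub>free_algebra N\<^esub> {single l 1 - single r c | l c r. (l, c, r) \<in> tl2_rewrites N}"
proof -
  have "single l 1 \<ominus>\<^bsub>free_algebra N\<^esub> single r c = single l 1 - single r c" if "(l, c, r) \<in> tl2_rewrites N" for l c r
    using tl2_rewrites_lists[OF assms that] by (intro free_algebra_minus) (auto simp: free_algebra_simps keys_single)
  then have "{l \<ominus>\<^bsub>free_algebra N\<^esub> r | l r. (l, r) \<in> tl2_relations N} =
    {single l 1 - single r c | l c r. (l, c, r) \<in> tl2_rewrites N}"
    unfolding tl2_relations_eq[OF assms] by (auto; metis)
  then show ?thesis by (simp add: tl2_ideal_def)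
qed

lemma rewrites_in_carrier:
  assumes "2 \<le> N"
  shows "{single l 1 - single r c | l c r. (l, c, r) \<in> tl2_rewrites N} \<subseteq> carrier (free_algebra N)"
proof -
  have "keys (single l 1 - single r c) \<subseteq> lists {0..N}" if "(l, c, r) \<in> tl2_rewrites N" for l r and c :: coeff
    using tl2_rewrites_lists[OF assms that] by (auto simp: in_keys_iff lookup_minus lookup_single when_def split: if_splits)
  then show ?thesis unfolding free_algebra_simps by blast
qed

lemma ideal_tl2_ideal: "2 \<le> N \<Longrightarrow> ideal (tl2_ideal N) (free_algebra N)"
  unfolding tl2_ideal_eq by (intro ring.genideal_ideal ring_free_algebra rewrites_in_carrier)

lemma tl2_ideal_closed:
  assumes "2 \<le> N"
  shows "p \<in> tl2_ideal N \<Longrightarrow> q \<in> tl2_ideal N \<Longrightarrow> p + q \<in> tl2_ideal N" "0 \<in> tl2_ideal N"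
    "p \<in> tl2_ideal N \<Longrightarrow> keys q \<subseteq> lists {0..N} \<Longrightarrow> mul (\<lambda>u v. (1, u @ v)) q p \<in> tl2_ideal N"
    "p \<in> tl2_ideal N \<Longrightarrow> keys q \<subseteq> lists {0..N} \<Longrightarrow> mul (\<lambda>u v. (1, u @ v)) p q \<in> tl2_ideal N"
    "p \<in> tl2_ideal N \<Longrightarrow> keys p \<subseteq> lists {0..N}"
    "p \<in> tl2_ideal N \<Longrightarrow> scale c p \<in> tl2_ideal N"
proof -
  interpret ideal "tl2_ideal N" "free_algebra N" by (rule ideal_tl2_ideal[OF assms])
  show "p \<in> tl2_ideal N \<Longrightarrow> q \<in> tl2_ideal N \<Longrightarrow> p + q \<in> tl2_ideal N"
    using additive_subgroup.a_closed[OF additive_subgroup_axioms] by (simp add: free_algebra_simps)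
  show "0 \<in> tl2_ideal N" using additive_subgroup.zero_closed[OF additive_subgroup_axioms] by (simp add: free_algebra_simps)
  show mult_l: "p \<in> tl2_ideal N \<Longrightarrow> keys q \<subseteq> lists {0..N} \<Longrightarrow> mul (\<lambda>u v. (1, u @ v)) q p \<in> tl2_ideal N" for p q
    using I_l_closed by (simp add: free_algebra_simps)
  show "p \<in> tl2_ideal N \<Longrightarrow> keys q \<subseteq> lists {0..N} \<Longrightarrow> mul (\<lambda>u v. (1, u @ v)) p q \<in> tl2_ideal N"
    using I_r_closed by (simp add: free_algebra_simps)
  show carr: "p \<in> tl2_ideal N \<Longrightarrow> keys p \<subseteq> lists {0..N}" for p
    using a_subset by (auto simp: free_algebra_simps)
  show "scale c p \<in> tl2_ideal N" if p: "p \<in> tl2_ideal N"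
  proof -
    \<comment> \<open>A ring ideal is closed under scalars because scaling by \<open>c\<close> is
      multiplication by \<open>c\<close> times the unit.\<close>
    have "mul (\<lambda>u v. (1, u @ v)) (scale c (single [] 1)) p = scale c p"
      unfolding mul_scale using mul_unit(1)[OF twisted_monoid_words carr[OF p]] by simp
    then show ?thesis using mult_l[OF p, of "scale c (single [] 1)"] by (simp add: scale_simps keys_single)
  qed
qed

text \<open>Differences telescope along a chain: u - c d w is the sum of u - c v and c times v - d
  w.\<close>

lemma reduces_in_ideal:
  assumes "reduces N u c v" "2 \<le> N"
  shows "single u 1 - single v c \<in> tl2_ideal N"
  using assms(1)
proof (induction rule: reduces.induct)
  case (rw_refl u)
  then show ?case using tl2_ideal_closed(2)[OF assms(2)] by simp
next
  case (rw_step l c r x y)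
  have "single l 1 - single r c \<in> tl2_ideal N"
    unfolding tl2_ideal_eq[OF assms(2)]
    using ring.genideal_self[OF ring_free_algebra rewrites_in_carrier[OF assms(2)]] rw_step(1) by blast
  moreover have "keys (single x (1 :: coeff)) \<subseteq> lists {0..N}" "keys (single y (1 :: coeff)) \<subseteq> lists {0..N}"
    using rw_step by (auto simp: keys_single)
  ultimately have "mul (\<lambda>u v. (1, u @ v)) (mul (\<lambda>u v. (1, u @ v)) (single x 1) (single l 1 - single r c)) (single y 1)
      \<in> tl2_ideal N"
    using tl2_ideal_closed(3,4)[OF assms(2)] by simp
  then show ?case by (simp add: mul_diff mul_single)
next
  case (rw_trans u c v d w)
  have "single u 1 - single v c + scale c (single v 1 - single w d) \<in> tl2_ideal N"
    using rw_trans.IH tl2_ideal_closed(1,6)[OF assms(2)] by simp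
  then show ?case by (simp add: scale_simps scale_diff)
qed

section \<open>The homomorphism from words to diagrams and its kernel\<close>

definition word_map :: "nat \<Rightarrow> (nat list \<Rightarrow>\<^sub>0 coeff) \<Rightarrow> (diagram \<Rightarrow>\<^sub>0 coeff)" where
  "word_map N = lin (\<lambda>u a. single (snd (word_diagram N u)) (a * fst (word_diagram N u)))"

lemma word_map_simps:
  "word_map N 0 = 0" "word_map N (p + q) = word_map N p + word_map N q"
  "word_map N (single u a) = single (snd (word_diagram N u)) (a * fst (word_diagram N u))"
  unfolding word_map_def
  by (simp, intro lin_add, simp_all add: single_add algebra_simps lin_single)

lemma word_map_diff: "word_map N (p - q) = word_map N p - word_map N q"
  using word_map_simps(2)[of N "p - q" q] by (simp add: algebra_simps)

lemma word_map_scale: "word_map N (scale c p) = scale c (word_map N p)"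
  by (induction p rule: keys_induct[OF subset_UNIV]) (simp_all add: scale_simps word_map_simps mult.assoc)

lemma keys_word_map:
  assumes "1 \<le> N" "keys p \<subseteq> lists {0..N}"
  shows "keys (word_map N p) \<subseteq> reduced_diagrams N"
  using assms(2)
proof (induction p rule: keys_induct)
  case (single u a)
  show ?case unfolding word_map_simps by (rule keys_single_subset[OF snd_word_diagram[OF assms(1) single]])
qed (simp_all add: word_map_simps keys_add_subset)

lemma word_map_mul:
  assumes "2 \<le> N" "keys p \<subseteq> lists {0..N}" "keys q \<subseteq> lists {0..N}"
  shows "word_map N (mul (\<lambda>u v. (1, u @ v)) p q) = mul (compose N) (word_map N p) (word_map N q)"
  using assms(2)
proof (induction p rule: keys_induct)
  case (single u a)
  from assms(3) show ?case
  proof (induction q rule: keys_induct)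
    case (single v b)
    then show ?case using word_diagram_append[OF assms(1) \<open>u \<in> _\<close> single]
      by (simp add: mul_single word_map_simps mult_ac)
  qed (simp_all add: mul_add_right word_map_simps)
qed (simp_all add: mul_add_left word_map_simps)

lemma word_map_surj:
  assumes "2 \<le> N" "keys p \<subseteq> reduced_diagrams N"
  shows "\<exists>q. keys q \<subseteq> lists {0..N} \<and> word_map N q = p"
  using assms(2)
proof (induction p rule: keys_induct)
  case zero
  then show ?case by (intro exI[of _ 0]) (simp add: word_map_simps)
next
  case (single D a)
  obtain u where "alternating N u" "word_diagram N u = (1, D)" using alternating_exists[OF assms(1) single] by blast
  then show ?case by (intro exI[of _ "single u a"]) (auto simp: word_map_simps alternating_def keys_single)
next
  case (add p q)
  then obtain p' q' where "keys p' \<subseteq> lists {0..N}" "word_map N p' = p" "keys q' \<subseteq> lists {0..N}" "word_map N q' = q" by blast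
  then show ?case by (intro exI[of _ "p' + q'"]) (simp add: word_map_simps keys_add_subset)
qed

lemma word_map_hom:
  assumes "2 \<le> N"
  shows "ring_hom_ring (free_algebra N) (diagram_algebra N) (word_map N)"
proof (rule ring_hom_ringI[OF ring_free_algebra ring_diagram_algebra[OF assms]])
  show "word_map N x \<in> carrier (diagram_algebra N)" if "x \<in> carrier (free_algebra N)" for x
    using that keys_word_map[of N x] assms by (simp add: free_algebra_simps diagram_algebra_simps)
  have "word_diagram N [] = (1, id_diagram N)" by (simp add: word_diagram_def diagram_of_id_config)
  then show "word_map N \<one>\<^bsub>free_algebra N\<^esub> = \<one>\<^bsub>diagram_algebra N\<^esub>"
    by (simp add: free_algebra_simps diagram_algebra_simps word_map_simps)
qed (use word_map_mul[OF assms] in \<open>auto simp: free_algebra_simps diagram_algebra_simps word_map_simps\<close>)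

text \<open>Modulo the ideal, every element is a combination of chosen alternating words, one for each
  diagram.\<close>

lemma word_map_kernel:
  assumes N: "2 \<le> N"
  shows "a_kernel (free_algebra N) (diagram_algebra N) (word_map N) = tl2_ideal N"
proof
  have "word_map N (single l 1 - single r c) = 0" if "(l, c, r) \<in> tl2_rewrites N" for l c r
  proof -
    have "reduces N ([] @ l @ []) c ([] @ r @ [])" using that by (intro reduces.rw_step) auto
    then have "word_diagram N l = (c * fst (word_diagram N r), snd (word_diagram N r))"
      using word_diagram_reduces[OF N] by simp
    then show ?thesis by (simp add: word_map_simps word_map_diff)
  qed
  then have zero: "word_map N x = 0" if "x \<in> {single l 1 - single r c | l c r. (l, c, r) \<in> tl2_rewrites N}" for x
    using that by blast
  have "{single l 1 - single r c | l c r. (l, c, r) \<in> tl2_rewrites N} \<subseteq>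
      a_kernel (free_algebra N) (diagram_algebra N) (word_map N)"
  proof
    fix x :: "nat list \<Rightarrow>\<^sub>0 coeff"
    assume x: "x \<in> {single l 1 - single r c | l c r. (l, c, r) \<in> tl2_rewrites N}"
    then have "x \<in> carrier (free_algebra N)" using rewrites_in_carrier[OF N] by blast
    then show "x \<in> a_kernel (free_algebra N) (diagram_algebra N) (word_map N)"
      using zero[OF x] unfolding a_kernel_def' diagram_algebra_simps by blast
  qed
  then show "tl2_ideal N \<subseteq> a_kernel (free_algebra N) (diagram_algebra N) (word_map N)"
    unfolding tl2_ideal_eq[OF N] by (intro ring.genideal_minimal ring_free_algebra ring_hom_ring.kernel_is_ideal[OF word_map_hom[OF N]])
  define wd where "wd D = (SOME u. alternating N u \<and> word_diagram N u = (1, D))" for D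
  have wd: "alternating N (wd D)" "word_diagram N (wd D) = (1, D)" if "D \<in> reduced_diagrams N" for D
    using someI_ex[OF alternating_exists[OF N that]] by (simp_all add: wd_def)
  \<comment> \<open>An additive section of \<open>word_map\<close> that sends each diagram to its
    chosen word; it is not multiplicative.\<close>
  define rep :: "(diagram \<Rightarrow>\<^sub>0 coeff) \<Rightarrow> (nat list \<Rightarrow>\<^sub>0 coeff)" where "rep = lin (\<lambda>D. single (wd D))"
  have rep: "rep 0 = 0" "rep (p + q) = rep p + rep q" "rep (single D a) = single (wd D) a" for p q D a
    unfolding rep_def by (simp, intro lin_add, simp_all add: single_add lin_single)
  have main: "x - rep (word_map N x) \<in> tl2_ideal N" if "keys x \<subseteq> lists {0..N}" for x
    using that
  proof (induction x rule: keys_induct)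
    case zero
    then show ?case using tl2_ideal_closed(2)[OF N] by (simp add: word_map_simps rep)
  next
    case (single u a)
    obtain c v where v: "reduces N u c v" "alternating N v" using reduces_alternating[OF N single] by blast
    have D: "snd (word_diagram N u) \<in> reduced_diagrams N" using snd_word_diagram[OF _ single] N by simp
    have u: "word_diagram N u = (c, snd (word_diagram N v))"
      using word_diagram_reduces[OF N v(1)] word_diagram_alternating[OF _ v(2)] N by simp
    \<comment> \<open>Both words are alternating and have the same diagram.\<close>
    have "reduces N v 1 (wd (snd (word_diagram N u)))"
      using u wd[OF D] by (intro word_diagram_unique[OF N v(2)]) simp_all
    then have "reduces N u (c * 1) (wd (snd (word_diagram N u)))" by (rule reduces.rw_trans[OF v(1)])
    then have "scale a (single u 1 - single (wd (snd (word_diagram N u))) c) \<in> tl2_ideal N"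
      using reduces_in_ideal[OF _ N] tl2_ideal_closed(6)[OF N] by simp
    then show ?case using u by (simp add: word_map_simps rep scale_simps scale_diff)
  next
    case (add p q)
    have "(p - rep (word_map N p)) + (q - rep (word_map N q)) \<in> tl2_ideal N"
      by (rule tl2_ideal_closed(1)[OF N add])
    then show ?case by (simp add: word_map_simps rep algebra_simps)
  qed
  show "a_kernel (free_algebra N) (diagram_algebra N) (word_map N) \<subseteq> tl2_ideal N"
  proof
    fix x assume "x \<in> a_kernel (free_algebra N) (diagram_algebra N) (word_map N)"
    then have "keys x \<subseteq> lists {0..N}" "word_map N x = 0"
      unfolding a_kernel_def' free_algebra_simps diagram_algebra_simps by blast+
    then show "x \<in> tl2_ideal N" using main[of x] by (simp add: rep)
  qed
qed

lemma tl2_algebra_simps: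
  "carrier (tl2_algebra N) = carrier (free_algebra N Quot tl2_ideal N)"
  "monoid.mult (tl2_algebra N) = monoid.mult (free_algebra N Quot tl2_ideal N)"
  "\<one>\<^bsub>tl2_algebra N\<^esub> = \<one>\<^bsub>free_algebra N Quot tl2_ideal N\<^esub>"
  "add (tl2_algebra N) = add (free_algebra N Quot tl2_ideal N)"
  "c \<odot>\<^bsub>tl2_algebra N\<^esub> K = (\<Union>x\<in>K. tl2_ideal N +>\<^bsub>free_algebra N\<^esub> (scale c x))"
  by (simp_all add: tl2_algebra_def Let_def ring.defs module.defs free_algebra_simps)

text \<open>The union over all representatives collapses: the ideal is closed under scaling, so each
  of them contributes the same coset.\<close>

lemma tl2_algebra_smult_coset:
  assumes N: "2 \<le> N" and x: "x \<in> carrier (free_algebra N)"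
  shows "c \<odot>\<^bsub>tl2_algebra N\<^esub> (tl2_ideal N +>\<^bsub>free_algebra N\<^esub> x) = tl2_ideal N +>\<^bsub>free_algebra N\<^esub> (scale c x)"
proof -
  interpret I: ideal "tl2_ideal N" "free_algebra N" by (rule ideal_tl2_ideal[OF N])
  have coset: "tl2_ideal N +>\<^bsub>free_algebra N\<^esub> y = (\<lambda>i. i + y) ` tl2_ideal N" for y
    by (auto simp: a_r_coset_def' free_algebra_simps)
  have sub: "tl2_ideal N +>\<^bsub>free_algebra N\<^esub> (scale c (i + x)) = tl2_ideal N +>\<^bsub>free_algebra N\<^esub> (scale c x)"
    if i: "i \<in> tl2_ideal N" for i
  proof -
    have "scale c i \<in> tl2_ideal N" using tl2_ideal_closed(6)[OF N i] .
    then have "scale c (i + x) \<in> tl2_ideal N +>\<^bsub>free_algebra N\<^esub> (scale c x)"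
      unfolding coset by (auto simp: scale_simps)
    moreover have "scale c x \<in> carrier (free_algebra N)" using x keys_scale[of c x] by (auto simp: free_algebra_simps)
    ultimately show ?thesis using I.a_repr_independence' by metis
  qed
  have "0 \<in> tl2_ideal N" by (rule tl2_ideal_closed(2)[OF N])
  then show ?thesis unfolding tl2_algebra_simps coset[of x] using sub by auto
qed

theorem proposition3p5:
  fixes N :: nat
  assumes "N \<ge> 2"
  shows "assoc_algebra ground_ring (diagram_algebra N) \<and>
    algebra_isomorphic ground_ring (diagram_algebra N) (tl2_algebra N)"
proof
  show "assoc_algebra ground_ring (diagram_algebra N)"
    unfolding diagram_algebra_def by (rule assoc_algebra_based_algebra[OF twisted_monoid_diagrams[OF assms]])
  let ?F = "free_algebra N" and ?D = "diagram_algebra N" and ?I = "tl2_ideal N"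
  interpret h: ring_hom_ring ?F ?D "word_map N" by (rule word_map_hom[OF assms])
  interpret I: ideal ?I ?F by (rule ideal_tl2_ideal[OF assms])
  have surj: "word_map N ` carrier ?F = carrier ?D"
    using h.hom_closed word_map_surj[OF assms] by (fastforce simp: free_algebra_simps diagram_algebra_simps)
  define f where "f = (\<lambda>K. the_elem (word_map N ` K))"
  have f: "f \<in> ring_iso (?F Quot ?I) ?D"
    using h.FactRing_iso_set[OF surj] unfolding word_map_kernel[OF assms] f_def .
  \<comment> \<open>The homomorphism theorem provides the map from the quotient to the diagrams; the
    claim asks for the opposite direction.\<close>
  define g where "g = inv_into (carrier (?F Quot ?I)) f"
  have g: "g \<in> ring_iso ?D (?F Quot ?I)"
    unfolding g_def by (rule ring_iso_set_sym[OF I.quotient_is_ring f])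
  have coset: "?I +>\<^bsub>?F\<^esub> x \<in> carrier (?F Quot ?I)" if "x \<in> carrier ?F" for x
    using that by (auto simp: FactRing_def A_RCOSETS_def' )
  have "f (?I +>\<^bsub>?F\<^esub> x) = word_map N x" if "x \<in> carrier ?F" for x
    using h.the_elem_simp[OF that] unfolding word_map_kernel[OF assms] f_def .
  then have g_eq: "g (word_map N x) = ?I +>\<^bsub>?F\<^esub> x" if "x \<in> carrier ?F" for x
    using that coset f unfolding g_def ring_iso_def bij_betw_def by (metis (no_types, lifting) inv_into_f_f mem_Collect_eq)
  have "g (c \<odot>\<^bsub>?D\<^esub> p) = c \<odot>\<^bsub>tl2_algebra N\<^esub> g p" if p: "p \<in> carrier ?D" for c p
  proof -
    obtain x where x: "x \<in> carrier ?F" "p = word_map N x" using p surj by blast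
    moreover have "scale c x \<in> carrier ?F" using x(1) keys_scale[of c x] by (auto simp: free_algebra_simps)
    ultimately show ?thesis
      using g_eq tl2_algebra_smult_coset[OF assms] by (simp add: diagram_algebra_simps word_map_scale[symmetric])
  qed
  moreover have "g \<in> ring_iso ?D (tl2_algebra N)"
    using g unfolding ring_iso_def ring_hom_def tl2_algebra_simps by simp
  ultimately have "g \<in> algebra_iso ground_ring ?D (tl2_algebra N)" by (simp add: algebra_iso_def)
  then show "algebra_isomorphic ground_ring ?D (tl2_algebra N)" by (auto simp: algebra_isomorphic_def)
qed

end
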